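(* Let $u_0\in BV(\mathbb{T})$ and let $u$ be the (unique) energy solution of $\partial_t u=(\mathcal{L}(u_x))_x$ in $\mathbb{T}\times(0,T)$, $u(\cdot,0)=u_0$. Then $u$ is also a viscosity solution of $\partial_t u-(W'(u_x))_x=0$ in $(0,T)\times\mathbb{T}$.
   Context: $\mathbb{T}=\mathbb{R}/\mathbb{Z}$ is the one-dimensional flat torus and $T>0$. Write $x^+=\max\{0,x\}$ and $x^-=(-x)^+$. The energy density $W:\mathbb{R}\to\mathbb{R}$ is fixed, of the form $$W(p)=\sum_{j=1}^{N^+}\alpha_j^+(p+\beta_j^+)^+ +\sum_{j=1}^{N^-}\alpha_j^-(p+\beta_j^-)^-,$$ where $N^\pm$ are positive integers, all $\alpha_j^\pm>0$ and $\beta_j^\pm\in\mathbb{R}$. The nonlinearity is $\mathcal{L}=dW/dp$, understood as the (multivalued) monotone map $\partial W$ (the subdifferential of $W$). ENERGY SOLUTIONS. A function $u\in L^2(0,T;L^2(\mathbb{T}))$ is an energy solution of $\partial_t u=(\mathcal{L}(u_x))_x$ if $u\in L^\infty(0,T;BV(\mathbb{T}))$, $u_t\in L^2(0,T;L^2(\mathbb{T}))$, and there is $\Omega\in L^2(0,T;W^{1,2}(\mathbb{T}))$ such that for all $\varphi\in C^\infty(\mathbb{T})$ and almost every $t\in(0,T)$, $\langle u_t,\varphi\rangle=-\int_{\mathbb{T}}\Omega\,\varphi_x\,dx$, where $\Omega$ is a selection of the composition $\mathcal{L}\circ u_x$. The last requirement means: for almost every $t$, writing $Du(\cdot,t)=u_x^{a}\,dx+D^su$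 for the Lebesgue decomposition of the distributional derivative $Du(\cdot,t)$ and using the continuous representative of $\Omega(\cdot,t)$, one has $\Omega(x,t)\in\partial W(u_x^{a}(x,t))$ for Lebesgue-a.e. $x$, $\Omega(\cdot,t)=\sum_j\alpha_j^+$ $(D^su)^+$-almost everywhere, and $\Omega(\cdot,t)=-\sum_j\alpha_j^-$ $(D^su)^-$-almost everywhere, with $(D^su)^{\pm}$ the positive and negative parts of $D^su$. Such $u$ lies in $C([0,T];L^2(\mathbb{T}))$, so the initial condition makes sense; for each $u_0\in BV(\mathbb{T})$ there is exactly one energy solution with $u(\cdot,0)=u_0$. For pointwise purposes, for every $t\in(0,T)$ the $BV$ function $u(\cdot,t)$ is identified with a good representative, i.e. one whose value at each point lies between its one-sided limits there. FACETED FUNCTIONS. Let $P$ be the (finite) set of jump points of the derivative of $W$. A function $f\in C^1(\mathbb{T})$ is $p$-faceted at $\hat x\in\mathbb{T}$ if there are a closed nontrivial interval (arc) $I=[c_l,c_r]\subset\mathbb{T}$, $c_l<c_r$, containing $\hat x$, and a neighborhood $J=(b_l,b_r)\subset\mathbb{T}$ of $I$ such that $f'=p$ on $I$ and $f'\ne p$ on $J\setminus I$. $I=R(f,\hat x)$ is called the faceted region of $f$ containing $\hat x$. The transition numbers are: $\chi_l=+1$ if $f'<p$ on $(b_l,c_l)$ and $\chi_l=-1$ if $f'>p$ on $(b_l,c_l)$; $\chi_r=+1$ if $f'>p$ on $(c_r,b_r)$ and $\chi_r=-1$ if $f'<p$ on $(c_r,b_r)$. Let $C^2_P(\mathbb{T})$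 be the set of all $f\in C^2(\mathbb{T})$ such that $f$ is $p$-faceted at $\hat x$ whenever $p=f'(\hat x)\in P$. NONLOCAL CURVATURE. Let $f\in C^2_P(\mathbb{T})$, $\hat x\in\mathbb{T}$. If $f'(\hat x)\notin P$, set $\Lambda_W(f)(\hat x)=W''(f'(\hat x))f''(\hat x)$ (which is $0$, since $W$ is piecewise linear). If $p=f'(\hat x)\in P$, let $\Delta=\frac{d^+W}{dq}(p)-\frac{d^-W}{dq}(p)$ be the jump of $W'$ at $p$, $I=R(f,\hat x)=[c_l,c_r]$, and set $\Lambda_W(f)(\hat x)=\bar\xi'(\hat x)$, where $\bar\xi$ is the minimizer of $\int_I|\xi'|^2dx$ over all $\xi\in H^1(I)$ with $|\xi|\le\Delta/2$ on $I$, $\xi(c_l)=-\chi_l\Delta/2$, $\xi(c_r)=\chi_r\Delta/2$. This minimizer is affine, so $\Lambda_W(f)(\hat x)=\frac{(\chi_l+\chi_r)\Delta}{2(c_r-c_l)}$. VISCOSITY SOLUTIONS. Let $U_T=(0,T)\times\mathbb{T}$. The admissible functions $A_P(U_T)$ are those of the form $\varphi(t,x)=f(x)+g(t)$ with $f\in C^2_P(\mathbb{T})$, $g\in C^1(0,T)$. For $u:U_T\to\mathbb{R}\cup\{\pm\infty\}$ let $u^*(t,x)=\limsup_{(s,y)\to(t,x)}u(s,y)$ and $u_*(t,x)=\liminf_{(s,y)\to(t,x)}u(s,y)$ be the upper and lower semicontinuous envelopes. $u$ is a viscosity subsolution of $\partial_t u-(W'(u_x))_x=0$ if, whenever $\varphi\in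 A_P(U_T)$ and $(\hat t,\hat x)\in U_T$ satisfy $\max_{U_T}(u^*-\varphi)=(u^*-\varphi)(\hat t,\hat x)=0$, one has $\varphi_t(\hat t,\hat x)-\Lambda_W(\varphi(\hat t,\cdot))(\hat x)\le0$. It is a viscosity supersolution if, whenever $\min_{U_T}(u_*-\varphi)=(u_*-\varphi)(\hat t,\hat x)=0$, one has $\varphi_t(\hat t,\hat x)-\Lambda_W(\varphi(\hat t,\cdot))(\hat x)\ge0$. A viscosity solution is both a subsolution and a supersolution. *)

theory Defs
  imports "HOL-Analysis.Analysis"
begin

text \<open>
  Functions on the torus \<open>\<real>/\<int>\<close> are represented by 1-periodic functions on \<open>\<real>\<close>, and integrals over
  the torus by integrals over the fundamental domain \<open>[0,1)\<close>.  Functions of time and space are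
  curried, time first.  Lebesgue (not Borel) measurability is used throughout, so that membership in
  the Lebesgue spaces below only depends on the class of a function modulo null sets.
\<close>

definition periodic1 :: "(real \<Rightarrow> 'a) \<Rightarrow> bool" where
  "periodic1 f \<longleftrightarrow> (\<forall>x. f (x + 1) = f x)"

text \<open>Meant for open \<open>S\<close>.\<close>

definition Ck_on :: "nat \<Rightarrow> real set \<Rightarrow> (real \<Rightarrow> real) \<Rightarrow> bool" where
  "Ck_on k S f \<longleftrightarrow>
     (\<forall>j<k. \<forall>x\<in>S. (deriv ^^ j) f differentiable (at x)) \<and> continuous_on S ((deriv ^^ k) f)"

definition smooth :: "(real \<Rightarrow> real) \<Rightarrow> bool" where
  "smooth f \<longleftrightarrow> (\<forall>k. Ck_on k UNIV f)"

definition smooth_torus :: "(real \<Rightarrow> real) \<Rightarrow> bool" where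
  "smooth_torus f \<longleftrightarrow> periodic1 f \<and> smooth f"

text \<open>\<open>C\<^sub>c\<^sup>\<infinity>(a,b)\<close>, extended by zero to \<open>\<real>\<close>.\<close>

definition test_fun :: "real \<Rightarrow> real \<Rightarrow> (real \<Rightarrow> real) \<Rightarrow> bool" where
  "test_fun a b f \<longleftrightarrow> smooth f \<and> (\<exists>c d. a < c \<and> d < b \<and> (\<forall>x. x \<notin> {c..d} \<longrightarrow> f x = 0))"

abbreviation torus_measure :: "real measure" where
  "torus_measure \<equiv> lebesgue_on {0..<1}"

abbreviation time_measure :: "real \<Rightarrow> real measure" where
  "time_measure T \<equiv> lebesgue_on {0<..<T}"

definition square_integrable :: "'a measure \<Rightarrow> ('a \<Rightarrow> real) \<Rightarrow> bool" where
  "square_integrable M f \<longleftrightarrow> f \<in> borel_measurable M \<and> integrable M (\<lambda>x. (f x)\<^sup>2)"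

definition L2_torus :: "(real \<Rightarrow> real) \<Rightarrow> bool" where
  "L2_torus f \<longleftrightarrow> periodic1 f \<and> square_integrable torus_measure f"

text \<open>\<open>L\<^sup>2(0,T;L\<^sup>2)\<close>, identified as usual with \<open>L\<^sup>2\<close> of the space-time cylinder.\<close>

definition L2_spacetime :: "real \<Rightarrow> (real \<Rightarrow> real \<Rightarrow> real) \<Rightarrow> bool" where
  "L2_spacetime T u \<longleftrightarrow> (\<forall>t\<in>{0<..<T}. periodic1 (u t)) \<and>
     square_integrable (lebesgue_on ({0<..<T} \<times> {0..<1})) (\<lambda>(t, x). u t x)"

definition torus_variation :: "(real \<Rightarrow> real) \<Rightarrow> ereal" where
  "torus_variation f = (SUP \<phi> \<in> {\<phi>. smooth_torus \<phi> \<and> (\<forall>x. \<bar>\<phi> x\<bar> \<le> 1)}.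
     ereal (LINT x|torus_measure. f x * deriv \<phi> x))"

definition BV_torus :: "(real \<Rightarrow> real) \<Rightarrow> bool" where
  "BV_torus f \<longleftrightarrow> periodic1 f \<and> integrable torus_measure f \<and> torus_variation f < \<infinity>"

definition BV_norm :: "(real \<Rightarrow> real) \<Rightarrow> ereal" where
  "BV_norm f = ereal (LINT x|torus_measure. \<bar>f x\<bar>) + torus_variation f"

definition Linfty_BV :: "real \<Rightarrow> (real \<Rightarrow> real \<Rightarrow> real) \<Rightarrow> bool" where
  "Linfty_BV T u \<longleftrightarrow>
     (\<exists>C::real. AE t in time_measure T. BV_torus (u t) \<and> BV_norm (u t) \<le> ereal C)"

definition mutually_singular :: "'a measure \<Rightarrow> 'a measure \<Rightarrow> bool" where
  "mutually_singular M N \<longleftrightarrow> (\<exists>A \<in> sets M \<inter> sets N. emeasure M A = 0 \<and> emeasure N (space N - A) = 0)"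

definition finite_borel_torus :: "real measure \<Rightarrow> bool" where
  "finite_borel_torus M \<longleftrightarrow> sets M = sets (restrict_space borel {0..<1}) \<and> finite_measure M"

text \<open>
  The distributional derivative of \<open>f\<close> on the torus is \<open>a dx + \<mu> - \<nu>\<close>, where \<open>a dx\<close> is the
  absolutely continuous part, and \<open>\<mu>\<close> and \<open>\<nu>\<close> are the positive and the negative part of the
  singular part.  For \<open>f\<close> in \<open>BV\<close> such \<open>a\<close>, \<open>\<mu>\<close>, \<open>\<nu>\<close> exist and are unique (\<open>a\<close> up to null sets).
\<close>

definition derivative_decomposition ::
  "(real \<Rightarrow> real) \<Rightarrow> (real \<Rightarrow> real) \<Rightarrow> real measure \<Rightarrow> real measure \<Rightarrow> bool" where
  "derivative_decomposition f a \<mu> \<nu> \<longleftrightarrow>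
     integrable torus_measure a \<and> finite_borel_torus \<mu> \<and> finite_borel_torus \<nu> \<and>
     mutually_singular \<mu> torus_measure \<and> mutually_singular \<nu> torus_measure \<and>
     mutually_singular \<mu> \<nu> \<and>
     (\<forall>\<phi>. smooth_torus \<phi> \<longrightarrow>
        (LINT x|torus_measure. f x * deriv \<phi> x) =
        - ((LINT x|torus_measure. a x * \<phi> x) + (LINT x|\<mu>. \<phi> x) - (LINT x|\<nu>. \<phi> x)))"

definition energy_density ::
  "nat \<Rightarrow> (nat \<Rightarrow> real) \<Rightarrow> (nat \<Rightarrow> real) \<Rightarrow> nat \<Rightarrow> (nat \<Rightarrow> real) \<Rightarrow> (nat \<Rightarrow> real) \<Rightarrow> real \<Rightarrow> real" where
  "energy_density Np \<alpha>p \<beta>p Nm \<alpha>m \<beta>m p =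
     (\<Sum>j=1..Np. \<alpha>p j * max 0 (p + \<beta>p j)) + (\<Sum>j=1..Nm. \<alpha>m j * max 0 (- (p + \<beta>m j)))"

definition subdifferential :: "(real \<Rightarrow> real) \<Rightarrow> real \<Rightarrow> real set" where
  "subdifferential W p = {s. \<forall>q. W p + s * (q - p) \<le> W q}"

definition right_deriv :: "(real \<Rightarrow> real) \<Rightarrow> real \<Rightarrow> real" where
  "right_deriv W p = vector_derivative W (at_right p)"

definition left_deriv :: "(real \<Rightarrow> real) \<Rightarrow> real \<Rightarrow> real" where
  "left_deriv W p = vector_derivative W (at_left p)"

definition deriv_jump :: "(real \<Rightarrow> real) \<Rightarrow> real \<Rightarrow> real" where
  "deriv_jump W p = right_deriv W p - left_deriv W p"

definition jump_points :: "(real \<Rightarrow> real) \<Rightarrow> real set" where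
  "jump_points W = {p. deriv_jump W p \<noteq> 0}"

text \<open>\<open>f\<close> belongs to \<open>W\<^sup>1\<^sup>,\<^sup>2\<close> of the torus, with weak derivative \<open>g\<close>.\<close>

definition W12_torus :: "(real \<Rightarrow> real) \<Rightarrow> (real \<Rightarrow> real) \<Rightarrow> bool" where
  "W12_torus f g \<longleftrightarrow> L2_torus f \<and> L2_torus g \<and>
     (\<forall>\<phi>. smooth_torus \<phi> \<longrightarrow>
        (LINT x|torus_measure. f x * deriv \<phi> x) = - (LINT x|torus_measure. g x * \<phi> x))"

text \<open>
  \<open>v\<close> is the weak time derivative of \<open>u\<close>: the \<open>L\<^sup>2\<close>-valued integrals \<open>\<integral> u \<psi>' dt\<close> and \<open>- \<integral> v \<psi> dt\<close>
  coincide, as elements of \<open>L\<^sup>2\<close> of the torus, for every \<open>\<psi> \<in> C\<^sub>c\<^sup>\<infinity>(0,T)\<close>.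
\<close>

definition weak_time_derivative ::
  "real \<Rightarrow> (real \<Rightarrow> real \<Rightarrow> real) \<Rightarrow> (real \<Rightarrow> real \<Rightarrow> real) \<Rightarrow> bool" where
  "weak_time_derivative T u v \<longleftrightarrow>
     (\<forall>\<psi>. test_fun 0 T \<psi> \<longrightarrow>
        (AE x in torus_measure.
          (LINT t|time_measure T. u t x * deriv \<psi> t) = - (LINT t|time_measure T. v t x * \<psi> t)))"

text \<open>
  \<open>\<omega>\<close> is a selection of \<open>\<partial>W \<circ> f\<^sub>x\<close> for the \<open>BV\<close> function \<open>f\<close>; \<open>w\<close> is the continuous representative of
  \<open>\<omega>\<close>.  The numbers \<open>cp\<close> and \<open>- cm\<close> are the slopes of \<open>W\<close> at \<open>+\<infinity>\<close> and \<open>-\<infinity>\<close>, that is the sums of the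
  coefficients \<open>\<alpha>\<^sup>+\<close> and, up to sign, \<open>\<alpha>\<^sup>-\<close>.
\<close>

definition selection ::
  "(real \<Rightarrow> real) \<Rightarrow> real \<Rightarrow> real \<Rightarrow> (real \<Rightarrow> real) \<Rightarrow> (real \<Rightarrow> real) \<Rightarrow> bool" where
  "selection W cp cm f \<omega> \<longleftrightarrow>
     (\<exists>a \<mu> \<nu> w. derivative_decomposition f a \<mu> \<nu> \<and>
        periodic1 w \<and> continuous_on UNIV w \<and> (AE x in torus_measure. w x = \<omega> x) \<and>
        (AE x in torus_measure. w x \<in> subdifferential W (a x)) \<and>
        (AE x in \<mu>. w x = cp) \<and> (AE x in \<nu>. w x = - cm))"

definition energy_solution ::
  "(real \<Rightarrow> real) \<Rightarrow> real \<Rightarrow> real \<Rightarrow> real \<Rightarrow> (real \<Rightarrow> real \<Rightarrow> real) \<Rightarrow> bool" where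
  "energy_solution W cp cm T u \<longleftrightarrow>
     L2_spacetime T u \<and> Linfty_BV T u \<and>
     (\<exists>ut \<Omega> \<Omega>x.
        L2_spacetime T ut \<and> weak_time_derivative T u ut \<and>
        L2_spacetime T \<Omega> \<and> L2_spacetime T \<Omega>x \<and>
        (AE t in time_measure T. W12_torus (\<Omega> t) (\<Omega>x t)) \<and>
        (\<forall>\<phi>. smooth_torus \<phi> \<longrightarrow>
           (AE t in time_measure T.
              (LINT x|torus_measure. ut t x * \<phi> x) = - (LINT x|torus_measure. \<Omega> t x * deriv \<phi> x))) \<and>
        (AE t in time_measure T. selection W cp cm (u t) (\<Omega> t)))"

text \<open>
  \<open>energy_solution\<close> only depends on the class of \<open>u\<close> modulo null sets of the cylinder.  To evaluate \<open>u\<close>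
  at every time, and in particular at \<open>0\<close>, one takes its representative in \<open>C([0,T];L\<^sup>2)\<close>.
\<close>

definition L2_continuous :: "real \<Rightarrow> (real \<Rightarrow> real \<Rightarrow> real) \<Rightarrow> bool" where
  "L2_continuous T u \<longleftrightarrow> (\<forall>t\<in>{0..T}. L2_torus (u t) \<and>
     ((\<lambda>s. LINT x|torus_measure. (u s x - u t x)\<^sup>2) \<longlongrightarrow> 0) (at t within {0..T}))"

definition energy_solution_from ::
  "(real \<Rightarrow> real) \<Rightarrow> real \<Rightarrow> real \<Rightarrow> real \<Rightarrow> (real \<Rightarrow> real) \<Rightarrow> (real \<Rightarrow> real \<Rightarrow> real) \<Rightarrow> bool" where
  "energy_solution_from W cp cm T u0 u \<longleftrightarrow>
     energy_solution W cp cm T u \<and> L2_continuous T u \<and> (AE x in torus_measure. u 0 x = u0 x)"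

definition good_representative :: "(real \<Rightarrow> real) \<Rightarrow> bool" where
  "good_representative f \<longleftrightarrow>
     (\<forall>x. \<exists>l r. (f \<longlongrightarrow> l) (at_left x) \<and> (f \<longlongrightarrow> r) (at_right x) \<and> min l r \<le> f x \<and> f x \<le> max l r)"

text \<open>
  The endpoints are lifts to \<open>\<real>\<close>, chosen so that \<open>[cl,cr]\<close> contains the given lift \<open>x\<close>; the condition
  \<open>br - bl \<le> 1\<close> says that \<open>(bl,br)\<close> projects injectively onto an arc of the torus.
\<close>

definition facet ::
  "(real \<Rightarrow> real) \<Rightarrow> real \<Rightarrow> real \<Rightarrow> real \<Rightarrow> real \<Rightarrow> real \<Rightarrow> real \<Rightarrow> bool" where
  "facet f p x bl cl cr br \<longleftrightarrow>
     bl < cl \<and> cl < cr \<and> cr < br \<and> br - bl \<le> 1 \<and> x \<in> {cl..cr} \<and>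
     (\<forall>y\<in>{cl..cr}. deriv f y = p) \<and> (\<forall>y\<in>{bl<..<br} - {cl..cr}. deriv f y \<noteq> p)"

definition faceted :: "(real \<Rightarrow> real) \<Rightarrow> real \<Rightarrow> real \<Rightarrow> bool" where
  "faceted f p x \<longleftrightarrow> (\<exists>bl cl cr br. facet f p x bl cl cr br)"

text \<open>The endpoints \<open>(c\<^sub>l, c\<^sub>r)\<close> of the faceted region containing \<open>x\<close>; these are unique.\<close>

definition faceted_region :: "(real \<Rightarrow> real) \<Rightarrow> real \<Rightarrow> real \<times> real" where
  "faceted_region f x = (THE (cl, cr). \<exists>bl br. facet f (deriv f x) x bl cl cr br)"

text \<open>
  The transition numbers at the endpoints \<open>cl\<close> and \<open>cr\<close> of a faceted region of slope \<open>p\<close>.  For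
  \<open>f\<close> in \<open>C\<^sup>1\<close> one of the first two cases applies.
\<close>

definition left_transition :: "(real \<Rightarrow> real) \<Rightarrow> real \<Rightarrow> real \<Rightarrow> real" where
  "left_transition f p cl =
     (if \<forall>\<^sub>F y in at_left cl. deriv f y < p then 1
      else if \<forall>\<^sub>F y in at_left cl. deriv f y > p then - 1 else 0)"

definition right_transition :: "(real \<Rightarrow> real) \<Rightarrow> real \<Rightarrow> real \<Rightarrow> real" where
  "right_transition f p cr =
     (if \<forall>\<^sub>F y in at_right cr. deriv f y > p then 1
      else if \<forall>\<^sub>F y in at_right cr. deriv f y < p then - 1 else 0)"

definition C2P_torus :: "real set \<Rightarrow> (real \<Rightarrow> real) \<Rightarrow> bool" where
  "C2P_torus P f \<longleftrightarrow> periodic1 f \<and> Ck_on 2 UNIV f \<and>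
     (\<forall>x. deriv f x \<in> P \<longrightarrow> faceted f (deriv f x) x)"

text \<open>\<open>\<xi>\<close> is the continuous representative of an \<open>H\<^sup>1(a,b)\<close> function with weak derivative \<open>\<eta>\<close>.\<close>

definition H1_interval :: "real \<Rightarrow> real \<Rightarrow> (real \<Rightarrow> real) \<Rightarrow> (real \<Rightarrow> real) \<Rightarrow> bool" where
  "H1_interval a b \<xi> \<eta> \<longleftrightarrow>
     continuous_on {a..b} \<xi> \<and>
     square_integrable (lebesgue_on {a..b}) \<xi> \<and> square_integrable (lebesgue_on {a..b}) \<eta> \<and>
     (\<forall>\<psi>. test_fun a b \<psi> \<longrightarrow>
        (LINT x|lebesgue_on {a..b}. \<xi> x * deriv \<psi> x) = - (LINT x|lebesgue_on {a..b}. \<eta> x * \<psi> x))"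

definition obstacle_admissible ::
  "real \<Rightarrow> real \<Rightarrow> real \<Rightarrow> real \<Rightarrow> real \<Rightarrow> (real \<Rightarrow> real) \<Rightarrow> (real \<Rightarrow> real) \<Rightarrow> bool" where
  "obstacle_admissible \<Delta> \<chi>l \<chi>r cl cr \<xi> \<eta> \<longleftrightarrow>
     H1_interval cl cr \<xi> \<eta> \<and> (\<forall>x\<in>{cl..cr}. \<bar>\<xi> x\<bar> \<le> \<Delta> / 2) \<and>
     \<xi> cl = - \<chi>l * \<Delta> / 2 \<and> \<xi> cr = \<chi>r * \<Delta> / 2"

definition obstacle_minimizer ::
  "real \<Rightarrow> real \<Rightarrow> real \<Rightarrow> real \<Rightarrow> real \<Rightarrow> (real \<Rightarrow> real) \<Rightarrow> bool" where
  "obstacle_minimizer \<Delta> \<chi>l \<chi>r cl cr \<xi> \<longleftrightarrow>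
     (\<exists>\<eta>. obstacle_admissible \<Delta> \<chi>l \<chi>r cl cr \<xi> \<eta> \<and>
        (\<forall>\<zeta> \<theta>. obstacle_admissible \<Delta> \<chi>l \<chi>r cl cr \<zeta> \<theta> \<longrightarrow>
           (LINT x|lebesgue_on {cl..cr}. (\<eta> x)\<^sup>2) \<le> (LINT x|lebesgue_on {cl..cr}. (\<theta> x)\<^sup>2)))"

text \<open>
  The minimizer is unique on \<open>[cl,cr]\<close>, but arbitrary outside; hence the derivative relative to
  \<open>[cl,cr]\<close>, which is one-sided if \<open>x\<close> is an endpoint.
\<close>

definition nonlocal_curvature :: "(real \<Rightarrow> real) \<Rightarrow> (real \<Rightarrow> real) \<Rightarrow> real \<Rightarrow> real" where
  "nonlocal_curvature W f x =
     (if deriv f x \<in> jump_points W then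
        let p = deriv f x;
            (cl, cr) = faceted_region f x;
            \<xi> = (SOME \<xi>. obstacle_minimizer (deriv_jump W p)
                   (left_transition f p cl) (right_transition f p cr) cl cr \<xi>)
        in vector_derivative \<xi> (at x within {cl..cr})
      else deriv (deriv W) (deriv f x) * deriv (deriv f) x)"

definition admissible_test :: "real set \<Rightarrow> real \<Rightarrow> (real \<Rightarrow> real \<Rightarrow> real) \<Rightarrow> bool" where
  "admissible_test P T \<phi> \<longleftrightarrow>
     (\<exists>f g. C2P_torus P f \<and> Ck_on 1 {0<..<T} g \<and> (\<forall>t\<in>{0<..<T}. \<forall>x. \<phi> t x = f x + g t))"

text \<open>
  \<open>nhds\<close> rather than the punctured \<open>at\<close>: the value at the point itself takes part in the upper and
  lower semicontinuous envelopes.  They are only used at points of the open cylinder.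
\<close>

definition upper_envelope :: "(real \<Rightarrow> real \<Rightarrow> ereal) \<Rightarrow> real \<Rightarrow> real \<Rightarrow> ereal" where
  "upper_envelope u t x = Limsup (nhds (t, x)) (\<lambda>(s, y). u s y)"

definition lower_envelope :: "(real \<Rightarrow> real \<Rightarrow> ereal) \<Rightarrow> real \<Rightarrow> real \<Rightarrow> ereal" where
  "lower_envelope u t x = Liminf (nhds (t, x)) (\<lambda>(s, y). u s y)"

definition viscosity_subsolution ::
  "(real \<Rightarrow> real) \<Rightarrow> real \<Rightarrow> (real \<Rightarrow> real \<Rightarrow> ereal) \<Rightarrow> bool" where
  "viscosity_subsolution W T u \<longleftrightarrow>
     (\<forall>\<phi> t' x'. admissible_test (jump_points W) T \<phi> \<and> t' \<in> {0<..<T} \<and>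
        upper_envelope u t' x' - ereal (\<phi> t' x') = 0 \<and>
        (\<forall>t\<in>{0<..<T}. \<forall>x. upper_envelope u t x - ereal (\<phi> t x) \<le> 0) \<longrightarrow>
        deriv (\<lambda>t. \<phi> t x') t' - nonlocal_curvature W (\<phi> t') x' \<le> 0)"

definition viscosity_supersolution ::
  "(real \<Rightarrow> real) \<Rightarrow> real \<Rightarrow> (real \<Rightarrow> real \<Rightarrow> ereal) \<Rightarrow> bool" where
  "viscosity_supersolution W T u \<longleftrightarrow>
     (\<forall>\<phi> t' x'. admissible_test (jump_points W) T \<phi> \<and> t' \<in> {0<..<T} \<and>
        lower_envelope u t' x' - ereal (\<phi> t' x') = 0 \<and>
        (\<forall>t\<in>{0<..<T}. \<forall>x. lower_envelope u t x - ereal (\<phi> t x) \<ge> 0) \<longrightarrow>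
        deriv (\<lambda>t. \<phi> t x') t' - nonlocal_curvature W (\<phi> t') x' \<ge> 0)"

definition viscosity_solution ::
  "(real \<Rightarrow> real) \<Rightarrow> real \<Rightarrow> (real \<Rightarrow> real \<Rightarrow> ereal) \<Rightarrow> bool" where
  "viscosity_solution W T u \<longleftrightarrow> viscosity_subsolution W T u \<and> viscosity_supersolution W T u"

end

theory Submission
  imports Defs
begin

text \<open>
  Suppose that \<open>f(x) + g(t)\<close> touches \<open>u\<close> from above at \<open>(t',x')\<close> but \<open>g'(t') > \<Lambda>(f)(x')\<close>.
  Then \<open>f\<close> can be replaced near \<open>x'\<close> by a barrier that still touches at \<open>x'\<close>, lies strictly above \<open>f\<close> at
  the ends of an interval \<open>[a,b]\<close> around \<open>x'\<close>, and admits a Lipschitz selection \<open>\<omega>\<close> of the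
  subdifferential of \<open>W\<close> at its slope that increases at a rate below \<open>g'\<close>.  Adding \<open>(t - t')\<^sup>2\<close> and
  lowering the barrier slightly yields a function \<open>\<phi>\<close> such that \<open>w = u - \<phi>\<close> is negative on the parabolic
  boundary of a small rectangle.  Where \<open>\<Omega> < \<omega>\<close> the monotonicity of the subdifferential forces \<open>w\<close> to be
  nonincreasing in \<open>x\<close>, and where \<open>\<Omega> > \<omega>\<close> nondecreasing; hence \<open>\<Omega> - \<omega>\<close> does not increase across
  the components of \<open>{w > 0}\<close>, and the time derivative of the integral of the positive part of \<open>w\<close>, which is the
  integral of \<open>\<Omega>\<^sub>x - g'\<close> over that set, is nonpositive.  So \<open>w \<le> 0\<close> up to the
  touching point, a contradiction.  Touching from below is symmetric.

  The chain rules for positive parts and the decomposition of \<open>{w > 0}\<close> into components are replaced by sums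
  over grids: their terms need only one-sided estimates, and they converge as soon as \<open>{w = 0}\<close> is a
  null set, which holds for all but countably many of the amounts by which the barrier can be lowered.
\<close>

section \<open>Smooth test functions\<close>

text \<open>Touching alone does not start a comparison: \<open>u\<close> may coincide with the test
  function on a large set, and beside a facet of negative curvature the selections along the slope
  of \<open>f\<close> are constant, which grows too fast against a negative \<open>g'\<close>. A
  number \<open>lam\<close> strictly between the curvature and the time derivative leaves room to
  bend \<open>f\<close>, to widen a facet and to add the time penalty. The obstacle is regularity.
  \<open>u(t)\<close> is only BV; identities in time hold for almost every \<open>x\<close>, those
  in space for almost every \<open>t\<close>, with null sets that depend on the test function. So
  each weak identity is turned once into an increment formula over intervals, by smooth trapezoids
  tending to indicators of \<open>(x,y]\<close>; in space only countably many trapezoids are used.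
  After that, \<open>u\<close> in time and the selection in space are integrals of one function
  \<open>V\<close>, and no weak derivative in time or of the selection appears any more. The
  comparison has to yield a uniform gap between \<open>u\<close> and the test function near the
  touching point, not only at it, since the envelopes see neighbourhoods.\<close>

lemma smoothI:
  assumes "\<And>k x. (deriv ^^ k) f differentiable (at x)"
  shows "smooth f"
  unfolding smooth_def Ck_on_def
  using assms by (auto intro!: continuous_at_imp_continuous_on differentiable_imp_continuous_within)

lemma smooth_differentiable:
  assumes "smooth f"
  shows "(deriv ^^ k) f differentiable (at x)"
  using assms unfolding smooth_def Ck_on_def by (metis UNIV_I lessI)

lemma smooth_has_derivative:
  assumes "smooth f"
  shows "((deriv ^^ k) f has_real_derivative (deriv ^^ (Suc k)) f x) (at x)"
  using smooth_differentiable[OF assms, of k x]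
  by (simp add: DERIV_deriv_iff_real_differentiable)

lemma smooth_DERIV: "smooth f \<Longrightarrow> (f has_real_derivative deriv f x) (at x)"
  using smooth_has_derivative[of f 0 x] by simp

lemma smooth_continuous: "smooth f \<Longrightarrow> continuous_on A f"
  by (meson DERIV_isCont continuous_at_imp_continuous_on smooth_DERIV)

lemma smooth_deriv: "smooth f \<Longrightarrow> smooth (deriv f)"
  using smooth_differentiable[of f "Suc _"] by (intro smoothI) (simp add: funpow_Suc_right del: funpow.simps)

lemma smooth_deriv_continuous: "smooth f \<Longrightarrow> continuous_on A (deriv f)"
  by (intro smooth_continuous smooth_deriv)

lemma DERIV_differentiable: "(f has_real_derivative D) (at x) \<Longrightarrow> f differentiable (at x)"
  by (auto simp: real_differentiable_def)

lemma smooth_antideriv: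
  assumes "smooth g" "\<And>x. (f has_real_derivative g x) (at x)"
  shows "smooth f"
proof (rule smoothI)
  fix k x
  have [simp]: "deriv f = g" using assms(2) by (auto intro!: DERIV_imp_deriv)
  show "(deriv ^^ k) f differentiable (at x)"
  proof (cases k)
    case 0 then show ?thesis using assms(2) by (auto intro: DERIV_differentiable)
  next
    case (Suc j)
    then show ?thesis using smooth_differentiable[OF assms(1), of j x]
      by (simp add: funpow_Suc_right del: funpow.simps)
  qed
qed

lemma deriv_eq_on_open:
  fixes f g :: "real \<Rightarrow> real"
  assumes "open U" "\<And>x. x \<in> U \<Longrightarrow> f x = g x" "x \<in> U"
  shows "deriv f x = deriv g x"
  by (rule deriv_cong_ev) (use assms in \<open>auto simp: eventually_nhds\<close>)

text \<open>Glueing: \<open>stair\<close> below is defined through the floor function and is smooth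
  only because near each point it agrees with a shifted copy of one smooth function.\<close>

lemma smooth_local:
  fixes f :: "real \<Rightarrow> real"
  assumes "\<And>x. \<exists>U g. open U \<and> x \<in> U \<and> smooth g \<and> (\<forall>y\<in>U. f y = g y)"
  shows "smooth f"
proof (rule smoothI)
  fix k x
  obtain U g where U: "open U" "x \<in> U" "smooth g" "\<forall>y\<in>U. f y = g y" using assms by blast
  have eq: "\<forall>y\<in>U. (deriv ^^ k) f y = (deriv ^^ k) g y"
    by (induction k) (use U in \<open>auto intro: deriv_eq_on_open\<close>)
  obtain D where "((deriv ^^ k) g has_derivative D) (at x)"
    using smooth_differentiable[OF U(3), of k x] by (auto simp: differentiable_def)
  then have "((deriv ^^ k) f has_derivative D) (at x)"
    by (rule has_derivative_transform_within_open[OF _ U(1,2)]) (use eq in auto)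
  then show "(deriv ^^ k) f differentiable (at x)" by (auto simp: differentiable_def)
qed

lemma smooth_affine:
  assumes "smooth f"
  shows "smooth (\<lambda>x. c + f (m * x + d))"
proof -
  have aff: "((\<lambda>x. (deriv ^^ k) f (m * x + d)) has_real_derivative (deriv ^^ Suc k) f (m * x + d) * m) (at x)" for k x
    by (rule DERIV_chain2[OF smooth_has_derivative[OF assms]]) (auto intro!: derivative_eq_intros)
  have *: "(deriv ^^ k) (\<lambda>x. c + f (m * x + d)) =
     (\<lambda>x. (if k = 0 then c else 0) + m ^ k * (deriv ^^ k) f (m * x + d))" for k
  proof (induction k)
    case (Suc k)
    show ?case
    proof
      fix x
      have "((\<lambda>x. (if k = 0 then c else 0) + m ^ k * (deriv ^^ k) f (m * x + d)) has_real_derivative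
             (0 + m ^ k * ((deriv ^^ Suc k) f (m * x + d) * m))) (at x)"
        by (rule DERIV_add[OF DERIV_const DERIV_cmult[OF aff]])
      then show "(deriv ^^ Suc k) (\<lambda>x. c + f (m * x + d)) x =
         (if Suc k = 0 then c else 0) + m ^ Suc k * (deriv ^^ Suc k) f (m * x + d)"
        unfolding funpow.simps comp_def Suc by (simp add: DERIV_imp_deriv algebra_simps)
    qed
  qed auto
  show ?thesis
  proof (rule smoothI)
    fix k x
    have "((\<lambda>x. (if k = 0 then c else 0) + m ^ k * (deriv ^^ k) f (m * x + d)) has_real_derivative
             (0 + m ^ k * ((deriv ^^ Suc k) f (m * x + d) * m))) (at x)"
      by (rule DERIV_add[OF DERIV_const DERIV_cmult[OF aff]])
    then show "(deriv ^^ k) (\<lambda>x. c + f (m * x + d)) differentiable at x"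
      unfolding * by (rule DERIV_differentiable)
  qed
qed

lemma smooth_diff:
  assumes "smooth f" "smooth g"
  shows "smooth (\<lambda>x. f x - g x)"
proof -
  have *: "(deriv ^^ k) (\<lambda>x. f x - g x) = (\<lambda>x. (deriv ^^ k) f x - (deriv ^^ k) g x)" for k
  proof (induction k)
    case (Suc k)
    show ?case unfolding funpow.simps comp_def Suc
      by (intro ext DERIV_imp_deriv DERIV_diff)
         (use smooth_has_derivative[of _ k] assms in auto)
  qed auto
  show ?thesis
    by (rule smoothI) (auto simp: * intro!: derivative_intros smooth_differentiable assms)
qed

lemma smooth_cmult:
  assumes "smooth f"
  shows "smooth (\<lambda>x. c * f x)"
proof -
  have *: "(deriv ^^ k) (\<lambda>x. c * f x) = (\<lambda>x. c * (deriv ^^ k) f x)" for k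
  proof (induction k)
    case (Suc k)
    show ?case unfolding funpow.simps comp_def Suc
      by (intro ext DERIV_imp_deriv DERIV_cmult)
         (use smooth_has_derivative[of _ k] assms in auto)
  qed auto
  show ?thesis
    by (rule smoothI) (auto simp: * intro!: derivative_intros smooth_differentiable assms)
qed

section \<open>A smooth monotone step from the bump function on the unit interval\<close>

lemma DERIV_zero_if_quadratic:
  fixes f :: "real \<Rightarrow> real"
  assumes "\<And>x. \<bar>f x\<bar> \<le> C * (x - x0)\<^sup>2"
  shows "(f has_real_derivative 0) (at x0)"
proof -
  have f0: "f x0 = 0" using assms[of x0] by simp
  have "((\<lambda>h. (f (x0 + h) - f x0) / h) \<longlongrightarrow> 0) (at 0)"
  proof (rule Lim_null_comparison)
    show "\<forall>\<^sub>F h in at 0. norm ((f (x0 + h) - f x0) / h) \<le> C * \<bar>h\<bar>"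
    proof (rule eventuallyI)
      fix h :: real
      show "norm ((f (x0 + h) - f x0) / h) \<le> C * \<bar>h\<bar>"
      proof (cases "h = 0")
        case False
        have "\<bar>f (x0 + h)\<bar> \<le> C * \<bar>h\<bar> * \<bar>h\<bar>"
          using assms[of "x0 + h"] by (simp add: power2_eq_square)
        then show ?thesis using False by (simp add: f0 field_simps)
      qed auto
    qed
    show "((\<lambda>h. C * \<bar>h\<bar>) \<longlongrightarrow> 0) (at 0)" by (auto intro!: tendsto_eq_intros)
  qed
  then show ?thesis by (simp add: DERIV_def)
qed

text \<open>The polynomial factor and the power of \<open>x * (1 - x)\<close> make the family closed
  under differentiation, so that one derivative computation gives all orders. The member with
  \<open>R = 1\<close> and \<open>m = 0\<close> is the usual bump on (0,1).\<close>

definition bumpH :: "real poly \<Rightarrow> nat \<Rightarrow> real \<Rightarrow> real" where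
  "bumpH R m x = (if 0 < x \<and> x < 1
     then poly R x / (x * (1 - x)) ^ m * exp (- 1 / (x * (1 - x))) else 0)"

lemma exp_inverse_le:
  fixes c :: real
  assumes "0 < c"
  shows "exp (- 1 / c) \<le> fact k * c ^ k"
proof -
  have "(\<Sum>j\<in>{k}. inverse (fact j) * (1/c) ^ j) \<le> (\<Sum>j. inverse (fact j) * (1/c) ^ j)"
    by (rule sum_le_suminf) (use assms summable_exp[of "1/c"] in auto)
  then have "(1/c)^k / fact k \<le> exp (1/c)" by (simp add: exp_def scaleR_conv_of_real divide_inverse mult.commute)
  then show ?thesis using assms by (simp add: exp_minus field_simps power_divide)
qed

text \<open>The exponential absorbs the \<open>m\<close> powers in the denominator and two more. The
  two spare ones give quadratic decay at both endpoints, which forces the derivative to exist and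
  vanish there.\<close>

lemma bumpH_bound:
  "\<exists>C. \<forall>x. \<bar>bumpH R m x\<bar> \<le> C * x\<^sup>2 \<and> \<bar>bumpH R m x\<bar> \<le> C * (x - 1)\<^sup>2"
proof -
  have "compact (poly R ` {0..1::real})"
    by (intro compact_continuous_image continuous_intros) auto
  then obtain K where K: "\<And>x. x \<in> {0..1} \<Longrightarrow> \<bar>poly R x\<bar> \<le> K"
    by (fastforce dest!: compact_imp_bounded simp: bounded_iff)
  have K0: "0 \<le> K" using K[of 0] by auto
  \<comment> \<open>The factorial is the constant of \<open>exp_inverse_le\<close> for the power
    \<open>m + 2\<close>.\<close>
  define C where "C = K * fact (m + 2)"
  have C0: "0 \<le> C" using K0 by (simp add: C_def)
  have main: "\<bar>bumpH R m x\<bar> \<le> C * (x * (1 - x))\<^sup>2" if "0 < x" "x < 1" for x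
  proof -
    define c where "c = x * (1 - x)"
    have c: "0 < c" using that by (simp add: c_def)
    have "\<bar>bumpH R m x\<bar> = \<bar>poly R x\<bar> * (exp (- 1 / c) / c ^ m)"
      using that c by (simp add: bumpH_def c_def[symmetric] abs_mult)
    also have "\<dots> \<le> K * (fact (m + 2) * c ^ (m + 2) / c ^ m)"
      using K[of x] K0 that c exp_inverse_le[OF c, of "m + 2"]
      by (intro mult_mono divide_right_mono) auto
    also have "\<dots> = C * c\<^sup>2" using c by (simp add: C_def power_add power2_eq_square)
    finally show ?thesis by (simp add: c_def)
  qed
  have "\<bar>bumpH R m x\<bar> \<le> C * x\<^sup>2 \<and> \<bar>bumpH R m x\<bar> \<le> C * (x - 1)\<^sup>2" for x
  proof (cases "0 < x \<and> x < 1")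
    case True
    have "(x * (1 - x))\<^sup>2 \<le> x\<^sup>2 * 1" "(x * (1 - x))\<^sup>2 \<le> 1 * (x - 1)\<^sup>2"
      unfolding power_mult_distrib power2_commute[of 1 x]
      using True by (auto intro!: mult_mono power_le_one simp: power2_commute[of x 1])
    then show ?thesis using main[of x] True C0 mult_left_mono
      by (smt (verit, ccfv_SIG) mult_1 mult.right_neutral)
  qed (use C0 in \<open>auto simp: bumpH_def\<close>)
  then show ?thesis by blast
qed

text \<open>With \<open>c = x * (1 - x)\<close>, encoded as \<open>[:0,1,-1:]\<close> with
  derivative \<open>[:1,-2:]\<close>, differentiating the exponential costs two powers of
  \<open>c\<close>; the three terms of the product rule are brought to the common denominator of
  exponent \<open>m + 2\<close>.\<close>

lemma bumpH_deriv:
  "(bumpH R m has_real_derivative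
     bumpH (pderiv R * [:0,1,-1:]^2 - smult (of_nat m) (R * [:1,-2:] * [:0,1,-1:]) + R * [:1,-2:]) (m + 2) x) (at x)"
proof -
  let ?R = "pderiv R * [:0,1,-1:]^2 - smult (of_nat m) (R * [:1,-2:] * [:0,1,-1:]) + R * [:1,-2:]"
  obtain C where C: "\<And>x. \<bar>bumpH R m x\<bar> \<le> C * x\<^sup>2" "\<And>x. \<bar>bumpH R m x\<bar> \<le> C * (x - 1)\<^sup>2"
    using bumpH_bound by blast
  consider "x = 0" | "x = 1" | "x < 0 \<or> x > 1" | "0 < x \<and> x < 1" by linarith
  then show ?thesis
  proof cases
    case 1
    then show ?thesis using DERIV_zero_if_quadratic[of "bumpH R m" C 0] C by (simp add: bumpH_def)
  next
    case 2
    then show ?thesis using DERIV_zero_if_quadratic[of "bumpH R m" C 1] C by (simp add: bumpH_def)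
  next
    case 3
    have "((\<lambda>x. 0) has_real_derivative 0) (at x)" by simp
    moreover have "open ({..<0} \<union> {1<..} :: real set)" by auto
    ultimately have "(bumpH R m has_real_derivative 0) (at x)"
      by (rule has_field_derivative_transform_within_open) (use 3 in \<open>auto simp: bumpH_def\<close>)
    then show ?thesis using 3 by (auto simp: bumpH_def)
  next
    case 4
    define c where "c = x * (1 - x)"
    have c: "c > 0" using 4 by (simp add: c_def)
    have c1: "(1 - x) * x = c" "x * (1 - x) = c" "x - x * x = c" by (auto simp: c_def algebra_simps)
    have d: "((\<lambda>x. poly R x * (1 / (x * (1 - x))) ^ m * exp (- (1 / (x * (1 - x))))) has_real_derivative
          (poly (pderiv R) x * (1 / c) ^ m + poly R x * (of_nat m * (1/c)^(m - 1) * (-(1 - 2*x) / c^2))) * exp (-(1/c))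
          + poly R x * (1 / c) ^ m * (exp (-(1/c)) * ((1 - 2*x)/c^2))) (at x)"
    proof -
      have dc: "((\<lambda>x. x * (1 - x)) has_real_derivative (1 - 2 * x)) (at x)"
        by (auto intro!: derivative_eq_intros)
      have di: "((\<lambda>x. 1 / (x * (1 - x))) has_real_derivative - (1 - 2 * x) / c\<^sup>2) (at x)"
        using DERIV_divide[OF DERIV_const[of 1] dc] c by (simp add: c1 power2_eq_square)
      have de: "((\<lambda>x. exp (- (1 / (x * (1 - x))))) has_real_derivative exp (- (1 / c)) * ((1 - 2 * x) / c\<^sup>2)) (at x)"
        by (rule DERIV_cong[OF DERIV_fun_exp[OF DERIV_minus[OF di]]]) (simp add: c1 divide_inverse algebra_simps)
      have dp: "((\<lambda>x. (1 / (x * (1 - x))) ^ m) has_real_derivative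
          of_nat m * (1 / c) ^ (m - 1) * (- (1 - 2 * x) / c\<^sup>2)) (at x)"
        using DERIV_power[OF di, of m] by (simp add: c1 mult_ac)
      show ?thesis
        using DERIV_mult[OF DERIV_mult[OF poly_DERIV[of R x] dp] de] by (simp add: c1 mult_ac add_ac)
    qed
    have e: "(poly (pderiv R) x * (1 / c) ^ m + poly R x * (of_nat m * (1/c)^(m - 1) * (-(1 - 2*x) / c^2))) * exp (-(1/c))
          + poly R x * (1 / c) ^ m * (exp (-(1/c)) * ((1 - 2*x)/c^2)) = bumpH ?R (m + 2) x"
    proof -
      \<comment> \<open>The truncated exponent \<open>m - 1\<close> does no harm: for
        \<open>m = 0\<close> both sides carry the factor 0.\<close>
      have pm: "(of_nat m * (1/c)^(m - 1) :: real) = of_nat m * (1/c)^m * c"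
        using c by (cases m) auto
      have R: "poly ?R x = poly (pderiv R) x * c^2 - of_nat m * (poly R x * (1 - 2*x) * c) + poly R x * (1 - 2*x)"
        by (simp add: c_def algebra_simps power2_eq_square)
      have b: "bumpH ?R (m + 2) x = poly ?R x / c ^ (m + 2) * exp (- (1 / c))"
        using 4 unfolding bumpH_def c_def by simp
      have "(poly (pderiv R) x * (1 / c) ^ m + poly R x * (of_nat m * (1/c)^(m - 1) * (-(1 - 2*x) / c^2))) * exp (-(1/c))
          + poly R x * (1 / c) ^ m * (exp (-(1/c)) * ((1 - 2*x)/c^2))
        = (poly (pderiv R) x * c^2 - of_nat m * (poly R x * (1 - 2*x) * c) + poly R x * (1 - 2*x)) * ((1/c)^m / c^2) * exp (-(1/c))"
        unfolding pm using c by (simp add: field_simps power2_eq_square)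
      also have "\<dots> = bumpH ?R (m + 2) x"
        unfolding b R by (simp add: power_add power_divide power2_eq_square)
      finally show ?thesis .
    qed
    show ?thesis
      using d unfolding e
      by (rule has_field_derivative_transform_within_open[where S="{0<..<1}"])
         (use 4 in \<open>auto simp: bumpH_def power_one_over divide_inverse power_inverse power_mult_distrib\<close>)
  qed
qed

lemma smooth_bumpH: "smooth (bumpH R m)"
proof (rule smoothI)
  fix k x
  have "\<exists>R' m'. (deriv ^^ k) (bumpH R m) = bumpH R' m'"
  proof (induction k)
    case (Suc k)
    then obtain R' m' where "(deriv ^^ k) (bumpH R m) = bumpH R' m'" by blast
    then show ?case using DERIV_imp_deriv[OF bumpH_deriv[of R' m']] by (auto intro!: exI ext)
  qed auto
  then show "(deriv ^^ k) (bumpH R m) differentiable (at x)"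
    using bumpH_deriv DERIV_differentiable by metis
qed

text \<open>The normalised antiderivative of the bump: monotone since the bump is nonnegative, and
  constant wherever the bump vanishes.\<close>

lemma ex_step:
  "\<exists>B. smooth B \<and> mono B \<and> (\<forall>x\<le>0. B x = 0) \<and> (\<forall>x\<ge>1. B x = (1::real))"
proof -
  let ?h = "bumpH 1 0"
  obtain F where F: "\<And>x. (F has_real_derivative ?h x) (at x)"
    using einterval_antiderivative[of "-\<infinity>" "\<infinity>" ?h] smooth_continuous[OF smooth_bumpH, of UNIV 1 0]
    by (auto simp: continuous_on_eq_continuous_at has_real_derivative_iff_has_vector_derivative)
  have mono: "F x \<le> F y" if "x \<le> y" for x y
    by (rule DERIV_nonneg_imp_nondecreasing[OF that]) (use F in \<open>auto simp: bumpH_def intro!: exI\<close>)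
  have "0 < F 1 - F 0"
  proof -
    \<comment> \<open>The mean value point is interior to (0,1), where the bump is positive, so the
      normalising constant is not 0.\<close>
    have "\<exists>z>0. z < 1 \<and> F 1 - F 0 = (1 - 0) * ?h z"
      by (rule MVT2) (use F in auto)
    then obtain z where "0 < z" "z < 1" "F 1 - F 0 = ?h z" by auto
    then show ?thesis by (simp add: bumpH_def)
  qed
  define B where "B x = (F x - F 0) / (F 1 - F 0)" for x
  have const: "F x = F y" if "x < y" "y \<le> 0 \<or> 1 \<le> x" for x y
  proof -
    have "\<exists>z>x. z < y \<and> F y - F x = (y - x) * ?h z"
      by (rule MVT2) (use that F in auto)
    then show ?thesis using that by (auto simp: bumpH_def)
  qed
  show ?thesis
  proof (intro exI[of _ B] conjI allI impI)
    have "smooth F" by (rule smooth_antideriv[OF smooth_bumpH F])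
    then show "smooth B"
      using smooth_affine[OF smooth_cmult[of F "1 / (F 1 - F 0)"], of "- F 0 / (F 1 - F 0)" 1 0]
      by (simp add: B_def[abs_def] diff_divide_distrib)
    show "mono B" using mono \<open>0 < F 1 - F 0\<close> by (auto simp: mono_def B_def divide_right_mono)
    show "B x = 0" if "x \<le> 0" for x using const[of x 0] that by (cases "x = 0") (auto simp: B_def)
    show "B x = 1" if "1 \<le> x" for x using const[of 1 x] that \<open>0 < F 1 - F 0\<close> by (cases "x = 1") (auto simp: B_def)
  qed
qed

section \<open>Cut-off functions on the line and on the torus\<close>

definition step :: "real \<Rightarrow> real" where
  "step = (SOME B. smooth B \<and> mono B \<and> (\<forall>x\<le>0. B x = 0) \<and> (\<forall>x\<ge>1. B x = 1))"

lemma step: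
  shows smooth_step: "smooth step" and mono_step: "mono step"
    and step_0: "x \<le> 0 \<Longrightarrow> step x = 0" and step_1: "x \<ge> 1 \<Longrightarrow> step x = 1"
  using someI_ex[OF ex_step] unfolding step_def[symmetric] by auto

lemma step_bounds: "0 \<le> step x" "step x \<le> 1"
  using monoD[OF mono_step, of "min 0 x" x] monoD[OF mono_step, of x "max 1 x"]
  by (auto simp: step_0 step_1)

lemma deriv_step_nonneg: "0 \<le> deriv step x"
proof (rule ccontr)
  assume "\<not> ?thesis"
  then obtain d where d: "d > 0" "\<And>h. 0 < h \<Longrightarrow> h < d \<Longrightarrow> step (x + h) < step x"
    using DERIV_neg_dec_right[OF smooth_DERIV[OF smooth_step, of x]] by (auto simp: not_le)
  then have "step (x + d / 2) < step x" by auto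
  then show False using d(1) monoD[OF mono_step, of x "x + d / 2"] by simp
qed

lemma deriv_step_0:
  assumes "x \<le> 0 \<or> 1 \<le> x"
  shows "deriv step x = 0"
proof -
  have d: "DERIV step x :> deriv step x" by (rule smooth_DERIV[OF smooth_step])
  show ?thesis
  proof (cases "x \<le> 0")
    case True
    then show ?thesis using DERIV_local_min[OF d, of 1] step_bounds by (simp add: step_0)
  next
    case False
    then show ?thesis using DERIV_local_max[OF d, of 1] step_bounds assms by (simp add: step_1)
  qed
qed

text \<open>Both ramps, of width \<open>1/n\<close>, lie to the right of their nodes. Hence the
  limit is the indicator of the half-open \<open>(x,y]\<close>, and the derivative is the difference
  of two averaging kernels, to the right of \<open>x\<close> and of \<open>y\<close>.\<close>

definition trap :: "real \<Rightarrow> real \<Rightarrow> real \<Rightarrow> real \<Rightarrow> real" where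
  "trap n x y s = step (n * (s - x)) - step (n * (s - y))"

lemma smooth_trap: "smooth (trap n x y)"
proof -
  have "smooth (\<lambda>s. step (n * (s - z)))" for z
    using smooth_affine[OF smooth_step, of 0 n "- n * z"] by (simp add: algebra_simps)
  then show ?thesis unfolding trap_def[abs_def] by (intro smooth_diff)
qed

lemma trap_bounds:
  assumes "0 < n" "x \<le> y"
  shows "0 \<le> trap n x y s" "trap n x y s \<le> 1"
  using monoD[OF mono_step, of "n * (s - y)" "n * (s - x)"] step_bounds[of "n * (s - x)"] step_bounds[of "n * (s - y)"] assms
  by (auto simp: trap_def)

lemma trap_outside:
  assumes "0 < n" "x \<le> y" "s \<le> x \<or> y + 1 / n \<le> s"
  shows "trap n x y s = 0"
proof (cases "s \<le> x")
  case True
  then show ?thesis using assms by (simp add: trap_def step_0 mult_le_0_iff)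
next
  case False
  then have "1 \<le> n * (s - y)" using assms by (simp add: field_simps)
  moreover have "n * (s - y) \<le> n * (s - x)" using assms by simp
  ultimately show ?thesis by (simp add: trap_def step_1)
qed

lemma trap_inside:
  assumes "0 < n" "x + 1 / n \<le> s" "s \<le> y"
  shows "trap n x y s = 1"
proof -
  have "1 \<le> n * (s - x)" "n * (s - y) \<le> 0" using assms by (auto simp: field_simps mult_le_0_iff)
  then show ?thesis by (simp add: trap_def step_1 step_0)
qed

lemma test_fun_trap:
  assumes "0 < n" "a < x" "x \<le> y" "y + 1 / n < b"
  shows "test_fun a b (trap n x y)"
  unfolding test_fun_def
  using assms smooth_trap trap_outside[OF assms(1,3)]
  by (intro conjI exI[of _ x] exI[of _ "y + 1/n"]) auto

lemma DERIV_step_scaled: "((\<lambda>s. step (n * (s - x))) has_real_derivative n * deriv step (n * (s - x))) (at s)"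
  by (rule DERIV_cong[OF DERIV_chain2[OF smooth_DERIV[OF smooth_step]]])
     (auto intro!: derivative_eq_intros)

lemma deriv_trap: "deriv (trap n x y) s = n * deriv step (n * (s - x)) - n * deriv step (n * (s - y))"
  unfolding trap_def[abs_def]
  by (rule DERIV_imp_deriv[OF DERIV_diff[OF DERIV_step_scaled DERIV_step_scaled]])

text \<open>A smooth map that grows by one over each period, so that a difference of two translates
  is periodic. For large \<open>n\<close> it approximates the ceiling function.\<close>

definition stair :: "real \<Rightarrow> real \<Rightarrow> real" where
  "stair n s = of_int \<lfloor>s\<rfloor> + step (n * frac s)"

lemma stair_add1: "stair n (s + 1) = stair n s + 1"
  by (simp add: stair_def frac_1_eq)

text \<open>The interval reaches below \<open>k\<close> because the previous ramp is complete at
  \<open>k - 1 + 1 / n\<close>. Consecutive intervals overlap, so the jumps of the floor function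
  leave no seam.\<close>

lemma stair_local:
  assumes "1 < n" "of_int k - 1 + 1 / n < s" "s < of_int k + 1"
  shows "stair n s = of_int k + step (n * (s - of_int k))"
proof (cases "of_int k \<le> s")
  case True
  then have "\<lfloor>s\<rfloor> = k" using assms by (simp add: floor_eq_iff)
  then show ?thesis by (simp add: stair_def frac_def)
next
  case False
  have "0 < 1 / n" using assms by simp
  then have "of_int k - 1 < s" using assms(2) by linarith
  then have f: "\<lfloor>s\<rfloor> = k - 1" using False by (simp add: floor_eq_iff)
  have "1 \<le> n * (s - of_int (k - 1))" using assms by (simp add: field_simps)
  moreover have "n * (s - of_int k) \<le> 0" using False assms by (simp add: mult_le_0_iff)
  ultimately show ?thesis using f by (simp add: stair_def frac_def step_0 step_1)
qed

lemma stair_nbhd: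
  assumes "1 < n"
  obtains U where "open U" "s \<in> U"
    "\<And>t. t \<in> U \<Longrightarrow> stair n t = of_int \<lfloor>s\<rfloor> + step (n * (t - of_int \<lfloor>s\<rfloor>))"
proof (rule that[of "{of_int \<lfloor>s\<rfloor> - 1 + 1 / n <..< of_int \<lfloor>s\<rfloor> + 1}"])
  have "1 / n < 1" using assms by simp
  then show "s \<in> {of_int \<lfloor>s\<rfloor> - 1 + 1 / n <..< of_int \<lfloor>s\<rfloor> + 1}" by (simp; linarith)
qed (use assms stair_local in auto)

lemma smooth_stair:
  assumes "1 < n"
  shows "smooth (stair n)"
proof (rule smooth_local)
  fix s
  obtain U where U: "open U" "s \<in> U"
    "\<And>t. t \<in> U \<Longrightarrow> stair n t = of_int \<lfloor>s\<rfloor> + step (n * (t - of_int \<lfloor>s\<rfloor>))"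
    using stair_nbhd[OF assms] by blast
  have "smooth (\<lambda>t. of_int \<lfloor>s\<rfloor> + step (n * (t - of_int \<lfloor>s\<rfloor>)))"
    using smooth_affine[OF smooth_step, of "of_int \<lfloor>s\<rfloor>" n "- n * of_int \<lfloor>s\<rfloor>"] by (simp add: algebra_simps)
  then show "\<exists>U g. open U \<and> s \<in> U \<and> smooth g \<and> (\<forall>y\<in>U. stair n y = g y)" using U by blast
qed

lemma deriv_stair:
  assumes "1 < n"
  shows "deriv (stair n) s = n * deriv step (n * frac s)"
proof -
  obtain U where U: "open U" "s \<in> U"
    "\<And>t. t \<in> U \<Longrightarrow> stair n t = of_int \<lfloor>s\<rfloor> + step (n * (t - of_int \<lfloor>s\<rfloor>))"
    using stair_nbhd[OF assms] by blast
  have "deriv (stair n) s = deriv (\<lambda>t. of_int \<lfloor>s\<rfloor> + step (n * (t - of_int \<lfloor>s\<rfloor>))) s"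
    by (rule deriv_eq_on_open[OF U(1) U(3) U(2)])
  also have "\<dots> = n * deriv step (n * frac s)"
    unfolding frac_def by (rule DERIV_imp_deriv) (use DERIV_add[OF DERIV_const DERIV_step_scaled] in auto)
  finally show ?thesis .
qed

lemma deriv_stair_nonneg: "1 < n \<Longrightarrow> 0 \<le> deriv (stair n) s"
  by (simp add: deriv_stair deriv_step_nonneg)

lemma deriv_stair_nonzero:
  assumes "1 < n" "deriv (stair n) s \<noteq> 0"
  shows "0 < frac s \<and> frac s < 1 / n"
proof -
  have "0 < n * frac s" "n * frac s < 1"
    using assms deriv_step_0[of "n * frac s"] by (auto simp: deriv_stair not_le[symmetric])
  then show ?thesis using assms(1) by (auto simp: field_simps zero_less_mult_iff)
qed

lemma deriv_stair_add1: "1 < n \<Longrightarrow> deriv (stair n) (s + 1) = deriv (stair n) s"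
  by (simp add: deriv_stair frac_1_eq)

lemma mono_stair:
  assumes "1 < n" "s \<le> t"
  shows "stair n s \<le> stair n t"
  by (rule DERIV_nonneg_imp_nondecreasing[OF assms(2)])
     (use smooth_DERIV[OF smooth_stair[OF assms(1)]] deriv_stair_nonneg[OF assms(1)] in blast)

lemma stair_eq_1: "1 < n \<Longrightarrow> 1 / n \<le> s \<Longrightarrow> s \<le> 1 \<Longrightarrow> stair n s = 1"
  using stair_local[of n 1 s] stair_local[of n 0 s]
  by (cases "s < 1") (auto simp: step_0 step_1 field_simps stair_def)

text \<open>At an integer the value is exact, since \<open>step 0 = 0\<close>; elsewhere the ramp is
  complete once \<open>n * frac s\<close> reaches 1. The shift by 2 keeps \<open>n\<close> above
  1.\<close>

lemma stair_tendsto: "(\<lambda>k. stair (real k + 2) s) \<longlonglongrightarrow> of_int \<lceil>s\<rceil>"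
proof (cases "frac s = 0")
  case True
  then have "s \<in> \<int>" by (simp add: frac_eq_0_iff)
  then show ?thesis using True by (auto simp: stair_def step_0 elim!: Ints_cases)
next
  case False
  then have f: "0 < frac s" using frac_ge_0[of s] by linarith
  then have c: "\<lceil>s\<rceil> = \<lfloor>s\<rfloor> + 1" using False by (simp add: ceiling_altdef frac_def)
  obtain N :: nat where N: "1 / frac s < N" using reals_Archimedean2 by blast
  have "stair (real k + 2) s = of_int \<lceil>s\<rceil>" if "k \<ge> N" for k
  proof -
    have "1 / frac s \<le> real k + 2" using that N by linarith
    then have "1 \<le> (real k + 2) * frac s" using f by (simp add: field_simps)
    then show ?thesis by (simp add: stair_def step_1 c)
  qed
  then show ?thesis by (intro tendsto_eventually) (auto simp: eventually_sequentially)
qed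

definition ptrap :: "real \<Rightarrow> real \<Rightarrow> real \<Rightarrow> real \<Rightarrow> real" where
  "ptrap n x y s = stair n (s - x) - stair n (s - y)"

lemma smooth_torus_ptrap:
  assumes "1 < n"
  shows "smooth_torus (ptrap n x y)"
proof -
  have "smooth (\<lambda>s. stair n (s - z))" for z
    using smooth_affine[OF smooth_stair[OF assms], of 0 1 "- z"] by simp
  moreover have "ptrap n x y (s + 1) = ptrap n x y s" for s
    using stair_add1[of n "s - x"] stair_add1[of n "s - y"] by (simp add: ptrap_def algebra_simps)
  ultimately show ?thesis unfolding smooth_torus_def periodic1_def
    by (auto simp: ptrap_def[abs_def] intro: smooth_diff)
qed

lemma deriv_ptrap:
  assumes "1 < n"
  shows "deriv (ptrap n x y) s = deriv (stair n) (s - x) - deriv (stair n) (s - y)"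
proof -
  have "((\<lambda>s. stair n (s - z)) has_real_derivative deriv (stair n) (s - z)) (at s)" for z
    by (rule DERIV_cong[OF DERIV_chain2[OF smooth_DERIV[OF smooth_stair[OF assms]]]])
       (auto intro!: derivative_eq_intros)
  then show ?thesis unfolding ptrap_def[abs_def] by (intro DERIV_imp_deriv DERIV_diff)
qed

text \<open>The upper bound compares with the translate by a full period:
  \<open>y \<le> x + 1\<close> makes \<open>stair n (s - y)\<close> at least
  \<open>stair n (s - x - 1)\<close>, which is \<open>stair n (s - x)\<close> minus 1.\<close>

lemma ptrap_bounds:
  assumes "1 < n" "x \<le> y" "y \<le> x + 1"
  shows "0 \<le> ptrap n x y s" "ptrap n x y s \<le> 1"
  using mono_stair[OF assms(1), of "s - y" "s - x"] mono_stair[OF assms(1), of "s - x - 1" "s - y"] assms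
    stair_add1[of n "s - x - 1"]
  by (auto simp: ptrap_def)

lemma ptrap_outside:
  assumes "1 < n" "x \<le> y" "y + 1 / n \<le> s" "s \<le> x + 1"
  shows "ptrap n x y s = 0"
  using stair_eq_1[OF assms(1), of "s - x"] stair_eq_1[OF assms(1), of "s - y"] assms
  by (auto simp: ptrap_def)

section \<open>Periodic functions and the lemma of du Bois-Reymond\<close>

lemma periodic1_int:
  fixes f :: "real \<Rightarrow> 'a"
  assumes "periodic1 f"
  shows "f (x + of_int k) = f x"
proof -
  have nat: "f (x + of_nat n) = f x" for x and n :: nat
  proof (induction n)
    case (Suc n)
    then show ?case using assms unfolding periodic1_def
      by (metis add.assoc add.commute of_nat_Suc)
  qed auto
  show ?thesis
  proof (cases "k \<ge> 0")
    case True
    then show ?thesis using nat[of x "nat k"] by simp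
  next
    case False
    then show ?thesis using nat[of "x + of_int k" "nat (- k)"] by simp
  qed
qed

lemma periodic1_frac: "periodic1 f \<Longrightarrow> f (frac x) = (f (x :: real))"
  using periodic1_int[of f "frac x" "\<lfloor>x\<rfloor>"] by (simp add: frac_def)

text \<open>The definitions use the completed measure, whereas translations and Fubini are carried
  out over \<open>lborel\<close>; for Borel integrands the two agree.\<close>

lemma lebesgue_on_eq:
  fixes f :: "real \<Rightarrow> real"
  assumes "A \<in> sets borel" "f \<in> borel_measurable borel"
  shows integral_lebesgue_on_eq: "integral\<^sup>L (lebesgue_on A) f = (LINT x:A|lborel. f x)"
    and integrable_lebesgue_on_eq: "integrable (lebesgue_on A) f \<longleftrightarrow> set_integrable lborel A f"
proof -
  have m: "(\<lambda>x. indicator A x *\<^sub>R f x) \<in> borel_measurable lborel" using assms by simp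
  have A: "A \<inter> space lebesgue \<in> sets lebesgue" using assms by simp
  show "integral\<^sup>L (lebesgue_on A) f = (LINT x:A|lborel. f x)"
    unfolding integral_restrict_space[OF A] set_lebesgue_integral_def
    by (rule integral_completion[OF m])
  show "integrable (lebesgue_on A) f \<longleftrightarrow> set_integrable lborel A f"
    unfolding integrable_restrict_space[OF A] set_integrable_def
    by (rule integrable_completion[OF m])
qed

lemma AE_lebesgue_on_iff:
  fixes A :: "real set"
  assumes "A \<in> sets borel"
  shows "(AE x in lebesgue_on A. P x) \<longleftrightarrow> (AE x in lborel. x \<in> A \<longrightarrow> P x)"
  using assms by (subst AE_restrict_space_iff) (auto simp: AE_completion_iff)

lemma borel_measurable_frac [measurable (raw)]:
  assumes [measurable]: "f \<in> borel_measurable M"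
  shows "(\<lambda>x. frac (f x :: real)) \<in> borel_measurable M"
  unfolding frac_def by measurable

text \<open>The window is cut at the first integer \<open>k\<close> not below \<open>a\<close>. Its
  left piece moves by \<open>k - 1\<close> to the right end of the unit cell, its right piece by
  \<open>k\<close> to the left end.\<close>

lemma nn_integral_periodic_shift:
  fixes f :: "real \<Rightarrow> ennreal"
  assumes f: "f \<in> borel_measurable borel" and p: "periodic1 f"
  shows "(\<integral>\<^sup>+x\<in>{a..<a+1}. f x \<partial>lborel) = (\<integral>\<^sup>+x\<in>{0..<1}. f x \<partial>lborel)"
proof -
  define k where "k = \<lceil>a\<rceil>"
  have k: "a \<le> of_int k" "of_int k < a + 1" unfolding k_def by linarith+
  note [measurable] = f
  have tr: "(\<integral>\<^sup>+x\<in>{c + of_int m..<d + of_int m}. f x \<partial>lborel) = (\<integral>\<^sup>+x\<in>{c..<d}. f x \<partial>lborel)" for c d and m :: int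
  proof -
    have "(\<integral>\<^sup>+x\<in>{c + of_int m..<d + of_int m}. f x \<partial>lborel) =
      (\<integral>\<^sup>+x. f (of_int m + 1 * x) * indicator {c + of_int m..<d + of_int m} (of_int m + 1 * x) \<partial>lborel)"
      by (subst nn_integral_real_affine[of _ 1 "of_int m"]) auto
    also have "\<dots> = (\<integral>\<^sup>+x\<in>{c..<d}. f x \<partial>lborel)"
      by (rule nn_integral_cong) (auto simp: indicator_def periodic1_int[OF p] add.commute)
    finally show ?thesis .
  qed
  have split: "(\<integral>\<^sup>+x\<in>{c..<e}. f x \<partial>lborel) = (\<integral>\<^sup>+x\<in>{c..<d}. f x \<partial>lborel) + (\<integral>\<^sup>+x\<in>{d..<e}. f x \<partial>lborel)"
    if "c \<le> d" "d \<le> e" for c d e :: real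
    by (subst nn_integral_add[symmetric]) (use that in \<open>auto intro!: nn_integral_cong simp: indicator_def\<close>)
  have "(\<integral>\<^sup>+x\<in>{a..<a+1}. f x \<partial>lborel) = (\<integral>\<^sup>+x\<in>{a..<of_int k}. f x \<partial>lborel) + (\<integral>\<^sup>+x\<in>{of_int k..<a+1}. f x \<partial>lborel)"
    using k by (intro split) auto
  also have "\<dots> = (\<integral>\<^sup>+x\<in>{a - of_int (k - 1)..<1}. f x \<partial>lborel) + (\<integral>\<^sup>+x\<in>{0..<a + 1 - of_int k}. f x \<partial>lborel)"
    using tr[of "a - of_int (k - 1)" "k - 1" 1] tr[of 0 k "a + 1 - of_int k"] by simp
  also have "\<dots> = (\<integral>\<^sup>+x\<in>{0..<1}. f x \<partial>lborel)"
    using split[of 0 "a + 1 - of_int k" 1] k by (simp add: add.commute algebra_simps)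
  finally show ?thesis .
qed

lemma integral_periodic_shift:
  fixes f :: "real \<Rightarrow> real"
  assumes f: "f \<in> borel_measurable borel" and p: "periodic1 f" and i: "set_integrable lborel {0..<1} f"
  shows set_integrable_periodic_shift: "set_integrable lborel {a..<a+1} f"
    and "(LINT x:{a..<a+1}|lborel. f x) = (LINT x:{0..<1}|lborel. f x)"
proof -
  define k where "k = \<lceil>a\<rceil>"
  have k: "a \<le> of_int k" "of_int k < a + 1" unfolding k_def by linarith+
  note [measurable] = f
  \<comment> \<open>Integrability on every window comes from the nonnegative version applied to the
    norm; only then may the integrals be cut.\<close>
  have si: "set_integrable lborel {c..<c+1} f" for c
  proof -
    have pn: "periodic1 (\<lambda>x. ennreal (norm (f x)))" using p by (simp add: periodic1_def)
    have e: "(\<integral>\<^sup>+x. ennreal (norm (indicator {c..<c+1} x *\<^sub>R f x)) \<partial>lborel) =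
          (\<integral>\<^sup>+x\<in>{c..<c+1}. ennreal (norm (f x)) \<partial>lborel)" for c
      by (rule nn_integral_cong) (auto simp: indicator_def)
    have "(\<integral>\<^sup>+x\<in>{0..<1}. ennreal (norm (f x)) \<partial>lborel) < \<infinity>"
      using i e[of 0] unfolding set_integrable_def integrable_iff_bounded by simp
    then show ?thesis
      unfolding set_integrable_def integrable_iff_bounded e
      by (subst nn_integral_periodic_shift[OF _ pn]) auto
  qed
  show "set_integrable lborel {a..<a+1} f" by (rule si)
  have tr: "(LINT x:{c + of_int m..<d + of_int m}|lborel. f x) = (LINT x:{c..<d}|lborel. f x)" for c d and m :: int
  proof -
    have "(LINT x:{c + of_int m..<d + of_int m}|lborel. f x) =
      (LINT x|lborel. indicator {c + of_int m..<d + of_int m} (of_int m + 1 * x) * f (of_int m + 1 * x))"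
      unfolding set_lebesgue_integral_def by (subst lborel_integral_real_affine[of 1 _ "of_int m"]) auto
    also have "\<dots> = (LINT x:{c..<d}|lborel. f x)"
      unfolding set_lebesgue_integral_def
      by (rule Bochner_Integration.integral_cong) (auto simp: indicator_def periodic1_int[OF p] add.commute)
    finally show ?thesis .
  qed
  have split: "(LINT x:{c..<e}|lborel. f x) = (LINT x:{c..<d}|lborel. f x) + (LINT x:{d..<e}|lborel. f x)"
    if "c \<le> d" "d \<le> e" "e \<le> c + 1" for c d e :: real
  proof -
    have "{c..<e} = {c..<d} \<union> {d..<e}" using that by auto
    moreover have "set_integrable lborel {c..<d} f" "set_integrable lborel {d..<e} f"
      by (rule set_integrable_subset[OF si[of c]]; use that in auto)+
    ultimately show ?thesis by (auto intro!: set_integral_Un)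
  qed
  have "(LINT x:{a..<a+1}|lborel. f x) = (LINT x:{a..<of_int k}|lborel. f x) + (LINT x:{of_int k..<a+1}|lborel. f x)"
    using k by (intro split) auto
  also have "\<dots> = (LINT x:{a - of_int (k - 1)..<1}|lborel. f x) + (LINT x:{0..<a + 1 - of_int k}|lborel. f x)"
    using tr[of "a - of_int (k - 1)" "k - 1" 1] tr[of 0 k "a + 1 - of_int k"] by simp
  also have "\<dots> = (LINT x:{0..<1}|lborel. f x)"
    using split[of 0 "a + 1 - of_int k" 1] k by (simp add: add.commute algebra_simps)
  finally show "(LINT x:{a..<a+1}|lborel. f x) = (LINT x:{0..<1}|lborel. f x)" .
qed

section \<open>Smooth averages and increments on an interval\<close>

lemma bounded_deriv_step: "\<exists>C. \<forall>x. \<bar>deriv step x\<bar> \<le> C"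
proof -
  have "compact (deriv step ` {0..1})"
    by (intro compact_continuous_image smooth_deriv_continuous smooth_step) auto
  then obtain K where K: "\<And>x. x \<in> {0..1} \<Longrightarrow> \<bar>deriv step x\<bar> \<le> K"
    by (fastforce dest!: compact_imp_bounded simp: bounded_iff)
  have "\<bar>deriv step x\<bar> \<le> max K 0" for x
    using K[of x] deriv_step_0[of x] by (cases "0 \<le> x \<and> x \<le> 1") auto
  then show ?thesis by blast
qed

lemma deriv_step_scaled_interval:
  assumes "0 < n"
  shows "((\<lambda>s. n * deriv step (n * (s - z))) has_integral 1) {z..z + 1/n}"
proof -
  have "((\<lambda>s. n * deriv step (n * (s - z))) has_integral
      step (n * (z + 1/n - z)) - step (n * (z - z))) {z..z + 1/n}"
    by (rule fundamental_theorem_of_calculus)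
       (use assms DERIV_step_scaled in \<open>auto simp: has_real_derivative_iff_has_vector_derivative[symmetric]
          intro: has_field_derivative_at_within\<close>)
  then show ?thesis using assms by (simp add: step_0 step_1)
qed

lemma integral_lebesgue_on_subset:
  fixes f :: "real \<Rightarrow> real"
  assumes "A \<subseteq> S" "A \<in> sets lebesgue" "S \<in> sets lebesgue" "\<And>x. x \<in> S - A \<Longrightarrow> f x = 0"
  shows "integral\<^sup>L (lebesgue_on S) f = integral\<^sup>L (lebesgue_on A) f"
    and "integrable (lebesgue_on S) f \<longleftrightarrow> integrable (lebesgue_on A) f"
proof -
  have e: "(\<lambda>x. indicator S x *\<^sub>R f x) = (\<lambda>x. indicator A x *\<^sub>R f x)"
    using assms by (auto simp: indicator_def fun_eq_iff)
  show "integral\<^sup>L (lebesgue_on S) f = integral\<^sup>L (lebesgue_on A) f"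
    using assms by (simp add: integral_restrict_space e del: real_scaleR_def)
  show "integrable (lebesgue_on S) f \<longleftrightarrow> integrable (lebesgue_on A) f"
    using assms by (simp add: integrable_restrict_space e del: real_scaleR_def)
qed

text \<open>The kernel \<open>n * deriv step (n * (s - z))\<close> is nonnegative, has mass one and
  lives on \<open>[z, z + 1/n]\<close>, so the integral is an average of \<open>m\<close> over that
  window.\<close>

lemma step_average:
  fixes m :: "real \<Rightarrow> real"
  assumes n: "0 < n" and S: "{z..z + 1/n} \<subseteq> S" "S \<in> sets lebesgue"
    and m: "continuous_on {z..z + 1/n} m"
  shows "integrable (lebesgue_on S) (\<lambda>s. m s * (n * deriv step (n * (s - z))))"
    and "(\<And>s. s \<in> {z..z + 1/n} \<Longrightarrow> \<bar>m s - c\<bar> \<le> e) \<Longrightarrow>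
      \<bar>(LINT s|lebesgue_on S. m s * (n * deriv step (n * (s - z)))) - c\<bar> \<le> e"
proof -
  let ?I = "{z..z + 1/n}" and ?d = "\<lambda>s. n * deriv step (n * (s - z))"
  have z: "?d s = 0" if "s \<notin> ?I" for s
    using that n deriv_step_0[of "n * (s - z)"] by (auto simp: field_simps mult_le_0_iff not_le)
  have cd: "continuous_on ?I ?d"
    by (intro continuous_intros continuous_on_compose2[OF smooth_deriv_continuous[OF smooth_step, of UNIV]]) auto
  have i1: "integrable (lebesgue_on ?I) (\<lambda>s. m s * ?d s)" 
    by (intro continuous_imp_integrable_real continuous_intros m cd)
  have i2: "integrable (lebesgue_on ?I) ?d" 
    by (intro continuous_imp_integrable_real cd)
  note sub = integral_lebesgue_on_subset[OF S(1) _ S(2), of "\<lambda>s. m s * ?d s"]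
  show "integrable (lebesgue_on S) (\<lambda>s. m s * ?d s)"
    using i1 sub(2) z by auto
  assume b: "\<And>s. s \<in> ?I \<Longrightarrow> \<bar>m s - c\<bar> \<le> e"
  have one: "(LINT s|lebesgue_on ?I. ?d s) = 1"
    by (rule trans[OF lebesgue_integral_eq_integral[OF i2] integral_unique[OF deriv_step_scaled_interval[OF n, of z]]]; simp)
  have d0: "0 \<le> ?d s" for s using n deriv_step_nonneg by simp
  have m: "c - e \<le> m s" "m s \<le> c + e" if "s \<in> ?I" for s using b[OF that] by auto
  have "(LINT s|lebesgue_on ?I. m s * ?d s) \<le> (LINT s|lebesgue_on ?I. (c + e) * ?d s)"
    using m d0 i2 by (intro integral_mono[OF i1] integrable_mult_right mult_right_mono) auto
  moreover have "(LINT s|lebesgue_on ?I. (c - e) * ?d s) \<le> (LINT s|lebesgue_on ?I. m s * ?d s)"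
    using m d0 i2 by (intro integral_mono[OF _ i1] integrable_mult_right mult_right_mono) auto
  moreover have "(LINT s|lebesgue_on S. m s * ?d s) = (LINT s|lebesgue_on ?I. m s * ?d s)"
    using sub(1) z by auto
  ultimately show "\<bar>(LINT s|lebesgue_on S. m s * ?d s) - c\<bar> \<le> e"
    using one by simp
qed

lemma trap_tendsto:
  assumes "x < y" "0 \<le> N"
  shows "(\<lambda>k. trap (real k + 1 + N) x y s) \<longlonglongrightarrow> indicator {x<..y} s"
proof -
  have ev: "\<forall>\<^sub>F k in sequentially. c / (real k + 1 + N) \<le> d" if "0 < d" for c d
  proof -
    have "(\<lambda>k. c / (real k + 1 + N)) \<longlonglongrightarrow> 0" by real_asymp
    from order_tendstoD(2)[OF this that] show ?thesis by eventually_elim simp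
  qed
  consider "s \<le> x" | "x < s" "s \<le> y" | "y < s" by linarith
  then show ?thesis
  proof cases
    case 1
    then show ?thesis using assms trap_outside[of _ x y s] by simp
  next
    case 2
    have "\<forall>\<^sub>F k in sequentially. trap (real k + 1 + N) x y s = 1"
      using ev[of "s - x" 1] 2 assms by (auto elim!: eventually_mono intro!: trap_inside)
    then show ?thesis using 2 by (auto intro: tendsto_eventually)
  next
    case 3
    have "\<forall>\<^sub>F k in sequentially. trap (real k + 1 + N) x y s = 0"
      using ev[of "s - y" 1] 3 assms by (auto elim!: eventually_mono intro!: trap_outside)
    then show ?thesis using 3 by (auto intro: tendsto_eventually)
  qed
qed

text \<open>Tested with a trapezoid, the left-hand side is an average of \<open>m\<close> near
  \<open>x\<close> minus one near \<open>y\<close>, while the right-hand side tends to minus the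
  integral over \<open>(x,y]\<close>. Asking for the weak identity on trapezoids alone lets the
  lemma serve both the time variable and the obstacle problem on a facet.\<close>

lemma du_Bois_Reymond_interval:
  fixes m \<kappa> :: "real \<Rightarrow> real"
  assumes S: "S \<in> sets lebesgue" "{a<..<b} \<subseteq> S" and xy: "a < x" "x < y" "y < b"
    and m: "continuous_on {a<..<b} m" and \<kappa>: "integrable (lebesgue_on S) \<kappa>"
    and weak: "\<And>n. 0 < n \<Longrightarrow> y + 1/n < b \<Longrightarrow>
      (LINT s|lebesgue_on S. m s * deriv (trap n x y) s) = - (LINT s|lebesgue_on S. \<kappa> s * trap n x y s)"
  shows "m y - m x = (LINT s|lebesgue_on {x<..y}. \<kappa> s)"
proof -
  \<comment> \<open>With this offset the ramp after \<open>y\<close> always fits: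
    \<open>1 / N\<close> is half the distance from \<open>y\<close> to \<open>b\<close>.\<close>
  define N where "N = 2 / (b - y)"
  define n where "n k = real k + 1 + N" for k
  have N: "0 < N" using xy by (simp add: N_def)
  have n: "0 < n k" for k using N by (simp add: n_def)
  have nb: "1 / n k < b - y" for k
  proof -
    have "1 / n k \<le> 1 / N" using N by (intro divide_left_mono) (auto simp: n_def)
    also have "\<dots> < b - y" using xy by (simp add: N_def)
    finally show ?thesis .
  qed
  define A where "A z k = (LINT s|lebesgue_on S. m s * (n k * deriv step (n k * (s - z))))" for z k
  have sub: "{z..z + 1 / n k} \<subseteq> {a<..<b}" if "z = x \<or> z = y" for z k
    using that xy nb[of k] by auto
  have A: "A z \<longlonglongrightarrow> m z" if z: "z = x \<or> z = y" for z
  proof (rule LIMSEQ_I)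
    fix r :: real assume "0 < r"
    have "isCont m z" using m z xy by (auto simp: continuous_on_eq_continuous_at)
    then obtain d where d: "d > 0" "\<And>s. dist s z < d \<Longrightarrow> dist (m s) (m z) < r / 2"
      using \<open>0 < r\<close> unfolding continuous_at_eps_delta by (meson half_gt_zero)
    have "(\<lambda>k. 1 / n k) \<longlonglongrightarrow> 0" unfolding n_def by real_asymp
    then have "\<forall>\<^sub>F k in sequentially. 1 / n k < d" using d(1) by (rule order_tendstoD(2))
    then obtain k0 where k0: "\<And>k. k \<ge> k0 \<Longrightarrow> 1 / n k < d" by (auto simp: eventually_sequentially)
    have "norm (A z k - m z) < r" if "k \<ge> k0" for k
    proof -
      have "\<bar>A z k - m z\<bar> \<le> r / 2"
        unfolding A_def
      proof (rule step_average(2)[OF n _ S(1)])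
        show "{z..z + 1 / n k} \<subseteq> S" using sub[OF z] S(2) by blast
        show "continuous_on {z..z + 1 / n k} m" by (rule continuous_on_subset[OF m sub[OF z]])
        fix s assume "s \<in> {z..z + 1 / n k}"
        then show "\<bar>m s - m z\<bar> \<le> r / 2" using d(2)[of s] k0[OF that] by (auto simp: dist_real_def)
      qed
      then show ?thesis using \<open>0 < r\<close> by simp
    qed
    then show "\<exists>no. \<forall>k\<ge>no. norm (A z k - m z) < r" by blast
  qed
  have L: "(LINT s|lebesgue_on S. m s * deriv (trap (n k) x y) s) = A x k - A y k" for k
  proof -
    have i: "integrable (lebesgue_on S) (\<lambda>s. m s * (n k * deriv step (n k * (s - z))))" if z: "z = x \<or> z = y" for z
      using sub[OF z] S by (intro step_average(1)[OF n _ S(1)] continuous_on_subset[OF m sub[OF z]]) auto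
    show ?thesis
      unfolding A_def deriv_trap right_diff_distrib[of "m s" for s]
      by (rule Bochner_Integration.integral_diff) (use i in auto)
  qed
  have "(\<lambda>k. LINT s|lebesgue_on S. \<kappa> s * trap (n k) x y s) \<longlonglongrightarrow> (LINT s|lebesgue_on S. \<kappa> s * indicator {x<..y} s)"
  proof (rule integral_dominated_convergence)
    have "(trap (n k) x y) \<in> borel_measurable borel" for k
      by (intro borel_measurable_continuous_onI smooth_continuous smooth_trap)
    then have [measurable]: "(trap (n k) x y) \<in> borel_measurable (lebesgue_on S)" for k
      by (auto intro: measurable_restrict_space1 simp: measurable_completion)
    show "(\<lambda>s. \<kappa> s * trap (n k) x y s) \<in> borel_measurable (lebesgue_on S)" for k
      using \<kappa> by measurable
    have [measurable]: "(indicator {x<..y} :: real \<Rightarrow> real) \<in> borel_measurable (lebesgue_on S)"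
      by (auto intro!: measurable_restrict_space1 measurable_completion)
    show "(\<lambda>s. \<kappa> s * indicator {x<..y} s) \<in> borel_measurable (lebesgue_on S)"
      using \<kappa> by measurable
    show "integrable (lebesgue_on S) (\<lambda>s. \<bar>\<kappa> s\<bar>)" using \<kappa> by simp
    show "AE s in lebesgue_on S. (\<lambda>k. \<kappa> s * trap (n k) x y s) \<longlonglongrightarrow> \<kappa> s * indicator {x<..y} s"
      unfolding n_def using trap_tendsto[OF xy(2), of N] N by (intro AE_I2 tendsto_intros) auto
    show "AE s in lebesgue_on S. norm (\<kappa> s * trap (n k) x y s) \<le> \<bar>\<kappa> s\<bar>" for k
      using trap_bounds[OF n, of x y k] xy by (intro AE_I2) (auto simp: abs_mult intro!: mult_left_le)
  qed
  moreover have "(\<lambda>k. - (LINT s|lebesgue_on S. \<kappa> s * trap (n k) x y s)) \<longlonglongrightarrow> m x - m y"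
  proof -
    have "y + 1 / n k < b" for k using nb[of k] by simp
    then have "- (LINT s|lebesgue_on S. \<kappa> s * trap (n k) x y s) = A x k - A y k" for k
      using weak[OF n, of k] L[of k] by simp
    then show ?thesis using A by (auto intro!: tendsto_intros)
  qed
  ultimately have "m x - m y = - (LINT s|lebesgue_on S. \<kappa> s * indicator {x<..y} s)"
    using LIMSEQ_unique tendsto_minus by blast
  also have "(LINT s|lebesgue_on S. \<kappa> s * indicator {x<..y} s) = (LINT s|lebesgue_on {x<..y}. \<kappa> s)"
    using S xy by (subst integral_lebesgue_on_subset(1)[of "{x<..y}"])
      (auto intro!: Bochner_Integration.integral_cong simp: space_restrict_space)
  finally show ?thesis by simp
qed

section \<open>Smooth averages and increments on the torus\<close>

lemma deriv_stair_bounded: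
  assumes "1 < n"
  shows "\<exists>C. \<forall>s. \<bar>deriv (stair n) s\<bar> \<le> C"
proof -
  obtain C where "\<And>x. \<bar>deriv step x\<bar> \<le> C" using bounded_deriv_step by blast
  then have "\<bar>deriv (stair n) s\<bar> \<le> n * C" for s
    using assms by (auto simp: deriv_stair abs_mult intro!: mult_left_mono)
  then show ?thesis by blast
qed

lemma borel_deriv_stair [measurable]: "1 < n \<Longrightarrow> deriv (stair n) \<in> borel_measurable borel"
  by (intro borel_measurable_continuous_onI smooth_deriv_continuous smooth_stair)

lemma torus_measurable: "f \<in> borel_measurable borel \<Longrightarrow> f \<in> borel_measurable torus_measure"
  by (simp add: measurable_completion measurable_restrict_space1)

lemma space_torus [simp]: "space torus_measure = {0..<1}"
  by (simp add: space_restrict_space)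

lemma emeasure_torus_finite: "finite_measure torus_measure"
  by (rule finite_measureI) (simp add: emeasure_restrict_space)

lemma integrable_mult_bounded:
  fixes f h :: "'a \<Rightarrow> real"
  assumes "integrable M f" "h \<in> borel_measurable M" "\<And>x. \<bar>h x\<bar> \<le> C"
  shows "integrable M (\<lambda>x. f x * h x)"
proof (rule Bochner_Integration.integrable_bound)
  show "integrable M (\<lambda>x. C * \<bar>f x\<bar>)" using assms(1) by simp
  show "(\<lambda>x. f x * h x) \<in> borel_measurable M" using assms by measurable
  have "\<bar>f x\<bar> * \<bar>h x\<bar> \<le> C * \<bar>f x\<bar>" for x
    using mult_left_mono[OF assms(3)[of x], of "\<bar>f x\<bar>"] by (simp add: mult.commute)
  moreover have "0 \<le> C" using assms(3)[of undefined] by linarith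
  ultimately show "AE x in M. norm (f x * h x) \<le> norm (C * \<bar>f x\<bar>)"
    by (intro AE_I2) (simp add: abs_mult)
qed

text \<open>For periodic \<open>F\<close> this is a mean over the window from \<open>z\<close> to
  \<open>z + 1/n\<close>, with a nonnegative weight of mass one.\<close>

definition stair_avg :: "real \<Rightarrow> (real \<Rightarrow> real) \<Rightarrow> real \<Rightarrow> real" where
  "stair_avg n F z = (LINT s|torus_measure. F s * deriv (stair n) (s - z))"

lemma integrable_stair_avg:
  assumes "1 < n" "integrable torus_measure F"
  shows "integrable torus_measure (\<lambda>s. F s * deriv (stair n) (s - z))"
proof -
  obtain C where "\<And>s. \<bar>deriv (stair n) s\<bar> \<le> C" using deriv_stair_bounded[OF assms(1)] by blast
  moreover have "(\<lambda>s. deriv (stair n) (s - z)) \<in> borel_measurable torus_measure"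
    by (intro torus_measurable measurable_compose[OF _ borel_deriv_stair[OF assms(1)]]) measurable
  ultimately show ?thesis using integrable_mult_bounded[OF assms(2)] by blast
qed

lemma stair_avg_one:
  assumes "1 < n"
  shows "(LINT s|torus_measure. deriv (stair n) (s - z)) = 1"
proof -
  have [measurable]: "(\<lambda>s. deriv (stair n) (s - z)) \<in> borel_measurable borel"
    by (intro measurable_compose[OF _ borel_deriv_stair[OF assms(1)]]) measurable
  have "(LINT s|torus_measure. deriv (stair n) (s - z)) = (LINT s:{0..<1}|lborel. deriv (stair n) (s - z))"
    by (rule integral_lebesgue_on_eq) auto
  also have "\<dots> = (LINT s|lborel. deriv (stair n) (s - z) * indicator {0..1} s)"
    unfolding set_lebesgue_integral_def
    using AE_lborel_singleton[of "1::real"]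
    by (intro integral_cong_AE) (auto simp: indicator_def)
  also have "\<dots> = stair n (1 - z) - stair n (0 - z)"
  proof (rule integral_FTC_Icc_real)
    fix s
    show "((\<lambda>s. stair n (s - z)) has_real_derivative deriv (stair n) (s - z)) (at s)"
      by (rule DERIV_cong[OF DERIV_chain2[OF smooth_DERIV[OF smooth_stair[OF assms]]]])
       (auto intro!: derivative_eq_intros)
    have "continuous_on UNIV (\<lambda>s. deriv (stair n) (s - z))"
      by (intro continuous_on_compose2[OF smooth_deriv_continuous[OF smooth_stair[OF assms], of UNIV]]
            continuous_intros) auto
    then show "isCont (\<lambda>s. deriv (stair n) (s - z)) s"
      by (simp add: continuous_on_eq_continuous_at)
  qed simp
  also have "\<dots> = 1" using stair_add1[of n "0 - z"] by simp
  finally show ?thesis .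
qed

text \<open>Only the window to the right of \<open>z\<close> carries weight; a point
  \<open>s\<close> of the unit cell is compared with its translate \<open>z + frac (s - z)\<close>
  in that window.\<close>

lemma stair_avg_ge:
  assumes "1 < n" "integrable torus_measure F" "periodic1 F" "\<And>s. z < s \<Longrightarrow> s < z + 1 / n \<Longrightarrow> c \<le> F s"
  shows "c \<le> stair_avg n F z"
proof -
  have i1: "integrable torus_measure (\<lambda>s. F s * deriv (stair n) (s - z))"
    by (rule integrable_stair_avg[OF assms(1,2)])
  have i2: "integrable torus_measure (\<lambda>s. c * deriv (stair n) (s - z))"
    using emeasure_torus_finite by (intro integrable_stair_avg[OF assms(1)]) (simp add: finite_measure.integrable_const)
  have "(LINT s|torus_measure. c * deriv (stair n) (s - z)) \<le> stair_avg n F z"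
    unfolding stair_avg_def
  proof (rule integral_mono[OF i2 i1])
    fix s
    show "c * deriv (stair n) (s - z) \<le> F s * deriv (stair n) (s - z)"
    proof (cases "deriv (stair n) (s - z) = 0")
      case False
      then have "0 < frac (s - z)" "frac (s - z) < 1 / n" using deriv_stair_nonzero[OF assms(1)] by auto
      then have "c \<le> F (z + frac (s - z))" by (intro assms(4)) auto
      also have "F (z + frac (s - z)) = F s"
        using periodic1_int[OF assms(3), of s "- \<lfloor>s - z\<rfloor>"] by (simp add: frac_def algebra_simps)
      finally show ?thesis by (intro mult_right_mono deriv_stair_nonneg assms(1))
    qed simp
  qed
  then show ?thesis using stair_avg_one[OF assms(1), of z] by simp
qed

lemma stair_avg_minus: "stair_avg n (\<lambda>s. - F s) z = - stair_avg n F z"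
  by (simp add: stair_avg_def)

lemma stair_avg_le:
  assumes "1 < n" "integrable torus_measure F" "periodic1 F" "\<And>s. z < s \<Longrightarrow> s < z + 1 / n \<Longrightarrow> F s \<le> c"
  shows "stair_avg n F z \<le> c"
  using stair_avg_ge[of n "\<lambda>s. - F s" z "- c"] assms
  by (simp add: stair_avg_minus periodic1_def)

lemma stair_avg_tendsto:
  assumes "integrable torus_measure F" "periodic1 F" "isCont F z"
  shows "(\<lambda>k. stair_avg (real k + 2) F z) \<longlonglongrightarrow> F z"
proof (rule LIMSEQ_I)
  fix r :: real assume "0 < r"
  then obtain d where d: "d > 0" "\<And>s. dist s z < d \<Longrightarrow> dist (F s) (F z) < r / 2"
    using assms(3) unfolding continuous_at_eps_delta by (meson half_gt_zero)
  have "(\<lambda>k. 1 / (real k + 2)) \<longlonglongrightarrow> 0" by real_asymp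
  then have "\<forall>\<^sub>F k in sequentially. 1 / (real k + 2) < d" using d(1) by (rule order_tendstoD(2))
  then obtain k0 where k0: "\<And>k. k \<ge> k0 \<Longrightarrow> 1 / (real k + 2) < d" by (auto simp: eventually_sequentially)
  have "norm (stair_avg (real k + 2) F z - F z) < r" if "k \<ge> k0" for k
  proof -
    have "F z - r / 2 \<le> F s" "F s \<le> F z + r / 2" if "z < s" "s < z + 1 / (real k + 2)" for s
    proof -
      have "\<bar>F s - F z\<bar> < r / 2"
        using d(2)[of s] k0[OF \<open>k \<ge> k0\<close>] that unfolding dist_real_def by linarith
      then show "F z - r / 2 \<le> F s" "F s \<le> F z + r / 2" by linarith+
    qed
    then have "F z - r / 2 \<le> stair_avg (real k + 2) F z" "stair_avg (real k + 2) F z \<le> F z + r / 2"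
      using assms by (auto intro!: stair_avg_ge stair_avg_le)
    then show ?thesis using \<open>0 < r\<close> by simp
  qed
  then show "\<exists>no. \<forall>k\<ge>no. norm (stair_avg (real k + 2) F z - F z) < r" by blast
qed

lemma integral_deriv_ptrap:
  assumes "1 < n" "integrable torus_measure F"
  shows "(LINT s|torus_measure. F s * deriv (ptrap n x y) s) = stair_avg n F x - stair_avg n F y"
  unfolding stair_avg_def deriv_ptrap[OF assms(1)] right_diff_distrib
  by (rule Bochner_Integration.integral_diff) (intro integrable_stair_avg assms)+

lemma borel_ptrap: "1 < n \<Longrightarrow> ptrap n x y \<in> borel_measurable borel"
  using smooth_torus_ptrap[of n x y] unfolding smooth_torus_def
  by (intro borel_measurable_continuous_onI smooth_continuous) auto

text \<open>For fixed \<open>x\<close> and \<open>y\<close> the weak identity is asked only for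
  countably many periodic trapezoids, so that with rational nodes all exceptional null sets of times
  can be united.\<close>

lemma du_Bois_Reymond_torus:
  fixes q v :: "real \<Rightarrow> real"
  assumes q: "periodic1 q" "continuous_on UNIV q" "integrable torus_measure q"
    and v: "periodic1 v" "v \<in> borel_measurable borel" "set_integrable lborel {0..<1} v"
    and xy: "x < y" "y < x + 1"
    and weak: "\<And>k :: nat. (LINT s|torus_measure. q s * deriv (ptrap (real k + 2) x y) s) =
      - (LINT s|torus_measure. v s * ptrap (real k + 2) x y s)"
  shows "q y - q x = (LINT s:{x<..y}|lborel. v s)"
proof -
  \<comment> \<open>The pointwise limit of the periodic trapezoids: a difference of ceilings, equal
    to the indicator of \<open>(x,y]\<close> repeated with period one.\<close>
  define W where "W s = real_of_int (\<lceil>s - x\<rceil> - \<lceil>s - y\<rceil>)" for s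
  have iv: "integrable torus_measure v" using v by (simp add: integrable_lebesgue_on_eq)
  have [measurable]: "W \<in> borel_measurable borel" unfolding W_def by measurable
  note [measurable] = v(2) borel_ptrap[THEN torus_measurable]
  have pt: "\<bar>ptrap (real k + 2) x y s\<bar> \<le> 1" for k s
    using ptrap_bounds[of "real k + 2" x y s] xy by auto
  have "(\<lambda>k. LINT s|torus_measure. v s * ptrap (real k + 2) x y s) \<longlonglongrightarrow> (LINT s|torus_measure. v s * W s)"
  proof (rule integral_dominated_convergence)
    show "integrable torus_measure (\<lambda>s. \<bar>v s\<bar>)" using iv by simp
    show "AE s in torus_measure. (\<lambda>k. v s * ptrap (real k + 2) x y s) \<longlonglongrightarrow> v s * W s"
      unfolding ptrap_def W_def of_int_diff by (intro AE_I2 tendsto_intros stair_tendsto)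
    show "AE s in torus_measure. norm (v s * ptrap (real k + 2) x y s) \<le> \<bar>v s\<bar>" for k
      using pt[of k] by (intro AE_I2) (auto simp: abs_mult intro!: mult_left_le)
    show "(\<lambda>s. v s * W s) \<in> borel_measurable torus_measure" by (intro torus_measurable) measurable
    show "(\<lambda>s. v s * ptrap (real k + 2) x y s) \<in> borel_measurable torus_measure" for k
      using iv borel_ptrap[of "real k + 2" x y, THEN torus_measurable] by measurable
  qed
  moreover have "(\<lambda>k. - (LINT s|torus_measure. v s * ptrap (real k + 2) x y s)) \<longlonglongrightarrow> q x - q y"
    unfolding weak[symmetric]
    using q by (subst integral_deriv_ptrap)
      (auto intro!: tendsto_intros stair_avg_tendsto simp: continuous_on_eq_continuous_at)
  ultimately have "q x - q y = - (LINT s|torus_measure. v s * W s)"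
    using LIMSEQ_unique tendsto_minus by blast
  also have "(LINT s|torus_measure. v s * W s) = (LINT s:{0..<1}|lborel. v s * W s)"
    by (rule integral_lebesgue_on_eq) auto
  \<comment> \<open>Moving the unit cell so that it starts at \<open>x\<close> makes
    \<open>(x,y]\<close> an interval without wrap-around.\<close>
  also have "\<dots> = (LINT s:{x..<x+1}|lborel. v s * W s)"
  proof (rule integral_periodic_shift(2)[symmetric])
    have W1: "W (s + 1) = W s" for s
      unfolding W_def using ceiling_add_one[of "s - x"] ceiling_add_one[of "s - y"] by (simp add: add.commute add_diff_eq)
    show "periodic1 (\<lambda>s. v s * W s)" using v(1) by (simp add: periodic1_def W1)
    have "\<bar>\<lceil>s - x\<rceil> - \<lceil>s - y\<rceil>\<bar> \<le> 1" for s using xy by linarith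
    then have W: "\<bar>W s\<bar> \<le> 1" for s unfolding W_def by (metis of_int_1 of_int_abs of_int_le_iff)
    show "set_integrable lborel {0..<1} (\<lambda>s. v s * W s)"
      using integrable_mult_bounded[of torus_measure v W 1, OF iv torus_measurable W]
      by (simp add: integrable_lebesgue_on_eq)
  qed measurable
  also have "\<dots> = (LINT s:{x<..y}|lborel. v s)"
    unfolding set_lebesgue_integral_def
  proof (rule integral_cong_AE)
    show "AE s in lborel. indicator {x..<x + 1} s *\<^sub>R (v s * W s) = indicator {x<..y} s *\<^sub>R v s"
      using AE_lborel_singleton[of x]
    proof eventually_elim
      case (elim s)
      have "W s = (if s \<le> y then 1 else 0)" if "x < s" "s < x + 1"
      proof -
        have "\<lceil>s - x\<rceil> = 1" using that by linarith
        moreover have "\<lceil>s - y\<rceil> = (if s \<le> y then 0 else 1)" using that xy by (auto; linarith)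
        ultimately show ?thesis by (simp add: W_def)
      qed
      then show ?case using elim xy by (auto simp: indicator_def)
    qed
  qed measurable
  finally show ?thesis by simp
qed

section \<open>One-sided bounds on the distributional derivative\<close>

text \<open>The gaps from \<open>x\<close> to \<open>e x\<close> are disjoint for distinct points of
  \<open>A\<close>, and each contains a rational.\<close>

lemma countable_right_isolated:
  fixes A :: "real set"
  assumes "\<And>x. x \<in> A \<Longrightarrow> \<exists>e>x. \<forall>y\<in>A. x < y \<longrightarrow> e \<le> y"
  shows "countable A"
proof -
  obtain e where e: "\<And>x. x \<in> A \<Longrightarrow> x < e x" "\<And>x y. x \<in> A \<Longrightarrow> y \<in> A \<Longrightarrow> x < y \<Longrightarrow> e x \<le> y"
    using assms by metis
  have "\<exists>q::rat. x < of_rat q \<and> of_rat q < e x" if "x \<in> A" for x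
    using of_rat_dense[OF e(1)[OF that]] by blast
  then obtain q :: "real \<Rightarrow> rat" where q: "\<And>x. x \<in> A \<Longrightarrow> x < of_rat (q x) \<and> of_rat (q x) < e x" by metis
  have "q x < q y" if "x \<in> A" "y \<in> A" "x < y" for x y
  proof -
    have "real_of_rat (q x) < of_rat (q y)" using q[OF that(1)] q[OF that(2)] e(2)[OF that] by linarith
    then show ?thesis by (simp add: of_rat_less)
  qed
  then have "inj_on q A" by (intro linorder_inj_onI) (auto simp: less_le)
  then show ?thesis by (rule countableI') 
qed

section \<open>Good representatives: discontinuities and one-sided intervals\<close>

lemma good_representative_minus: "good_representative f \<Longrightarrow> good_representative (\<lambda>x. - f x)"
proof (unfold good_representative_def, intro allI)
  fix x
  assume "\<forall>x. \<exists>l r. (f \<longlongrightarrow> l) (at_left x) \<and> (f \<longlongrightarrow> r) (at_right x) \<and> min l r \<le> f x \<and> f x \<le> max l r"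
  then obtain l r where "(f \<longlongrightarrow> l) (at_left x)" "(f \<longlongrightarrow> r) (at_right x)" "min l r \<le> f x" "f x \<le> max l r" by blast
  then show "\<exists>l r. ((\<lambda>x. - f x) \<longlongrightarrow> l) (at_left x) \<and> ((\<lambda>x. - f x) \<longlongrightarrow> r) (at_right x) \<and> min l r \<le> - f x \<and> - f x \<le> max l r"
    by (intro exI[of _ "- l"] exI[of _ "- r"]) (auto intro: tendsto_minus)
qed

lemma good_representative_add:
  assumes "good_representative f" "continuous_on UNIV g"
  shows "good_representative (\<lambda>x. f x + g x)"
  unfolding good_representative_def
proof
  fix x
  obtain l r where *: "(f \<longlongrightarrow> l) (at_left x)" "(f \<longlongrightarrow> r) (at_right x)" "min l r \<le> f x" "f x \<le> max l r"
    using assms(1) unfolding good_representative_def by blast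
  have "(g \<longlongrightarrow> g x) (at x)" using assms(2) by (simp add: continuous_on_def)
  then have "(g \<longlongrightarrow> g x) (at_left x)" "(g \<longlongrightarrow> g x) (at_right x)" by (auto intro: tendsto_within_subset)
  then show "\<exists>l r. ((\<lambda>x. f x + g x) \<longlongrightarrow> l) (at_left x) \<and> ((\<lambda>x. f x + g x) \<longlongrightarrow> r) (at_right x) \<and>
      min l r \<le> f x + g x \<and> f x + g x \<le> max l r"
    using * by (intro exI[of _ "l + g x"] exI[of _ "r + g x"]) (auto intro: tendsto_add)
qed

text \<open>Jumps across a fixed level \<open>c\<close> are isolated on the right: after one the
  function stays above \<open>c\<close> for a while, whereas just before the next it must be below
  \<open>c\<close>. Every upward jump crosses some rational level.\<close>

lemma countable_upward_jumps:
  fixes f :: "real \<Rightarrow> real"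
  shows "countable {x. \<exists>l r. (f \<longlongrightarrow> l) (at_left x) \<and> (f \<longlongrightarrow> r) (at_right x) \<and> l < r}"
proof -
  define A where "A c = {x. \<exists>l r. (f \<longlongrightarrow> l) (at_left x) \<and> (f \<longlongrightarrow> r) (at_right x) \<and> l < c \<and> c < r}" for c :: real
  have "countable (A c)" for c
  proof (rule countable_right_isolated)
    fix x assume "x \<in> A c"
    then obtain r where "(f \<longlongrightarrow> r) (at_right x)" "c < r" by (auto simp: A_def)
    then have "\<forall>\<^sub>F y in at_right x. c < f y" by (rule order_tendstoD)
    then obtain e where e: "e > x" "\<And>y. x < y \<Longrightarrow> y < e \<Longrightarrow> c < f y" by (auto simp: eventually_at_right_field)
    have "e \<le> y" if "y \<in> A c" "x < y" for y
    proof (rule ccontr)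
      assume "\<not> e \<le> y"
      obtain l where "(f \<longlongrightarrow> l) (at_left y)" "l < c" using \<open>y \<in> A c\<close> by (auto simp: A_def)
      then have "\<forall>\<^sub>F z in at_left y. f z < c" by (rule order_tendstoD)
      then obtain d where d: "d < y" "\<And>z. d < z \<Longrightarrow> z < y \<Longrightarrow> f z < c" by (auto simp: eventually_at_left_field)
      have "max x d < y" using d(1) that by simp
      then obtain z where "max x d < z" "z < y" using dense by blast
      then show False using e(2)[of z] d(2)[of z] \<open>\<not> e \<le> y\<close> by auto
    qed
    then show "\<exists>e>x. \<forall>y\<in>A c. x < y \<longrightarrow> e \<le> y" using e(1) by blast
  qed
  moreover have "{x. \<exists>l r. (f \<longlongrightarrow> l) (at_left x) \<and> (f \<longlongrightarrow> r) (at_right x) \<and> l < r} \<subseteq> (\<Union>c\<in>\<rat>. A c)"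
  proof
    fix x assume "x \<in> {x. \<exists>l r. (f \<longlongrightarrow> l) (at_left x) \<and> (f \<longlongrightarrow> r) (at_right x) \<and> l < r}"
    then obtain l r where lr: "(f \<longlongrightarrow> l) (at_left x)" "(f \<longlongrightarrow> r) (at_right x)" "l < r" by blast
    obtain c where "c \<in> \<rat>" "l < c" "c < r" using Rats_dense_in_real[OF lr(3)] by blast
    then show "x \<in> (\<Union>c\<in>\<rat>. A c)" using lr unfolding A_def by blast
  qed
  ultimately show ?thesis by (rule countable_subset[rotated, OF countable_UN[OF countable_rat]])
qed

text \<open>At a discontinuity the one-sided limits differ, since otherwise the value is squeezed
  between them; so the point is an upward jump of \<open>f\<close> or of \<open>- f\<close>.\<close>

lemma good_representative_countable_discontinuities:
  assumes "good_representative f"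
  shows "countable {x. \<not> isCont f x}"
proof -
  let ?J = "\<lambda>f. {x. \<exists>l r. (f \<longlongrightarrow> l) (at_left x) \<and> (f \<longlongrightarrow> r) (at_right x) \<and> l < (r :: real)}"
  have "{x. \<not> isCont f x} \<subseteq> ?J f \<union> ?J (\<lambda>x. - f x)"
  proof
    fix x assume x: "x \<in> {x. \<not> isCont f x}"
    obtain l r where *: "(f \<longlongrightarrow> l) (at_left x)" "(f \<longlongrightarrow> r) (at_right x)" "min l r \<le> f x" "f x \<le> max l r"
      using assms(1) unfolding good_representative_def by blast
    consider "l = r" | "l < r" | "- l < - r" by linarith
    then show "x \<in> ?J f \<union> ?J (\<lambda>x. - f x)"
    proof cases
      case 1
      then have "f x = l" using * by auto
      then have "isCont f x" using * 1 by (simp add: isCont_def filterlim_at_split)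
      then show ?thesis using x by simp
    next
      case 2
      then show ?thesis using * by blast
    next
      case 3
      then show ?thesis using * tendsto_minus by blast
    qed
  qed
  then show ?thesis by (rule countable_subset) (intro countable_Un countable_upward_jumps)
qed

lemma good_representative_borel:
  assumes "good_representative f"
  shows "f \<in> borel_measurable borel"
proof (rule borel_measurable_continuous_countable_exceptions[OF good_representative_countable_discontinuities[OF assms]])
  show "continuous_on (- {x. \<not> isCont f x}) f"
    by (auto intro: continuous_at_imp_continuous_on)
qed

text \<open>A pointwise inequality becomes one on an interval, which integrals can see: the value
  lies between the one-sided limits, so at least one of these is below \<open>c\<close>.\<close>

lemma good_representative_near_less:
  assumes "good_representative f" "f x < c" "0 < d"
  obtains x1 x2 where "x - d < x1" "x1 < x2" "x2 < x + d" "\<And>z. x1 < z \<Longrightarrow> z < x2 \<Longrightarrow> f z < c"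
proof -
  obtain l r where *: "(f \<longlongrightarrow> l) (at_left x)" "(f \<longlongrightarrow> r) (at_right x)" "min l r \<le> f x" "f x \<le> max l r"
    using assms(1) unfolding good_representative_def by blast
  have "l < c \<or> r < c" using * assms by linarith
  then show ?thesis
  proof
    assume "l < c"
    then have "\<forall>\<^sub>F z in at_left x. f z < c" using * by (blast intro: order_tendstoD)
    then obtain e where e: "e < x" "\<And>z. e < z \<Longrightarrow> z < x \<Longrightarrow> f z < c" by (auto simp: eventually_at_left_field)
    then show ?thesis using assms(3) by (intro that[of "max e (x - d/2)" x]) auto
  next
    assume "r < c"
    then have "\<forall>\<^sub>F z in at_right x. f z < c" using * by (blast intro: order_tendstoD)
    then obtain e where e: "e > x" "\<And>z. x < z \<Longrightarrow> z < e \<Longrightarrow> f z < c" by (auto simp: eventually_at_right_field)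
    then show ?thesis using assms(3) by (intro that[of x "min e (x + d/2)"]) auto
  qed
qed

section \<open>Testing the derivative measure with periodic trapezoids\<close>

lemma smooth_borel: "smooth f \<Longrightarrow> f \<in> borel_measurable borel"
  by (intro borel_measurable_continuous_onI smooth_continuous)

text \<open>Barriers are not periodic. The restriction of \<open>f\<close> to the cell
  \<open>[c, c+1)\<close>, extended periodically, is \<open>f (c + frac (x - c))\<close>, and this
  is what gets paired with periodic test functions.\<close>

lemma periodic_torus_shift:
  fixes f :: "real \<Rightarrow> real"
  assumes "f \<in> borel_measurable borel" "periodic1 \<phi>" "smooth \<phi>" "continuous_on {c..c+1} f"
  shows "integrable torus_measure (\<lambda>x. f (c + frac (x - c)))"
    and "integrable torus_measure (\<lambda>x. f (c + frac (x - c)) * \<phi> x)"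
    and "(LINT x|torus_measure. f (c + frac (x - c)) * \<phi> x) = (LINT x|lborel. (f x * \<phi> x) * indicator {c..c+1} x)"
proof -
  note [measurable] = assms(1) smooth_borel[OF assms(3)]
  have "compact (f ` {c..c+1})" using assms(4) by (intro compact_continuous_image) auto
  then obtain K where K: "\<And>x. x \<in> {c..c+1} \<Longrightarrow> \<bar>f x\<bar> \<le> K"
    by (fastforce dest!: compact_imp_bounded simp: bounded_iff)
  have "compact (\<phi> ` {0..1})" using assms(3) by (intro compact_continuous_image smooth_continuous) auto
  then obtain L where L: "\<And>x. x \<in> {0..1} \<Longrightarrow> \<bar>\<phi> x\<bar> \<le> L"
    by (fastforce dest!: compact_imp_bounded simp: bounded_iff)
  have Lall: "\<bar>\<phi> x\<bar> \<le> L" for x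
    using L[of "frac x"] frac_lt_1[of x] frac_ge_0[of x] by (simp add: periodic1_frac[OF assms(2)])
  have Kall: "\<bar>f (c + frac (x - c))\<bar> \<le> K" for x
    using K[of "c + frac (x - c)"] frac_lt_1[of "x - c"] frac_ge_0[of "x - c"] by simp
  show i: "integrable torus_measure (\<lambda>x. f (c + frac (x - c)))"
    by (rule finite_measure.integrable_const_bound[OF emeasure_torus_finite, of _ K])
       (use Kall in \<open>auto intro!: torus_measurable\<close>)
  show i2: "integrable torus_measure (\<lambda>x. f (c + frac (x - c)) * \<phi> x)"
    by (rule integrable_mult_bounded[OF i _ Lall]) (auto intro!: torus_measurable)
  have "(LINT x|torus_measure. f (c + frac (x - c)) * \<phi> x) = (LINT x:{0..<1}|lborel. f (c + frac (x - c)) * \<phi> x)"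
    by (rule integral_lebesgue_on_eq) auto
  also have "\<dots> = (LINT x:{c..<c+1}|lborel. f (c + frac (x - c)) * \<phi> x)"
  proof (rule integral_periodic_shift(2)[symmetric])
    have "frac (x + 1 - c) = frac (x - c)" for x using frac_1_eq[of "x - c"] by (simp add: algebra_simps)
    then show "periodic1 (\<lambda>x. f (c + frac (x - c)) * \<phi> x)"
      using assms(2) by (simp add: periodic1_def)
    show "set_integrable lborel {0..<1} (\<lambda>x. f (c + frac (x - c)) * \<phi> x)"
      using i2 by (subst integrable_lebesgue_on_eq[symmetric]) auto
  qed measurable
  also have "\<dots> = (LINT x|lborel. (f x * \<phi> x) * indicator {c..c+1} x)"
    unfolding set_lebesgue_integral_def
  proof (rule integral_cong_AE)
    show "AE x in lborel. indicator {c..<c + 1} x *\<^sub>R (f (c + frac (x - c)) * \<phi> x) = f x * \<phi> x * indicator {c..c + 1} x"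
      using AE_lborel_singleton[of "c + 1"]
    proof eventually_elim
      case (elim x)
      have "frac (x - c) = x - c" if "c \<le> x" "x < c + 1" using that by (simp add: frac_eq)
      then show ?case using elim by (auto simp: indicator_def)
    qed
  qed measurable
  finally show "(LINT x|torus_measure. f (c + frac (x - c)) * \<phi> x) = (LINT x|lborel. (f x * \<phi> x) * indicator {c..c+1} x)" .
qed

text \<open>On the arc from \<open>s\<close> to \<open>r\<close> the derivative of
  \<open>u - f\<close> is nonpositive: its density is \<open>a - F\<close>, the positive singular
  part does not charge the arc, and the negative one only helps. Since the claim concerns individual
  points, a rise of \<open>u - f\<close> is first spread to two small intervals and then refuted by
  a trapezoid with one ramp in each. The length below one keeps the lifts of the arc
  disjoint.\<close>

lemma decomposition_nonincreasing:
  fixes u f F a :: "real \<Rightarrow> real"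
  assumes dec: "derivative_decomposition u a \<mu> \<nu>"
    and u: "periodic1 u" "good_representative u" "integrable torus_measure u"
    and f: "\<And>x. (f has_real_derivative F x) (at x)" "continuous_on UNIV F"
    and sr: "r < s + 1"
    and ac: "AE x in torus_measure. \<forall>y\<in>{s<..<r}. y - x \<in> \<int> \<longrightarrow> a x \<le> F y"
    and sing: "AE x in \<mu>. \<forall>y\<in>{s<..<r}. y - x \<notin> \<int>"
    and xy: "s < x" "x < y" "y < r"
  shows "u y - f y \<le> u x - f x"
proof (rule ccontr)
  assume "\<not> ?thesis"
  then obtain m where m1: "u x - f x < m" and m2: "m < u y - f y" using dense not_le by metis
  obtain m' where m': "m < m'" "m' < u y - f y" using dense m2 by blast
  have cf: "continuous_on UNIV f" using f(1) by (meson DERIV_isCont continuous_at_imp_continuous_on)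
  have g: "good_representative (\<lambda>z. u z - f z)"
    using good_representative_add[OF u(2), of "\<lambda>x. - f x"] cf by (simp add: continuous_on_minus)
  have g': "good_representative (\<lambda>z. - (u z - f z))" by (rule good_representative_minus[OF g])
  \<comment> \<open>Keeps the windows around \<open>x\<close> and \<open>y\<close> inside the arc,
    and the first one to the left of the second.\<close>
  define d where "d = min (x - s) (min ((y - x) / 2) (r - y))"
  have d: "0 < d" "d \<le> x - s" "d \<le> (y - x) / 2" "d \<le> r - y" using xy unfolding d_def min_def by auto
  obtain x1 x2 where x12: "x - d < x1" "x1 < x2" "x2 < x + d" "\<And>z. x1 < z \<Longrightarrow> z < x2 \<Longrightarrow> u z - f z < m"
    using good_representative_near_less[OF g m1 d(1)] by blast
  have "- (u y - f y) < - m'" using m' by simp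
  then obtain y1 y2 where y12: "y - d < y1" "y1 < y2" "y2 < y + d" "\<And>z. y1 < z \<Longrightarrow> z < y2 \<Longrightarrow> - (u z - f z) < - m'"
    using good_representative_near_less[OF g' _ d(1)] by blast
  obtain k :: nat where "1 / min (x2 - x1) (y2 - y1) < k" using reals_Archimedean2 by blast
  \<comment> \<open>The ramps must fit into the two windows on which the levels \<open>m\<close> and
    \<open>m'\<close> are known.\<close>
  define n where "n = max 2 (real k)"
  have n: "1 < n" "1 / n < x2 - x1" "1 / n < y2 - y1"
  proof -
    define M where "M = min (x2 - x1) (y2 - y1)"
    have p: "0 < M" using x12 y12 by (simp add: M_def)
    have n0: "0 < n" by (simp add: n_def)
    have "1 / M < n" using \<open>_ < real k\<close> by (simp add: n_def M_def)
    then have "1 / n < M" using p n0 by (simp add: field_simps)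
    then have "1 / n < min (x2 - x1) (y2 - y1)" unfolding M_def .
    then show "1 < n" "1 / n < x2 - x1" "1 / n < y2 - y1" by (auto simp: n_def)
  qed
  have pos1: "s < x1" using d(2) x12(1) by linarith
  have pos2: "x1 < y1" proof -
    have "2 * d \<le> y - x" using d(3) by simp
    then show ?thesis using x12(2,3) y12(1) by linarith
  qed
  have pos3: "y1 + 1 / n < r" using d(4) y12(3) n(3) by linarith
  have "0 < 1 / n" using n(1) by simp
  then have "y1 \<le> x1 + 1" using pos1 pos3 sr by linarith
  note pos = pos1 pos2 pos3 this
  define \<phi> where "\<phi> = ptrap n x1 y1"
  have \<phi>: "smooth_torus \<phi>" "smooth \<phi>" "periodic1 \<phi>" "\<And>z. 0 \<le> \<phi> z" "\<And>z. \<phi> z \<le> 1"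
    using smooth_torus_ptrap[OF n(1), of x1 y1] ptrap_bounds[OF n(1), of x1 y1] pos
    by (auto simp: \<phi>_def smooth_torus_def)
  note [measurable] = smooth_borel[OF \<phi>(2), THEN torus_measurable]
  \<comment> \<open>The test function vanishes off the lifts of the arc;
    \<open>s + frac (z - s)\<close> is the lift of \<open>z\<close> in
    \<open>[s, s + 1)\<close>.\<close>
  have supp: "s + frac (z - s) \<in> {s<..<r}" if "\<phi> z \<noteq> 0" for z
  proof -
    define t where "t = s + frac (z - s)"
    have t: "s \<le> t" "t < s + 1" using frac_ge_0[of "z - s"] frac_lt_1[of "z - s"] by (auto simp: t_def)
    have "\<phi> t = \<phi> z" using periodic1_int[OF \<phi>(3), of z "- \<lfloor>z - s\<rfloor>"] by (simp add: t_def frac_def algebra_simps)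
    then have "\<phi> t \<noteq> 0" "\<phi> (t + 1) \<noteq> 0" using that \<phi>(3) by (auto simp: periodic1_def)
    then have "\<not> (y1 + 1 / n \<le> t \<and> t \<le> x1 + 1)" "\<not> (y1 + 1 / n \<le> t + 1 \<and> t + 1 \<le> x1 + 1)"
      using ptrap_outside[OF n(1), of x1 y1] pos by (auto simp: \<phi>_def)
    then show ?thesis unfolding t_def[symmetric] using t pos sr by auto
  qed
  have int: "s + frac (z - s) - z \<in> \<int>" for z by (simp add: frac_def)
  have a: "integrable torus_measure a" and 
    id: "(LINT x|torus_measure. u x * deriv \<phi> x) =
        - ((LINT x|torus_measure. a x * \<phi> x) + (LINT x|\<mu>. \<phi> x) - (LINT x|\<nu>. \<phi> x))"
    using dec \<phi>(1) unfolding derivative_decomposition_def by blast+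
  have "(LINT x|\<mu>. \<phi> x) = 0"
  proof (rule integral_eq_zero_AE)
    show "AE x in \<mu>. \<phi> x = 0" using sing by eventually_elim (use supp int in blast)
  qed
  moreover have "0 \<le> (LINT x|\<nu>. \<phi> x)" using \<phi>(4) by simp
  moreover have "(LINT x|torus_measure. a x * \<phi> x) \<le> (LINT x|torus_measure. F (s + frac (x - s)) * \<phi> x)"
  proof (rule integral_mono_AE)
    show "integrable torus_measure (\<lambda>x. a x * \<phi> x)"
      using \<phi> by (intro integrable_mult_bounded[OF a, of _ 1]) auto
    show "integrable torus_measure (\<lambda>x. F (s + frac (x - s)) * \<phi> x)"
      using f(2) \<phi> by (intro periodic_torus_shift(2)) (auto intro: borel_measurable_continuous_onI continuous_on_subset)
    show "AE x in torus_measure. a x * \<phi> x \<le> F (s + frac (x - s)) * \<phi> x"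
      using ac
    proof eventually_elim
      case (elim x)
      show ?case
      proof (cases "\<phi> x = 0")
        case False
        then have "a x \<le> F (s + frac (x - s))" using elim supp int by blast
        then show ?thesis by (intro mult_right_mono \<phi>)
      qed simp
    qed
  qed
  \<comment> \<open>Integration by parts over the cell that starts at \<open>s\<close>. The boundary
    terms vanish because \<open>s\<close> itself lies outside the open arc.\<close>
  moreover have "(LINT x|torus_measure. f (s + frac (x - s)) * deriv \<phi> x) = - (LINT x|torus_measure. F (s + frac (x - s)) * \<phi> x)"
  proof -
    have dp: "periodic1 (deriv \<phi>)"
      using deriv_ptrap[OF n(1), of x1 y1] deriv_stair_add1[OF n(1)] unfolding periodic1_def \<phi>_def
      by (metis (no_types, opaque_lifting) add_diff_eq diff_add_eq)
    have 1: "(LINT x|torus_measure. f (s + frac (x - s)) * deriv \<phi> x) = (LINT x|lborel. (f x * deriv \<phi> x) * indicator {s..s+1} x)"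
      using cf \<phi> dp by (intro periodic_torus_shift(3)) (auto intro: borel_measurable_continuous_onI continuous_on_subset smooth_deriv)
    have 2: "(LINT x|torus_measure. F (s + frac (x - s)) * \<phi> x) = (LINT x|lborel. (F x * \<phi> x) * indicator {s..s+1} x)"
      using f(2) \<phi> by (intro periodic_torus_shift(3)) (auto intro: borel_measurable_continuous_onI continuous_on_subset)
    have i: "integrable lborel (\<lambda>x. (h x * g x) * indicator {s..s+1} x)"
      if "continuous_on UNIV h" "continuous_on UNIV g" for h g :: "real \<Rightarrow> real"
      using borel_integrable_atLeastAtMost'[of s "s + 1" "\<lambda>x. h x * g x"] that
      by (auto simp: set_integrable_def mult.commute intro: continuous_on_subset continuous_intros)
    have "(LINT x|lborel. (f x * deriv \<phi> x) * indicator {s..s+1} x) + (LINT x|lborel. (F x * \<phi> x) * indicator {s..s+1} x)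
      = (LINT x|lborel. (F x * \<phi> x + f x * deriv \<phi> x) * indicator {s..s+1} x)"
      using cf f(2) smooth_continuous[OF \<phi>(2)] smooth_deriv_continuous[OF \<phi>(2)]
      by (subst Bochner_Integration.integral_add[symmetric, OF i i]) (auto simp: algebra_simps)
    also have "\<dots> = f (s + 1) * \<phi> (s + 1) - f s * \<phi> s"
    proof (rule integral_FTC_Icc_real)
      fix x
      show "((\<lambda>x. f x * \<phi> x) has_real_derivative F x * \<phi> x + f x * deriv \<phi> x) (at x)"
        by (rule DERIV_cong[OF DERIV_mult[OF f(1) smooth_DERIV[OF \<phi>(2)]]]) (simp add: mult.commute)
      have "continuous_on UNIV (\<lambda>x. F x * \<phi> x + f x * deriv \<phi> x)"
        by (intro continuous_intros cf f(2) smooth_continuous[OF \<phi>(2)] smooth_deriv_continuous[OF \<phi>(2)])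
      then show "isCont (\<lambda>x. F x * \<phi> x + f x * deriv \<phi> x) x" by (simp add: continuous_on_eq_continuous_at)
    qed simp
    also have "\<dots> = 0"
    proof -
      have "\<phi> s = 0" using supp[of s] by auto
      then show ?thesis using \<phi>(3) by (simp add: periodic1_def)
    qed
    finally show ?thesis unfolding 1 2 by simp
  qed
  ultimately have ge: "(LINT x|torus_measure. f (s + frac (x - s)) * deriv \<phi> x) \<le> (LINT x|torus_measure. u x * deriv \<phi> x)"
    using id by linarith
  \<comment> \<open>A periodic version of \<open>u - f\<close>, equal to it on the arc.\<close>
  define w where "w z = u z - f (s + frac (z - s))" for z
  have fi: "integrable torus_measure (\<lambda>x. f (s + frac (x - s)))"
    using cf \<phi> by (intro periodic_torus_shift(1)[of _ \<phi>]) (auto intro: borel_measurable_continuous_onI continuous_on_subset)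
  have wi: "integrable torus_measure w" unfolding w_def using u(3) fi by simp
  have "frac (z + 1 - s) = frac (z - s)" for z using frac_1_eq[of "z - s"] by (simp add: algebra_simps)
  then have wp: "periodic1 w" using u(1) by (simp add: periodic1_def w_def)
  have weq: "w z = u z - f z" if "s < z" "z < r" for z
    using that sr frac_eq[of "z - s"] by (simp add: w_def)
  have "stair_avg n w x1 - stair_avg n w y1 = (LINT x|torus_measure. w x * deriv \<phi> x)"
    unfolding \<phi>_def by (rule integral_deriv_ptrap[OF n(1) wi, symmetric])
  also have "\<dots> = (LINT x|torus_measure. u x * deriv \<phi> x) - (LINT x|torus_measure. f (s + frac (x - s)) * deriv \<phi> x)"
  proof -
    have "integrable torus_measure (\<lambda>x. h x * deriv \<phi> x)" if "integrable torus_measure h" for h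
      unfolding \<phi>_def deriv_ptrap[OF n(1)] right_diff_distrib
      using integrable_stair_avg[OF n(1) that] by simp
    then show ?thesis unfolding w_def left_diff_distrib using u(3) fi by simp
  qed
  finally have "stair_avg n w y1 \<le> stair_avg n w x1" using ge by simp
  moreover have "stair_avg n w x1 \<le> m"
  proof (rule stair_avg_le[OF n(1) wi wp])
    fix z assume "x1 < z" "z < x1 + 1 / n"
    then show "w z \<le> m" using x12 n pos weq[of z] xy d by (simp add: less_imp_le)
  qed
  moreover have "m' \<le> stair_avg n w y1"
  proof (rule stair_avg_ge[OF n(1) wi wp])
    fix z assume z: "y1 < z" "z < y1 + 1 / n"
    then have "s < z" "z < r" "z < y2" using pos n by linarith+
    then show "m' \<le> w z" using y12(4)[of z] z weq[of z] by linarith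
  qed
  ultimately show False using m' by simp
qed

lemma derivative_decomposition_minus:
  assumes "derivative_decomposition u a \<mu> \<nu>"
  shows "derivative_decomposition (\<lambda>x. - u x) (\<lambda>x. - a x) \<nu> \<mu>"
proof -
  have ms: "mutually_singular \<nu> \<mu>"
  proof -
    obtain A where A: "A \<in> sets \<mu> \<inter> sets \<nu>" "emeasure \<mu> A = 0" "emeasure \<nu> (space \<nu> - A) = 0"
      using assms unfolding derivative_decomposition_def mutually_singular_def by blast
    have s: "sets \<mu> = sets \<nu>" using assms unfolding derivative_decomposition_def finite_borel_torus_def by metis
    then have sp: "space \<mu> = space \<nu>" by (rule sets_eq_imp_space_eq)
    have "space \<mu> - (space \<nu> - A) = A" using A(1) sets.sets_into_space[of A \<mu>] sp by auto
    then show ?thesis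
      unfolding mutually_singular_def using A s sp by (intro bexI[of _ "space \<nu> - A"]) auto
  qed
  show ?thesis
    using assms ms unfolding derivative_decomposition_def by auto
qed

section \<open>Increments in time\<close>

abbreviation lborel2 :: "(real \<times> real) measure" where
  "lborel2 \<equiv> lborel \<Otimes>\<^sub>M lborel"

text \<open>Exchanging the order of the quantifiers requires a measurable exceptional set, so
  \<open>P\<close> is replaced by avoidance of a measurable null set that contains its
  failures.\<close>

lemma AE_lborel2_swap:
  assumes "AE z in lborel2. P z"
  shows "AE x in lborel. AE t in lborel. P (t, x)"
proof -
  obtain N where N: "N \<in> sets lborel2" "emeasure lborel2 N = 0" "{z \<in> space lborel2. \<not> P z} \<subseteq> N"
    using assms by (auto elim!: AE_E)
  have "AE z in lborel2. z \<notin> N" using N by (intro AE_not_in) auto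
  then have "AE t in lborel. AE x in lborel. (t, x) \<notin> N" by (rule lborel_pair.AE_pair)
  moreover have "{z \<in> space lborel2. (fst z, snd z) \<notin> N} \<in> sets lborel2"
    using sets.compl_sets[OF N(1)] by (simp add: set_diff_eq)
  ultimately have "AE x in lborel. AE t in lborel. (t, x) \<notin> N"
    using lborel_pair.AE_commute[of "\<lambda>t x. (t, x) \<notin> N"] by simp
  then show ?thesis
  proof eventually_elim
    case (elim x)
    then show ?case by eventually_elim (use N(3) in \<open>auto simp: space_pair_measure\<close>)
  qed
qed

section \<open>Null sets and Borel versions\<close>

lemma lebesgue_on_cong_AE:
  fixes h k :: "real \<Rightarrow> real"
  assumes A: "A \<in> sets borel" and h: "h \<in> borel_measurable borel"
    and ae: "AE x in lborel. x \<in> A \<longrightarrow> h x = k x"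
  shows integral_lebesgue_on_cong_AE: "integral\<^sup>L (lebesgue_on A) k = (LINT x:A|lborel. h x)"
    and integrable_lebesgue_on_cong_AE: "integrable (lebesgue_on A) k \<longleftrightarrow> set_integrable lborel A h"
proof -
  have ae': "AE x in lebesgue. indicator A x *\<^sub>R h x = indicator A x *\<^sub>R k x"
    using AE_completion[OF ae] by eventually_elim (auto simp: indicator_def)
  have hm: "(\<lambda>x. indicator A x *\<^sub>R h x) \<in> borel_measurable lebesgue"
    using A h by (intro measurable_completion) simp
  have km: "(\<lambda>x. indicator A x *\<^sub>R k x) \<in> borel_measurable lebesgue"
    by (rule borel_measurable_AE[OF hm ae'])
  have A': "A \<inter> space lebesgue \<in> sets lebesgue" using A by simp
  show "integral\<^sup>L (lebesgue_on A) k = (LINT x:A|lborel. h x)"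
    unfolding integral_lebesgue_on_eq[OF A h, symmetric] integral_restrict_space[OF A']
    by (rule integral_cong_AE[OF km hm]) (use ae' in auto)
  show "integrable (lebesgue_on A) k \<longleftrightarrow> set_integrable lborel A h"
    unfolding integrable_lebesgue_on_eq[OF A h, symmetric] integrable_restrict_space[OF A']
    by (rule integrable_cong_AE[OF km hm]) (use ae' in auto)
qed

text \<open>Countably many unit cells cover the line, and the integral of the modulus is the same
  over each.\<close>

lemma AE_periodic:
  fixes X :: "real \<Rightarrow> real"
  assumes X: "X \<in> borel_measurable borel" "periodic1 X" and ae: "AE x in lborel. x \<in> {0..<1} \<longrightarrow> X x = 0"
  shows "AE x in lborel. X x = 0"
proof -
  have [measurable]: "X \<in> borel_measurable borel" by fact
  have "AE x in lborel. x \<in> {of_int k..<of_int k + 1} \<longrightarrow> X x = 0" for k :: int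
  proof -
    have "(\<integral>\<^sup>+x\<in>{of_int k..<of_int k + 1}. ennreal \<bar>X x\<bar> \<partial>lborel) = (\<integral>\<^sup>+x\<in>{0..<1}. ennreal \<bar>X x\<bar> \<partial>lborel)"
      using X(2) by (intro nn_integral_periodic_shift) (auto simp: periodic1_def)
    also have "\<dots> = (\<integral>\<^sup>+x. 0 \<partial>(lborel :: real measure))"
      by (rule nn_integral_cong_AE) (use ae in \<open>eventually_elim, auto simp: indicator_def\<close>)
    also have "\<dots> = 0" by simp
    finally have "AE x in lborel. ennreal \<bar>X x\<bar> * indicator {of_int k..<of_int k + 1} x = 0"
      by (subst (asm) nn_integral_0_iff_AE) auto
    then show ?thesis by eventually_elim (auto simp: indicator_def split: if_splits)
  qed
  then have "AE x in lborel. \<forall>k::int. x \<in> {of_int k..<of_int k + 1} \<longrightarrow> X x = 0"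
    by (intro AE_all_countable[THEN iffD2] allI)
  then show ?thesis
  proof eventually_elim
    case (elim x)
    then show ?case using elim[rule_format, of "\<lfloor>x\<rfloor>"] by (auto simp: floor_correct)
  qed
qed

lemma abs_le_one_plus_square: "\<bar>y\<bar> \<le> 1 + y\<^sup>2" for y :: real
proof (cases "\<bar>y\<bar> \<le> 1")
  case True
  then show ?thesis using zero_le_power2[of y] by linarith
next
  case False
  then have "\<bar>y\<bar> * 1 \<le> \<bar>y\<bar> * \<bar>y\<bar>" by (intro mult_left_mono) auto
  then show ?thesis by (simp add: power2_eq_square)
qed

text \<open>Membership in \<open>L2_spacetime\<close> gives Lebesgue measurability on the cylinder,
  under which individual slices may fail to be measurable. A Borel version extended by zero makes
  Fubini available; agreement with \<open>w\<close> is recorded slice by slice in both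
  orders.\<close>

lemma spacetime_borel_version:
  assumes w: "L2_spacetime T w"
  obtains g :: "real \<times> real \<Rightarrow> real" where
    "g \<in> borel_measurable lborel2" "integrable lborel2 g"
    "\<And>t x. t \<notin> {0<..<T} \<or> x \<notin> {0..<1} \<Longrightarrow> g (t, x) = 0"
    "AE t in lborel. AE x in lborel. t \<in> {0<..<T} \<longrightarrow> x \<in> {0..<1} \<longrightarrow> g (t, x) = w t x"
    "AE x in lborel. AE t in lborel. t \<in> {0<..<T} \<longrightarrow> x \<in> {0..<1} \<longrightarrow> g (t, x) = w t x"
proof -
  define Q where "Q = {0<..<T} \<times> {0..<1::real}"
  define f where "f = (\<lambda>(t, x). w t x)"
  have Qb: "Q \<in> sets (borel :: (real \<times> real) measure)" unfolding Q_def by (rule borel_Times) auto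
  have Q: "Q \<inter> space (lebesgue :: (real \<times> real) measure) \<in> sets lebesgue" using Qb by auto
  have fm: "f \<in> borel_measurable (lebesgue_on Q)" and f2: "integrable (lebesgue_on Q) (\<lambda>z. (f z)\<^sup>2)"
    using w unfolding L2_spacetime_def square_integrable_def Q_def f_def by auto
  have "emeasure lebesgue Q < \<infinity>"
  proof -
    have "bounded Q" unfolding Q_def by (intro bounded_Times) auto
    then have "emeasure lborel Q < \<infinity>" by (rule emeasure_bounded_finite)
    then show ?thesis using Qb by simp
  qed
  then have "finite_measure (lebesgue_on Q)"
    using Q by (intro finite_measureI) (simp add: emeasure_restrict_space space_restrict_space)
  then have "integrable (lebesgue_on Q) (\<lambda>z. 1 + (f z)\<^sup>2)"
    using f2 by (intro Bochner_Integration.integrable_add) (auto simp: finite_measure.integrable_const)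
  then have fi: "integrable (lebesgue_on Q) f"
  proof (rule Bochner_Integration.integrable_bound[OF _ fm])
    show "AE z in lebesgue_on Q. norm (f z) \<le> norm (1 + (f z)\<^sup>2)" using abs_le_one_plus_square by (intro AE_I2) (simp add: abs_of_nonneg)
  qed
  define h where "h z = indicator Q z *\<^sub>R f z" for z
  have hm: "h \<in> borel_measurable lebesgue" and hi: "integrable lebesgue h"
    using fm fi unfolding h_def borel_measurable_restrict_space_iff[OF Q] integrable_restrict_space[OF Q] by auto
  obtain g0 where g0: "g0 \<in> borel_measurable lborel" "AE z in lborel. h z = g0 z"
    using completion_ex_borel_measurable_real[OF hm] by blast
  define g where "g z = indicator Q z * g0 z" for z
  have gm: "g \<in> borel_measurable lborel" unfolding g_def using g0(1) Qb by simp
  have ae: "AE z in lborel. h z = g z" using g0(2) by eventually_elim (auto simp: g_def h_def indicator_def)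
  have "integrable lebesgue g"
    using hi integrable_cong_AE[OF hm measurable_completion[OF gm] AE_completion[OF ae]] by simp
  then have gi: "integrable lborel g" by (simp add: integrable_completion[OF gm])
  have ae2: "AE z in lborel2. fst z \<in> {0<..<T} \<longrightarrow> snd z \<in> {0..<1} \<longrightarrow> g z = w (fst z) (snd z)"
    using ae unfolding lborel_prod
    by eventually_elim (auto simp: h_def f_def Q_def)
  show ?thesis
  proof (rule that[of g])
    show "g \<in> borel_measurable lborel2" "integrable lborel2 g" using gm gi by (simp_all add: lborel_prod)
    show "g (t, x) = 0" if "t \<notin> {0<..<T} \<or> x \<notin> {0..<1}" for t x using that by (auto simp: g_def Q_def)
    show "AE t in lborel. AE x in lborel. t \<in> {0<..<T} \<longrightarrow> x \<in> {0..<1} \<longrightarrow> g (t, x) = w t x"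
      using lborel_pair.AE_pair[OF ae2] by simp
    show "AE x in lborel. AE t in lborel. t \<in> {0<..<T} \<longrightarrow> x \<in> {0..<1} \<longrightarrow> g (t, x) = w t x"
      using AE_lborel2_swap[OF ae2] by simp
  qed
qed

text \<open>The variance of the modulus of \<open>h\<close> over a space of total mass one is
  nonnegative.\<close>

lemma integral_abs_le_torus:
  fixes h :: "real \<Rightarrow> real"
  assumes "integrable torus_measure h" "integrable torus_measure (\<lambda>x. (h x)\<^sup>2)"
  shows "(LINT x|torus_measure. \<bar>h x\<bar>)\<^sup>2 \<le> (LINT x|torus_measure. (h x)\<^sup>2)"
proof -
  define c where "c = (LINT x|torus_measure. \<bar>h x\<bar>)"
  have m: "measure torus_measure {0..<1} = 1" by (simp add: measure_restrict_space)
  have [simp]: "integrable torus_measure (\<lambda>x. c\<^sup>2)"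
    using emeasure_torus_finite by (simp add: finite_measure.integrable_const)
  have "0 \<le> (LINT x|torus_measure. (\<bar>h x\<bar> - c)\<^sup>2)" by (rule Bochner_Integration.integral_nonneg) simp
  also have "(\<lambda>x. (\<bar>h x\<bar> - c)\<^sup>2) = (\<lambda>x. (h x)\<^sup>2 - 2 * c * \<bar>h x\<bar> + c\<^sup>2)"
    by (auto simp: power2_diff algebra_simps)
  also have "(LINT x|torus_measure. (h x)\<^sup>2 - 2 * c * \<bar>h x\<bar> + c\<^sup>2) = (LINT x|torus_measure. (h x)\<^sup>2) - 2 * c * c + c\<^sup>2"
    using assms m by (simp add: c_def[symmetric])
  finally show ?thesis by (simp add: c_def power2_eq_square)
qed

section \<open>The time derivative tested against bounded functions of space\<close>

lemma L2_torus_integrable: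
  assumes "L2_torus f"
  shows "integrable torus_measure f"
proof -
  have f: "f \<in> borel_measurable torus_measure" "integrable torus_measure (\<lambda>x. (f x)\<^sup>2)"
    using assms by (auto simp: L2_torus_def square_integrable_def)
  have "integrable torus_measure (\<lambda>z. 1 + (f z)\<^sup>2)"
    using f emeasure_torus_finite by (intro Bochner_Integration.integrable_add) (auto simp: finite_measure.integrable_const)
  then show ?thesis
  proof (rule Bochner_Integration.integrable_bound[OF _ f(1)])
    show "AE z in torus_measure. norm (f z) \<le> norm (1 + (f z)\<^sup>2)" using abs_le_one_plus_square by (intro AE_I2) (simp add: abs_of_nonneg)
  qed
qed

text \<open>Against a bounded function, the difference of two pairings is at most \<open>C\<close>
  times the distance in the \<open>L2\<close> norm.\<close>

lemma L2_continuous_pairing: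
  assumes u: "L2_continuous T u" and t: "t \<in> {0..T}"
    and \<theta>: "\<theta> \<in> borel_measurable borel" "\<And>x. \<bar>\<theta> x\<bar> \<le> C"
  shows "((\<lambda>s. LINT x|torus_measure. u s x * \<theta> x) \<longlongrightarrow> (LINT x|torus_measure. u t x * \<theta> x)) (at t within {0..T})"
proof -
  have L: "L2_torus (u s)" if "s \<in> {0..T}" for s using u that by (simp add: L2_continuous_def)
  have C: "0 \<le> C" using \<theta>(2)[of 0] by linarith
  have lim: "((\<lambda>s. LINT x|torus_measure. (u s x - u t x)\<^sup>2) \<longlongrightarrow> 0) (at t within {0..T})"
    using u t by (simp add: L2_continuous_def)
  have bound: "norm ((LINT x|torus_measure. u s x * \<theta> x) - (LINT x|torus_measure. u t x * \<theta> x))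
      \<le> C * sqrt (LINT x|torus_measure. (u s x - u t x)\<^sup>2)" if s: "s \<in> {0..T}" for s
  proof -
    have i: "integrable torus_measure (u s)" "integrable torus_measure (u t)"
      using L2_torus_integrable L s t by auto
    note ic = integrable_mult_bounded[OF _ torus_measurable[OF \<theta>(1)] \<theta>(2)]
    have i2: "integrable torus_measure (\<lambda>x. (u s x - u t x)\<^sup>2)"
    proof (rule Bochner_Integration.integrable_bound)
      show "integrable torus_measure (\<lambda>x. 2 * (u s x)\<^sup>2 + 2 * (u t x)\<^sup>2)"
        using L[OF s] L[OF t] by (simp add: L2_torus_def square_integrable_def)
      show "(\<lambda>x. (u s x - u t x)\<^sup>2) \<in> borel_measurable torus_measure"
        using i by measurable
      have "(a - b)\<^sup>2 \<le> 2 * a\<^sup>2 + 2 * b\<^sup>2" for a b :: real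
        using zero_le_power2[of "a + b"] by (simp add: power2_eq_square algebra_simps)
      then show "AE x in torus_measure. norm ((u s x - u t x)\<^sup>2) \<le> norm (2 * (u s x)\<^sup>2 + 2 * (u t x)\<^sup>2)"
        by (intro AE_I2) simp
    qed
    have "(LINT x|torus_measure. u s x * \<theta> x) - (LINT x|torus_measure. u t x * \<theta> x) = (LINT x|torus_measure. (u s x - u t x) * \<theta> x)"
      unfolding left_diff_distrib using ic[OF i(1)] ic[OF i(2)] by simp
    also have "norm \<dots> \<le> (LINT x|torus_measure. C * \<bar>u s x - u t x\<bar>)"
    proof (rule Bochner_Integration.integral_norm_bound_integral)
      show "integrable torus_measure (\<lambda>x. (u s x - u t x) * \<theta> x)" using i by (intro ic) auto
      show "integrable torus_measure (\<lambda>x. C * \<bar>u s x - u t x\<bar>)" using i by auto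
      show "norm ((u s x - u t x) * \<theta> x) \<le> C * \<bar>u s x - u t x\<bar>" for x
        using mult_left_mono[OF \<theta>(2)[of x], of "\<bar>u s x - u t x\<bar>"] by (simp add: abs_mult mult.commute)
    qed
    also have "\<dots> \<le> C * sqrt (LINT x|torus_measure. (u s x - u t x)\<^sup>2)"
      using integral_abs_le_torus[OF _ i2] i C by (auto intro!: mult_left_mono real_le_rsqrt)
    finally show ?thesis .
  qed
  have "((\<lambda>s. (LINT x|torus_measure. u s x * \<theta> x) - (LINT x|torus_measure. u t x * \<theta> x)) \<longlongrightarrow> 0) (at t within {0..T})"
  proof (rule Lim_null_comparison)
    show "\<forall>\<^sub>F s in at t within {0..T}. norm ((LINT x|torus_measure. u s x * \<theta> x) - (LINT x|torus_measure. u t x * \<theta> x))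
      \<le> C * sqrt (LINT x|torus_measure. (u s x - u t x)\<^sup>2)"
      using bound by (auto simp: eventually_at_filter)
    show "((\<lambda>s. C * sqrt (LINT x|torus_measure. (u s x - u t x)\<^sup>2)) \<longlongrightarrow> 0) (at t within {0..T})"
      using tendsto_mult_left[OF tendsto_real_sqrt[OF lim], of C] by simp
  qed
  then show ?thesis by (simp add: LIM_zero_iff)
qed

lemma smooth_bounded_if_compact_support:
  assumes "smooth f" "\<And>x. x \<notin> {c..d} \<Longrightarrow> f x = 0"
  shows "\<exists>C. \<forall>x. \<bar>f x\<bar> \<le> C"
proof -
  have "compact (f ` {c..d})" using assms(1) by (intro compact_continuous_image smooth_continuous) auto
  then obtain K where K: "\<And>x. x \<in> {c..d} \<Longrightarrow> \<bar>f x\<bar> \<le> K"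
    by (fastforce dest!: compact_imp_bounded simp: bounded_iff)
  have "\<bar>f x\<bar> \<le> max K 0" for x using K[of x] assms(2)[of x] by (cases "x \<in> {c..d}") auto
  then show ?thesis by blast
qed

lemma test_fun_bounded:
  assumes "test_fun a b f"
  shows "\<exists>C. \<forall>x. \<bar>f x\<bar> \<le> C \<and> \<bar>deriv f x\<bar> \<le> C"
proof -
  obtain c d where f: "smooth f" "\<And>x. x \<notin> {c..d} \<Longrightarrow> f x = 0"
    using assms by (auto simp: test_fun_def)
  have "deriv f x = 0" if "x \<notin> {c..d}" for x
  proof -
    have "deriv f x = deriv (\<lambda>_. 0) x"
      by (rule deriv_eq_on_open[of "- {c..d}"]) (use that f in auto)
    then show ?thesis by simp
  qed
  then obtain C1 C2 where "\<And>x. \<bar>f x\<bar> \<le> C1" "\<And>x. \<bar>deriv f x\<bar> \<le> C2"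
    using smooth_bounded_if_compact_support[OF f] smooth_bounded_if_compact_support[OF smooth_deriv[OF f(1)]] by metis
  then have "\<bar>f x\<bar> \<le> max C1 C2 \<and> \<bar>deriv f x\<bar> \<le> max C1 C2" for x by (meson max.coboundedI1 max.coboundedI2)
  then show ?thesis by blast
qed

text \<open>The weak time derivative is an identity for almost every \<open>x\<close>. Multiplied by
  a bounded Borel \<theta> and integrated in \<open>x\<close>, it becomes a scalar weak derivative
  of \<open>m\<close>; as \<open>m\<close> is continuous in time, all endpoints \<open>t1\<close>
  and \<open>t2\<close> are allowed.\<close>

lemma weak_time_derivative_pairing:
  assumes u: "L2_spacetime T u" "L2_spacetime T ut" "weak_time_derivative T u ut"
    and v: "v \<in> borel_measurable lborel2" "integrable lborel2 v"
      "\<And>t x. t \<notin> {0<..<T} \<or> x \<notin> {0..<1} \<Longrightarrow> v (t, x) = 0"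
      "AE x in lborel. AE t in lborel. t \<in> {0<..<T} \<longrightarrow> x \<in> {0..<1} \<longrightarrow> v (t, x) = ut t x"
    and \<theta>: "\<theta> \<in> borel_measurable borel" "\<And>x. \<bar>\<theta> x\<bar> \<le> C"
    and cont: "L2_continuous T u" and good: "\<forall>t\<in>{0<..<T}. good_representative (u t)"
    and t: "0 < t1" "t1 < t2" "t2 < T"
  shows "(LINT x|torus_measure. u t2 x * \<theta> x) - (LINT x|torus_measure. u t1 x * \<theta> x) =
    (LINT t:{t1<..t2}|lborel. LINT x|lborel. v (t, x) * \<theta> x)"
proof -
  obtain U where U: "U \<in> borel_measurable lborel2" "integrable lborel2 U"
      "\<And>t x. t \<notin> {0<..<T} \<or> x \<notin> {0..<1} \<Longrightarrow> U (t, x) = 0"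
      "AE t in lborel. AE x in lborel. t \<in> {0<..<T} \<longrightarrow> x \<in> {0..<1} \<longrightarrow> U (t, x) = u t x"
      "AE x in lborel. AE t in lborel. t \<in> {0<..<T} \<longrightarrow> x \<in> {0..<1} \<longrightarrow> U (t, x) = u t x"
    using spacetime_borel_version[OF u(1)] by blast
  note [measurable] = U(1) v(1) \<theta>(1)
  define m where "m t = (LINT x|torus_measure. u t x * \<theta> x)" for t
  define \<kappa> where "\<kappa> t = (LINT x|lborel. v (t, x) * \<theta> x)" for t
  \<comment> \<open>\<open>M\<close> is the Borel version of \<open>m\<close>, zero outside the time
    interval; the two agree for almost every time, which suffices under the integral.\<close>
  define M where "M t = (LINT x|lborel. U (t, x) * \<theta> x)" for t
  have [measurable]: "\<kappa> \<in> borel_measurable borel" "M \<in> borel_measurable borel"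
    unfolding \<kappa>_def M_def by measurable
  have M0: "M t = 0" "\<kappa> t = 0" if "t \<notin> {0<..<T}" for t
    unfolding M_def \<kappa>_def using U(3) v(3) that by simp_all
  have cm: "continuous_on {0<..<T} m"
    unfolding continuous_on_def m_def
  proof
    fix t assume "t \<in> {0<..<T}"
    then show "((\<lambda>s. LINT x|torus_measure. u s x * \<theta> x) \<longlongrightarrow> (LINT x|torus_measure. u t x * \<theta> x)) (at t within {0<..<T})"
      by (intro tendsto_within_subset[OF L2_continuous_pairing[OF cont _ \<theta>]]) auto
  qed
  have ivt: "integrable lborel2 (\<lambda>(t, x). v (t, x) * \<theta> x)"
    using integrable_mult_bounded[OF v(2), of "\<lambda>z. \<theta> (snd z)" C] \<theta>(2) by (simp add: split_beta')
  have ik: "integrable lborel \<kappa>"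
    using lborel_pair.integrable_fst[OF ivt] by (simp add: \<kappa>_def[abs_def])
  have mM: "AE t in lborel. t \<in> {0<..<T} \<longrightarrow> M t = m t"
    using U(4)
  proof eventually_elim
    case (elim t)
    show ?case
    proof
      assume t: "t \<in> {0<..<T}"
      have [measurable]: "u t \<in> borel_measurable borel" using good t good_representative_borel by blast
      have "m t = (LINT x:{0..<1}|lborel. u t x * \<theta> x)"
        unfolding m_def by (rule integral_lebesgue_on_eq) auto
      also have "\<dots> = (LINT x|lborel. U (t, x) * \<theta> x)"
        unfolding set_lebesgue_integral_def
        by (rule integral_cong_AE) (use elim t U(3) in \<open>auto elim!: AE_mp simp: indicator_def\<close>)
      finally show "M t = m t" by (simp add: M_def)
    qed
  qed
  have "m t2 - m t1 = (LINT t|lebesgue_on {t1<..t2}. \<kappa> t)"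
  proof (rule du_Bois_Reymond_interval[of "{0<..<T}" 0 T])
    show "integrable (lebesgue_on {0<..<T}) \<kappa>"
      using integrable_mult_indicator[OF _ ik, of "{0<..<T}"] by (simp add: integrable_lebesgue_on_eq set_integrable_def)
    fix n :: real assume n: "0 < n" "t2 + 1 / n < T"
    define \<psi> where "\<psi> = trap n t1 t2"
    have \<psi>: "test_fun 0 T \<psi>" unfolding \<psi>_def by (rule test_fun_trap) (use n t in auto)
    then have s\<psi>: "smooth \<psi>" by (simp add: test_fun_def)
    note [measurable] = smooth_borel[OF s\<psi>] smooth_borel[OF smooth_deriv[OF s\<psi>]]
    obtain K where K: "\<And>t. \<bar>\<psi> t\<bar> \<le> K" "\<And>t. \<bar>deriv \<psi> t\<bar> \<le> K" using test_fun_bounded[OF \<psi>] by blast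
    have iA: "integrable lborel2 (\<lambda>(t, x). U (t, x) * \<theta> x * deriv \<psi> t)"
    proof -
      have "integrable lborel2 (\<lambda>z. U z * \<theta> (snd z))"
        using integrable_mult_bounded[OF U(2), of "\<lambda>z. \<theta> (snd z)" C] \<theta>(2) by simp
      from integrable_mult_bounded[OF this, of "\<lambda>z. deriv \<psi> (fst z)" K] K(2) show ?thesis
        by (simp add: split_beta')
    qed
    have iB: "integrable lborel2 (\<lambda>(t, x). v (t, x) * \<theta> x * \<psi> t)"
      using integrable_mult_bounded[OF ivt, of "\<lambda>z. \<psi> (fst z)" K] K(1) by (simp add: split_beta')
    have "AE x in lborel. x \<in> {0..<1} \<longrightarrow>
        (LINT t|time_measure T. u t x * deriv \<psi> t) = - (LINT t|time_measure T. ut t x * \<psi> t)"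
      using u(3) \<psi> by (simp add: weak_time_derivative_def AE_lebesgue_on_iff)
    then have ae: "AE x in lborel. (LINT t|lborel. U (t, x) * \<theta> x * deriv \<psi> t) = - (LINT t|lborel. v (t, x) * \<theta> x * \<psi> t)"
      using U(5) v(4)
    proof eventually_elim
      case (elim x)
      show ?case
      proof (cases "x \<in> {0..<1}")
        case True
        have "(LINT t|time_measure T. u t x * deriv \<psi> t) = (LINT t:{0<..<T}|lborel. U (t, x) * deriv \<psi> t)"
          by (rule integral_lebesgue_on_cong_AE) (use elim True in \<open>auto elim!: AE_mp\<close>)
        also have "\<dots> = (LINT t|lborel. U (t, x) * deriv \<psi> t)"
          unfolding set_lebesgue_integral_def
          by (rule Bochner_Integration.integral_cong) (use U(3) in \<open>auto simp: indicator_def\<close>)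
        finally have 1: "(LINT t|time_measure T. u t x * deriv \<psi> t) = (LINT t|lborel. U (t, x) * deriv \<psi> t)" .
        have "(LINT t|time_measure T. ut t x * \<psi> t) = (LINT t:{0<..<T}|lborel. v (t, x) * \<psi> t)"
          by (rule integral_lebesgue_on_cong_AE) (use elim True in \<open>auto elim!: AE_mp\<close>)
        also have "\<dots> = (LINT t|lborel. v (t, x) * \<psi> t)"
          unfolding set_lebesgue_integral_def
          by (rule Bochner_Integration.integral_cong) (use v(3) in \<open>auto simp: indicator_def\<close>)
        finally have 2: "(LINT t|time_measure T. ut t x * \<psi> t) = (LINT t|lborel. v (t, x) * \<psi> t)" .
        have "(LINT t|lborel. U (t, x) * deriv \<psi> t) = - (LINT t|lborel. v (t, x) * \<psi> t)"
          using elim(1) True unfolding 1 2 by simp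
        then have "(LINT t|lborel. \<theta> x * (U (t, x) * deriv \<psi> t)) = - (LINT t|lborel. \<theta> x * (v (t, x) * \<psi> t))"
          by simp
        then show ?thesis by (simp add: mult_ac)
      qed (use U(3) v(3) in simp)
    qed
    have "(LINT t|lebesgue_on {0<..<T}. m t * deriv \<psi> t) = (LINT t:{0<..<T}|lborel. M t * deriv \<psi> t)"
      by (rule integral_lebesgue_on_cong_AE) (use mM in \<open>auto elim!: AE_mp\<close>)
    also have "\<dots> = (LINT t|lborel. M t * deriv \<psi> t)"
      unfolding set_lebesgue_integral_def
      by (rule Bochner_Integration.integral_cong) (use M0 in \<open>auto simp: indicator_def\<close>)
    also have "\<dots> = (LINT t|lborel. LINT x|lborel. U (t, x) * \<theta> x * deriv \<psi> t)"
      by (simp add: M_def)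
    \<comment> \<open>Fubini puts the time integral inside, where the weak identity is available for
      almost every \<open>x\<close>.\<close>
    also have "\<dots> = (LINT x|lborel. LINT t|lborel. U (t, x) * \<theta> x * deriv \<psi> t)"
      by (rule lborel_pair.Fubini_integral[symmetric, OF iA])
    also have "\<dots> = (LINT x|lborel. - (LINT t|lborel. v (t, x) * \<theta> x * \<psi> t))"
      by (rule integral_cong_AE) (use ae in auto)
    also have "\<dots> = - (LINT t|lborel. LINT x|lborel. v (t, x) * \<theta> x * \<psi> t)"
      using lborel_pair.Fubini_integral[OF iB] by simp
    also have "(LINT t|lborel. LINT x|lborel. v (t, x) * \<theta> x * \<psi> t) = (LINT t|lborel. \<kappa> t * \<psi> t)"
      by (simp add: \<kappa>_def)
    also have "\<dots> = (LINT t:{0<..<T}|lborel. \<kappa> t * \<psi> t)"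
      unfolding set_lebesgue_integral_def
      by (rule Bochner_Integration.integral_cong) (use M0 in \<open>auto simp: indicator_def\<close>)
    also have "\<dots> = (LINT t|lebesgue_on {0<..<T}. \<kappa> t * \<psi> t)"
      by (rule integral_lebesgue_on_eq[symmetric]) auto
    finally show "(LINT t|lebesgue_on {0<..<T}. m t * deriv (trap n t1 t2) t) = - (LINT t|lebesgue_on {0<..<T}. \<kappa> t * trap n t1 t2 t)"
      by (simp add: \<psi>_def)
  qed (use t cm in auto)
  also have "\<dots> = (LINT t:{t1<..t2}|lborel. \<kappa> t)"
    by (rule integral_lebesgue_on_eq) auto
  finally show ?thesis by (simp add: m_def \<kappa>_def)
qed

text \<open>Both sides depend continuously on the endpoints. The two sequences approach from the
  right, so the intervals \<open>(X n, Y n]\<close> tend to \<open>(x,y]\<close> at every point,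
  endpoints included.\<close>

lemma increments_from_rationals:
  fixes q V :: "real \<Rightarrow> real"
  assumes q: "continuous_on UNIV q" and V: "V \<in> borel_measurable borel" "\<And>c. set_integrable lborel {c..<c+1} V"
    and rat: "\<And>x y. x \<in> \<rat> \<Longrightarrow> y \<in> \<rat> \<Longrightarrow> x < y \<Longrightarrow> y < x + 1 \<Longrightarrow> q y - q x = (LINT s:{x<..y}|lborel. V s)"
    and xy: "x < y" "y < x + 1"
  shows "q y - q x = (LINT s:{x<..y}|lborel. V s)"
proof -
  note [measurable] = V(1)
  have "\<exists>r\<in>\<rat>. x < r \<and> r < min y (x + 1 / (real n + 1))" for n :: nat
    using xy by (intro Rats_dense_in_real) auto
  then obtain X where X: "\<And>n. X n \<in> \<rat>" "\<And>n. x < X n" "\<And>n. X n < y" "\<And>n. X n < x + 1 / (real n + 1)"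
    by (metis min_less_iff_conj)
  have "\<exists>r\<in>\<rat>. y < r \<and> r < min (x + 1) (y + 1 / (real n + 1))" for n :: nat
    using xy by (intro Rats_dense_in_real) auto
  then obtain Y where Y: "\<And>n. Y n \<in> \<rat>" "\<And>n. y < Y n" "\<And>n. Y n < x + 1" "\<And>n. Y n < y + 1 / (real n + 1)"
    by (metis min_less_iff_conj)
  have z: "(\<lambda>n. c + 1 / (real n + 1)) \<longlonglongrightarrow> c" for c :: real by real_asymp
  have Xl: "X \<longlonglongrightarrow> x"
    by (rule tendsto_sandwich[OF _ _ tendsto_const z]) (use X in \<open>auto intro!: always_eventually less_imp_le\<close>)
  have Yl: "Y \<longlonglongrightarrow> y"
    by (rule tendsto_sandwich[OF _ _ tendsto_const z]) (use Y in \<open>auto intro!: always_eventually less_imp_le\<close>)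
  have eq: "q (Y n) - q (X n) = (LINT s:{X n<..Y n}|lborel. V s)" for n
    by (intro rat X Y) (use X(2,3)[of n] Y(2,3)[of n] in linarith)+
  have "(\<lambda>n. q (Y n) - q (X n)) \<longlonglongrightarrow> q y - q x"
    using q by (intro tendsto_diff continuous_on_tendsto_compose[OF q _ _] Xl Yl) auto
  moreover have "(\<lambda>n. LINT s:{X n<..Y n}|lborel. V s) \<longlonglongrightarrow> (LINT s:{x<..y}|lborel. V s)"
    unfolding set_lebesgue_integral_def
  proof (rule integral_dominated_convergence)
    show "integrable lborel (\<lambda>s. \<bar>indicator {x..<x+1} s * V s\<bar>)"
      using V(2)[of x] by (simp add: set_integrable_def)
    show "AE s in lborel. norm (indicator {X n<..Y n} s *\<^sub>R V s) \<le> \<bar>indicator {x..<x+1} s * V s\<bar>" for n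
      using X(2)[of n] Y(3)[of n] by (intro AE_I2) (auto simp: indicator_def)
    show "AE s in lborel. (\<lambda>n. indicator {X n<..Y n} s *\<^sub>R V s) \<longlonglongrightarrow> indicator {x<..y} s *\<^sub>R V s"
    proof (intro AE_I2 tendsto_scaleR tendsto_const)
      fix s
      have "\<forall>\<^sub>F n in sequentially. indicator {X n<..Y n} s = (indicator {x<..y} s :: real)"
      proof (cases "s \<le> x")
        case True
        then show ?thesis using X(2) by (intro always_eventually) (auto simp: indicator_def dest: less_le_trans less_trans)
      next
        case False
        then have ev1: "\<forall>\<^sub>F n in sequentially. X n < s" using order_tendstoD(2)[OF Xl] by simp
        show ?thesis
        proof (cases "s \<le> y")
          case True
          show ?thesis using ev1 by eventually_elim (use True False Y(2) in \<open>auto simp: indicator_def intro: less_imp_le le_less_trans\<close>)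
        next
          case False
          then have "\<forall>\<^sub>F n in sequentially. Y n < s" using order_tendstoD(2)[OF Yl] by simp
          then show ?thesis by eventually_elim (use False in \<open>auto simp: indicator_def\<close>)
        qed
      qed
      then show "(\<lambda>n. indicator {X n<..Y n} s :: real) \<longlonglongrightarrow> indicator {x<..y} s" by (rule tendsto_eventually)
    qed
  qed measurable
  ultimately show ?thesis unfolding eq by (rule LIMSEQ_unique)
qed

section \<open>One function for the increments of \<open>u\<close> in time and of the selection in
  space\<close>

lemma periodic_extension_integrable:
  fixes v :: "real \<times> real \<Rightarrow> real"
  assumes v: "v \<in> borel_measurable lborel2" "integrable lborel2 v"
  shows "integrable lborel2 (\<lambda>(t, x). indicator {c..<c+1} x * v (t, frac x))"
proof -
  note [measurable] = v(1)
  have p: "periodic1 (\<lambda>x. ennreal \<bar>v (t, frac x)\<bar>)" for t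
    by (simp add: periodic1_def frac_1_eq)
  have "(\<integral>\<^sup>+z. ennreal (norm (case z of (t, x) \<Rightarrow> indicator {c..<c+1} x * v (t, frac x))) \<partial>lborel2)
    = (\<integral>\<^sup>+t. \<integral>\<^sup>+x. ennreal (norm (indicator {c..<c+1} x * v (t, frac x))) \<partial>lborel \<partial>lborel)"
    by (subst lborel.nn_integral_fst[symmetric]) auto
  also have "\<dots> = (\<integral>\<^sup>+t. (\<integral>\<^sup>+x\<in>{c..<c+1}. ennreal \<bar>v (t, frac x)\<bar> \<partial>lborel) \<partial>lborel)"
    by (intro nn_integral_cong) (auto simp: indicator_def)
  also have "\<dots> = (\<integral>\<^sup>+t. (\<integral>\<^sup>+x\<in>{0..<1}. ennreal \<bar>v (t, frac x)\<bar> \<partial>lborel) \<partial>lborel)"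
    by (subst nn_integral_periodic_shift[OF _ p]) auto
  also have "\<dots> \<le> (\<integral>\<^sup>+t. \<integral>\<^sup>+x. ennreal (norm (v (t, x))) \<partial>lborel \<partial>lborel)"
    by (intro nn_integral_mono) (auto simp: indicator_def frac_eq)
  also have "\<dots> = (\<integral>\<^sup>+z. ennreal (norm (v z)) \<partial>lborel2)"
    by (rule lborel.nn_integral_fst) auto
  also have "\<dots> < \<infinity>" using v(2) by (simp add: integrable_iff_bounded)
  finally show ?thesis by (auto simp: integrable_iff_bounded)
qed

text \<open>The difference is tested against its own sign: \<theta> may be any bounded Borel
  function, so \<open>sgn (X x)\<close> turns the pairing identity into a vanishing integral of the
  modulus of \<open>X\<close>.\<close>

lemma time_increments:
  assumes u: "L2_spacetime T u" "L2_spacetime T ut" "weak_time_derivative T u ut"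
    and v: "v \<in> borel_measurable lborel2" "integrable lborel2 v"
      "\<And>t x. t \<notin> {0<..<T} \<or> x \<notin> {0..<1} \<Longrightarrow> v (t, x) = 0"
      "AE x in lborel. AE t in lborel. t \<in> {0<..<T} \<longrightarrow> x \<in> {0..<1} \<longrightarrow> v (t, x) = ut t x"
    and cont: "L2_continuous T u" and good: "\<forall>t\<in>{0<..<T}. good_representative (u t)"
    and t: "0 < t1" "t1 < t2" "t2 < T"
  shows "AE x in lborel. u t2 x - u t1 x = (LINT t:{t1<..t2}|lborel. v (t, frac x))"
proof -
  have ub [measurable]: "u t1 \<in> borel_measurable borel" "u t2 \<in> borel_measurable borel"
    using good t good_representative_borel by auto
  have L: "L2_torus (u t1)" "L2_torus (u t2)" using cont t by (auto simp: L2_continuous_def)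
  note [measurable] = v(1)
  define J where "J x = (LINT t:{t1<..t2}|lborel. v (t, x))" for x
  have [measurable]: "J \<in> borel_measurable borel" unfolding J_def set_lebesgue_integral_def by measurable
  have J0: "J x = 0" if "x \<notin> {0..<1}" for x using v(3) that by (simp add: J_def)
  \<comment> \<open>\<open>J (frac x)\<close> is the periodic extension of the integrated time
    derivative; thus \<open>X\<close> is periodic and it is enough to examine one cell.\<close>
  define X where "X x = u t2 x - u t1 x - J (frac x)" for x
  have [measurable]: "X \<in> borel_measurable borel" unfolding X_def by measurable
  have Xp: "periodic1 X" using L by (simp add: X_def periodic1_def L2_torus_def frac_1_eq)
  define \<theta> where "\<theta> x = sgn (X x)" for x
  have \<theta>[measurable]: "\<theta> \<in> borel_measurable borel" unfolding \<theta>_def by measurable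
  have \<theta>1: "\<bar>\<theta> x\<bar> \<le> 1" for x by (simp add: \<theta>_def sgn_if)
  have iA: "integrable lborel2 (\<lambda>z. v z * (\<theta> (snd z) * indicator {t1<..t2} (fst z)))"
    using \<theta>1 by (intro integrable_mult_bounded[OF v(2), of _ 1]) (auto simp: indicator_def)
  then have iA': "integrable lborel2 (\<lambda>(t, x). indicator {t1<..t2} t * (v (t, x) * \<theta> x))"
    by (simp add: split_beta' mult_ac)
  have iJ: "integrable lborel J"
  proof -
    have "integrable lborel2 (\<lambda>z. v z * indicator {t1<..t2} (fst z))"
      by (intro integrable_mult_bounded[OF v(2), of _ 1]) (auto simp: indicator_def)
    then have "integrable lborel2 (\<lambda>(t, x). indicator {t1<..t2} t * v (t, x))"
      by (simp add: split_beta' mult_ac)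
    from lborel_pair.integrable_snd[OF this] show ?thesis
      by (simp add: J_def[abs_def] set_lebesgue_integral_def)
  qed
  have iJt: "integrable torus_measure J"
    using integrable_mult_indicator[OF _ iJ, of "{0..<1}"] by (simp add: integrable_lebesgue_on_eq set_integrable_def)
  have iu: "integrable torus_measure (u t1)" "integrable torus_measure (u t2)"
    using L L2_torus_integrable by auto
  note m = integrable_mult_bounded[OF _ torus_measurable[OF \<theta>] \<theta>1]
  have "(LINT x|torus_measure. u t2 x * \<theta> x) - (LINT x|torus_measure. u t1 x * \<theta> x) =
      (LINT t:{t1<..t2}|lborel. LINT x|lborel. v (t, x) * \<theta> x)"
    by (rule weak_time_derivative_pairing[OF u v \<theta> \<theta>1 cont good t])
  also have "\<dots> = (LINT t|lborel. LINT x|lborel. indicator {t1<..t2} t * (v (t, x) * \<theta> x))"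
    by (simp add: set_lebesgue_integral_def)
  also have "\<dots> = (LINT x|lborel. LINT t|lborel. indicator {t1<..t2} t * (v (t, x) * \<theta> x))"
    by (rule lborel_pair.Fubini_integral[symmetric, OF iA'])
  also have "\<dots> = (LINT x|lborel. J x * \<theta> x)"
    by (simp add: J_def set_lebesgue_integral_def mult.assoc[symmetric])
  also have "\<dots> = (LINT x:{0..<1}|lborel. J x * \<theta> x)"
    unfolding set_lebesgue_integral_def
    by (rule Bochner_Integration.integral_cong) (use J0 in \<open>auto simp: indicator_def\<close>)
  also have "\<dots> = (LINT x|torus_measure. J x * \<theta> x)"
    by (rule integral_lebesgue_on_eq[symmetric]) auto
  finally have "(LINT x|torus_measure. (u t2 x - u t1 x - J x) * \<theta> x) = 0"
    unfolding left_diff_distrib using m[OF iu(1)] m[OF iu(2)] m[OF iJt] by simp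
  moreover have "(LINT x|torus_measure. (u t2 x - u t1 x - J x) * \<theta> x) = (LINT x|torus_measure. \<bar>X x\<bar>)"
    by (rule Bochner_Integration.integral_cong) (auto simp: X_def \<theta>_def frac_eq mult_sgn_abs abs_sgn)
  moreover have iX: "integrable torus_measure X"
  proof -
    have "integrable torus_measure (\<lambda>x. u t2 x - u t1 x - J x)" using iu iJt by simp
    then show ?thesis
      by (rule Bochner_Integration.integrable_cong[OF refl, THEN iffD1, rotated]) (simp add: X_def frac_eq)
  qed
  ultimately have "AE x in torus_measure. \<bar>X x\<bar> = 0"
    using integral_nonneg_eq_0_iff_AE[of torus_measure "\<lambda>x. \<bar>X x\<bar>"] by simp
  then have "AE x in lborel. x \<in> {0..<1} \<longrightarrow> X x = 0"
    by (simp add: AE_lebesgue_on_iff)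
  then have "AE x in lborel. X x = 0" using Xp by (intro AE_periodic) auto
  then show ?thesis by eventually_elim (simp add: X_def J_def)
qed

text \<open>The form in which \<open>selection\<close> is used from here on: the continuous
  representative together with its increments. In these, \<open>v\<close> is the space derivative of
  the selection, which by the equation is the time derivative of \<open>u\<close>.\<close>

definition continuous_selection ::
  "(real \<Rightarrow> real) \<Rightarrow> real \<Rightarrow> real \<Rightarrow> (real \<Rightarrow> real) \<Rightarrow> (real \<Rightarrow> real) \<Rightarrow> bool" where
  "continuous_selection W cp cm f v \<longleftrightarrow>
     (\<exists>a \<mu> \<nu> q. derivative_decomposition f a \<mu> \<nu> \<and> periodic1 q \<and> continuous_on UNIV q \<and>
       (AE x in torus_measure. q x \<in> subdifferential W (a x)) \<and>
       (AE x in \<mu>. q x = cp) \<and> (AE x in \<nu>. q x = - cm) \<and>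
       (\<forall>x y. x < y \<longrightarrow> y < x + 1 \<longrightarrow> q y - q x = (LINT s:{x<..y}|lborel. v s)))"

text \<open>A single Borel function \<open>V\<close> serves in both directions: integrated in time
  it gives the increments of \<open>u\<close>, integrated in space those of the selection. Only this
  form of the equation enters the comparison.\<close>

lemma energy_solution_data:
  assumes en: "energy_solution W cp cm T u" and cont: "L2_continuous T u"
    and good: "\<forall>t\<in>{0<..<T}. good_representative (u t)"
  obtains V :: "real \<Rightarrow> real \<Rightarrow> real" where
    "(\<lambda>(t, x). V t x) \<in> borel_measurable lborel2"
    "\<And>c. integrable lborel2 (\<lambda>(t, x). indicator {c..<c+1} x * V t x)"
    "\<And>t1 t2. 0 < t1 \<Longrightarrow> t1 < t2 \<Longrightarrow> t2 < T \<Longrightarrow>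
       AE x in lborel. u t2 x - u t1 x = (LINT t:{t1<..t2}|lborel. V t x)"
    "AE t in lborel. t \<in> {0<..<T} \<longrightarrow> continuous_selection W cp cm (u t) (V t)"
proof -
  obtain ut \<Omega> \<Omega>x where u: "L2_spacetime T u" and ut: "L2_spacetime T ut" "weak_time_derivative T u ut"
    and \<Omega>: "AE t in time_measure T. W12_torus (\<Omega> t) (\<Omega>x t)"
    and weak: "\<And>\<phi>. smooth_torus \<phi> \<Longrightarrow> AE t in time_measure T.
       (LINT x|torus_measure. ut t x * \<phi> x) = - (LINT x|torus_measure. \<Omega> t x * deriv \<phi> x)"
    and sel: "AE t in time_measure T. selection W cp cm (u t) (\<Omega> t)"
    using en unfolding energy_solution_def by blast
  obtain v where v: "v \<in> borel_measurable lborel2" "integrable lborel2 v"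
      "\<And>t x. t \<notin> {0<..<T} \<or> x \<notin> {0..<1} \<Longrightarrow> v (t, x) = 0"
      "AE t in lborel. AE x in lborel. t \<in> {0<..<T} \<longrightarrow> x \<in> {0..<1} \<longrightarrow> v (t, x) = ut t x"
      "AE x in lborel. AE t in lborel. t \<in> {0<..<T} \<longrightarrow> x \<in> {0..<1} \<longrightarrow> v (t, x) = ut t x"
    using spacetime_borel_version[OF ut(1)] by blast
  note [measurable] = v(1)
  define V where "V t x = v (t, frac x)" for t x
  have Vm: "(\<lambda>(t, x). V t x) \<in> borel_measurable lborel2" unfolding V_def by measurable
  have Vp: "periodic1 (V t)" for t by (simp add: periodic1_def V_def frac_1_eq)
  have Vt [measurable]: "V t \<in> borel_measurable borel" for t unfolding V_def by measurable
  \<comment> \<open>The null set of times depends on the test function, hence the restriction to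
    rational nodes and integer indices.\<close>
  have "AE t in lborel. \<forall>x\<in>\<rat>. \<forall>y\<in>\<rat>. \<forall>k::nat. t \<in> {0<..<T} \<longrightarrow>
      (LINT s|torus_measure. ut t s * ptrap (real k + 2) x y s) = - (LINT s|torus_measure. \<Omega> t s * deriv (ptrap (real k + 2) x y) s)"
    using weak smooth_torus_ptrap
    by (intro AE_ball_countable[THEN iffD2] ballI countable_rat AE_all_countable[THEN iffD2] allI)
       (auto simp: AE_lebesgue_on_iff)
  moreover have "AE t in lborel. integrable lborel (\<lambda>x. v (t, x))"
    using lborel_pair.AE_integrable_fst'[OF v(2)] .
  ultimately have main: "AE t in lborel. t \<in> {0<..<T} \<longrightarrow> continuous_selection W cp cm (u t) (V t)"
    using v(4) \<Omega>[unfolded AE_lebesgue_on_iff[OF borel_open[OF open_greaterThanLessThan]]]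
      sel[unfolded AE_lebesgue_on_iff[OF borel_open[OF open_greaterThanLessThan]]]
  proof eventually_elim
    case (elim t)
    show ?case
    proof
      assume t: "t \<in> {0<..<T}"
      obtain a \<mu> \<nu> q where q: "derivative_decomposition (u t) a \<mu> \<nu>" "periodic1 q" "continuous_on UNIV q"
        "AE x in torus_measure. q x = \<Omega> t x"
        "AE x in torus_measure. q x \<in> subdifferential W (a x)"
        "AE x in \<mu>. q x = cp" "AE x in \<nu>. q x = - cm"
        using elim(5) t unfolding selection_def by blast
      have V01: "set_integrable lborel {0..<1} (V t)"
      proof -
        have "integrable lborel (\<lambda>x. indicator {0..<1} x *\<^sub>R v (t, x))"
          using elim(2) by (intro integrable_mult_indicator) auto
        then show ?thesis unfolding set_integrable_def
          by (rule Bochner_Integration.integrable_cong[OF refl, THEN iffD1, rotated])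
             (auto simp: V_def indicator_def frac_eq)
      qed
      have Om: "\<Omega> t \<in> borel_measurable torus_measure"
        using elim(4) t by (simp add: W12_torus_def L2_torus_def square_integrable_def)
      have qi: "integrable torus_measure q"
        using periodic_torus_shift(1)[of q "\<lambda>_. 0" 0] q(2,3) smooth_affine[OF smooth_step, of 0 0 0]
        by (simp add: periodic1_frac periodic1_def borel_measurable_continuous_onI continuous_on_subset step_0)
      have "q y - q x = (LINT s:{x<..y}|lborel. V t s)" if xy: "x < y" "y < x + 1" for x y
      proof (rule increments_from_rationals[OF q(3) Vt _ _ xy])
        show "set_integrable lborel {c..<c + 1} (V t)" for c
          by (rule set_integrable_periodic_shift[OF Vt Vp V01])
        fix x y :: real assume r: "x \<in> \<rat>" "y \<in> \<rat>" "x < y" "y < x + 1"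
        show "q y - q x = (LINT s:{x<..y}|lborel. V t s)"
        proof (rule du_Bois_Reymond_torus[OF q(2,3) qi Vp Vt V01 r(3,4)])
          fix k :: nat
          let ?\<phi> = "ptrap (real k + 2) x y"
          have s: "smooth ?\<phi>" using smooth_torus_ptrap by (simp add: smooth_torus_def)
          note [measurable] = smooth_borel[OF s] 
          have d: "deriv ?\<phi> \<in> borel_measurable torus_measure"
            by (intro torus_measurable smooth_borel smooth_deriv s)
          have "(LINT s|torus_measure. q s * deriv ?\<phi> s) = (LINT s|torus_measure. \<Omega> t s * deriv ?\<phi> s)"
            using q(4) qi Om d by (intro integral_cong_AE) auto
          also have "\<dots> = - (LINT s|torus_measure. ut t s * ?\<phi> s)"
            using elim(1) r t by fastforce
          also have "(LINT s|torus_measure. ut t s * ?\<phi> s) = (LINT s:{0..<1}|lborel. V t s * ?\<phi> s)"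
            by (rule integral_lebesgue_on_cong_AE)
               (use elim(3) t in \<open>auto elim!: AE_mp simp: V_def frac_eq\<close>)
          also have "\<dots> = (LINT s|torus_measure. V t s * ?\<phi> s)"
            by (rule integral_lebesgue_on_eq[symmetric]) auto
          finally show "(LINT s|torus_measure. q s * deriv ?\<phi> s) = - (LINT s|torus_measure. V t s * ?\<phi> s)" .
        qed
      qed
      then show "continuous_selection W cp cm (u t) (V t)"
        using q unfolding continuous_selection_def by blast
    qed
  qed
  show ?thesis
  proof (rule that[OF Vm])
    show "integrable lborel2 (\<lambda>(t, x). indicator {c..<c+1} x * V t x)" for c
      unfolding V_def by (rule periodic_extension_integrable[OF v(1,2)])
    show "AE x in lborel. u t2 x - u t1 x = (LINT t:{t1<..t2}|lborel. V t x)" if "0 < t1" "t1 < t2" "t2 < T" for t1 t2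
      unfolding V_def by (rule time_increments[OF u ut v(1,2,3,5) cont good that])
  qed (rule main)
qed

section \<open>Superlevel sets along grids\<close>

text \<open>\<open>Suc n\<close> cells, so that the denominator is never 0.\<close>

definition grid :: "real \<Rightarrow> real \<Rightarrow> nat \<Rightarrow> nat \<Rightarrow> real" where
  "grid a b n i = a + (b - a) * (real i / real (Suc n))"

lemma grid_ends [simp]: "grid a b n 0 = a" "grid a b n (Suc n) = b"
  by (simp_all add: grid_def del: of_nat_Suc)

lemma grid_strict_mono: "a < b \<Longrightarrow> i < j \<Longrightarrow> grid a b n i < grid a b n j"
  by (simp add: grid_def divide_strict_right_mono)

lemma grid_mono: "a < b \<Longrightarrow> i \<le> j \<Longrightarrow> grid a b n i \<le> grid a b n j"
  using grid_strict_mono[of a b i j n] by (cases "i = j") auto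

lemma grid_range:
  assumes "a < b" "i \<le> Suc n"
  shows "a \<le> grid a b n i" "grid a b n i \<le> b"
  using grid_mono[of a b 0 i n] grid_mono[of a b i "Suc n" n] assms by (auto simp del: of_nat_Suc)

lemma grid_step: "grid a b n (Suc i) - grid a b n i = (b - a) / real (Suc n)"
  unfolding grid_def of_nat_Suc[of i] add_divide_distrib distrib_left by (simp del: of_nat_Suc)

lemma grid_cell:
  assumes "a < b" "a < s" "s \<le> b"
  obtains j where "j < Suc n" "grid a b n j < s" "s \<le> grid a b n (Suc j)"
    "\<And>i. grid a b n i < s \<Longrightarrow> s \<le> grid a b n (Suc i) \<Longrightarrow> i = j"
proof -
  define m where "m = (LEAST m. s \<le> grid a b n m)"
  have ex: "s \<le> grid a b n (Suc n)" using assms by simp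
  have m: "s \<le> grid a b n m" unfolding m_def by (rule LeastI[of _ "Suc n"]) (rule ex)
  have "m \<le> Suc n" unfolding m_def by (rule Least_le) (rule ex)
  moreover have "m \<noteq> 0" using m assms by (intro notI) simp
  ultimately obtain j where j: "m = Suc j" "j < Suc n" by (cases m) auto
  have gj: "grid a b n j < s" using not_less_Least[of j "\<lambda>m. s \<le> grid a b n m"] j(1) unfolding m_def by auto
  show ?thesis
  proof (rule that[OF j(2) gj])
    show "s \<le> grid a b n (Suc j)" using m j by simp
    fix i assume i: "grid a b n i < s" "s \<le> grid a b n (Suc i)"
    have "\<not> i < j" using grid_mono[OF assms(1), of "Suc i" j n] gj i by auto
    moreover have "\<not> j < i" using grid_mono[OF assms(1), of "Suc j" i n] m j i by auto
    ultimately show "i = j" by simp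
  qed
qed

text \<open>The sum is the integral of \<open>D\<close> against a function that is constant on each
  cell. Where \<open>e\<close> is locally constant, both nodes of the cell around \<open>s\<close>
  eventually share the value \<open>e s\<close>, and dominated convergence applies. Since
  \<open>k\<close> sees \<open>e\<close> at both ends of a cell, the lemma also covers sums over the
  cells where \<open>e\<close> changes.\<close>

lemma grid_sum_tendsto:
  fixes e :: "real \<Rightarrow> bool" and k :: "bool \<Rightarrow> bool \<Rightarrow> real" and D :: "real \<Rightarrow> real"
  assumes ab: "a < b" and D: "D \<in> borel_measurable borel" "set_integrable lborel {a..b} D"
    and e: "Measurable.pred borel e"
    and loc: "AE s in lborel. s \<in> {a<..<b} \<longrightarrow> (\<exists>d>0. \<forall>y\<in>{a..b}. \<bar>y - s\<bar> < d \<longrightarrow> e y = e s)"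
  shows "(\<lambda>n. \<Sum>i<Suc n. k (e (grid a b n i)) (e (grid a b n (Suc i))) *
      (LINT s:{grid a b n i<..grid a b n (Suc i)}|lborel. D s))
    \<longlonglongrightarrow> (LINT s:{a..b}|lborel. k (e s) (e s) * D s)"
proof -
  note [measurable] = D(1) e
  define C where "C = \<bar>k True True\<bar> + \<bar>k True False\<bar> + \<bar>k False True\<bar> + \<bar>k False False\<bar>"
  have C: "\<bar>k p q\<bar> \<le> C" for p q by (cases p; cases q) (auto simp: C_def)
  define c where "c n i = k (e (grid a b n i)) (e (grid a b n (Suc i)))" for n i
  define K where "K n s = (\<Sum>i<Suc n. c n i * indicator {grid a b n i<..grid a b n (Suc i)} s)" for n s
  have K_out: "K n s = 0" if "s \<notin> {a<..b}" for n s
    unfolding K_def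
  proof (rule sum.neutral, intro ballI)
    fix i assume "i \<in> {..<Suc n}"
    then have "a \<le> grid a b n i" "grid a b n (Suc i) \<le> b" using grid_range[OF ab] by auto
    then show "c n i * indicator {grid a b n i<..grid a b n (Suc i)} s = 0" using that by (auto simp: indicator_def)
  qed
  have K_in: "\<exists>j<Suc n. grid a b n j < s \<and> s \<le> grid a b n (Suc j) \<and> K n s = c n j" if "s \<in> {a<..b}" for n s
  proof -
    from that have s: "a < s" "s \<le> b" by auto
    obtain j where j: "j < Suc n" "grid a b n j < s" "s \<le> grid a b n (Suc j)"
      "\<And>i. grid a b n i < s \<Longrightarrow> s \<le> grid a b n (Suc i) \<Longrightarrow> i = j"
      using grid_cell[OF ab s] by metis
    have "K n s = (\<Sum>i<Suc n. if i = j then c n j else 0)"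
      unfolding K_def
    proof (rule sum.cong[OF refl])
      fix i
      show "c n i * indicator {grid a b n i<..grid a b n (Suc i)} s = (if i = j then c n j else 0)"
      proof (cases "i = j")
        case True
        then show ?thesis using j(2,3) by simp
      next
        case False
        then have "s \<notin> {grid a b n i<..grid a b n (Suc i)}" using j(4)[of i] by auto
        then show ?thesis using False by simp
      qed
    qed
    also have "\<dots> = c n j" using j(1) by (simp add: sum.delta)
    finally show ?thesis using j(1,2,3) by blast
  qed
  have K_bound: "\<bar>K n s\<bar> \<le> C * indicator {a..b} s" for n s
  proof (cases "s \<in> {a<..b}")
    case True
    then obtain j where "K n s = c n j" using K_in by blast
    then show ?thesis using C True by (simp add: c_def)
  next
    case False
    have "0 \<le> C" using C[of True True] by linarith
    then show ?thesis using K_out[OF False] by simp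
  qed
  have K_lim: "(\<lambda>n. K n s) \<longlonglongrightarrow> k (e s) (e s)"
    if s: "s \<in> {a<..<b}" and d: "d > 0" "\<forall>y\<in>{a..b}. \<bar>y - s\<bar> < d \<longrightarrow> e y = e s" for s d
  proof -
    have "(\<lambda>n. (b - a) / real (Suc n)) \<longlonglongrightarrow> 0" by real_asymp
    then have "\<forall>\<^sub>F n in sequentially. (b - a) / real (Suc n) < d" using d(1) by (rule order_tendstoD(2))
    then have "\<forall>\<^sub>F n in sequentially. K n s = k (e s) (e s)"
    proof eventually_elim
      case (elim n)
      have "s \<in> {a<..b}" using s by auto
      then obtain j where j: "j < Suc n" "grid a b n j < s" "s \<le> grid a b n (Suc j)" "K n s = c n j"
        using K_in by blast
      have st: "grid a b n (Suc j) - grid a b n j < d" using elim by (simp add: grid_step)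
      have "e (grid a b n j) = e s" "e (grid a b n (Suc j)) = e s"
        using j st grid_range[OF ab, of j n] grid_range[OF ab, of "Suc j" n] by (auto intro!: d(2)[rule_format])
      then show ?case using j(4) by (simp add: c_def)
    qed
    then show ?thesis by (rule tendsto_eventually)
  qed
  have cell: "set_integrable lborel {grid a b n i<..grid a b n (Suc i)} D" if "i < Suc n" for n i
    by (rule set_integrable_subset[OF D(2)]) (use grid_range[OF ab, of i n] grid_range[OF ab, of "Suc i" n] that in auto)
  have sum_eq: "(\<Sum>i<Suc n. c n i * (LINT s:{grid a b n i<..grid a b n (Suc i)}|lborel. D s)) = (LINT s|lborel. K n s * D s)" for n
  proof -
    have "(LINT s|lborel. K n s * D s) = (LINT s|lborel. (\<Sum>i<Suc n. c n i * (indicator {grid a b n i<..grid a b n (Suc i)} s *\<^sub>R D s)))"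
      by (simp only: K_def sum_distrib_right mult.assoc real_scaleR_def)
    also have "\<dots> = (\<Sum>i<Suc n. LINT s|lborel. c n i * (indicator {grid a b n i<..grid a b n (Suc i)} s *\<^sub>R D s))"
      using cell by (intro Bochner_Integration.integral_sum) (auto simp: set_integrable_def)
    finally show ?thesis by (simp add: set_lebesgue_integral_def)
  qed
  have "(\<lambda>n. LINT s|lborel. K n s * D s) \<longlonglongrightarrow> (LINT s|lborel. indicator {a..b} s *\<^sub>R (k (e s) (e s) * D s))"
  proof (rule integral_dominated_convergence)
    show "integrable lborel (\<lambda>s. C * \<bar>indicator {a..b} s * D s\<bar>)"
      using D(2) by (simp add: set_integrable_def)
    show "AE s in lborel. norm (K n s * D s) \<le> C * \<bar>indicator {a..b} s * D s\<bar>" for n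
    proof (rule AE_I2)
      fix s
      have "\<bar>K n s\<bar> * \<bar>D s\<bar> \<le> C * indicator {a..b} s * \<bar>D s\<bar>"
        by (rule mult_right_mono[OF K_bound]) simp
      then show "norm (K n s * D s) \<le> C * \<bar>indicator {a..b} s * D s\<bar>"
        by (simp add: abs_mult mult.assoc)
    qed
    show "AE s in lborel. (\<lambda>n. K n s * D s) \<longlonglongrightarrow> indicator {a..b} s *\<^sub>R (k (e s) (e s) * D s)"
      using loc AE_lborel_singleton[of a] AE_lborel_singleton[of b]
    proof eventually_elim
      case (elim s)
      show ?case
      proof (cases "s \<in> {a<..<b}")
        case True
        then obtain d where "d > 0" "\<forall>y\<in>{a..b}. \<bar>y - s\<bar> < d \<longrightarrow> e y = e s" using elim by blast
        then have "(\<lambda>n. K n s * D s) \<longlonglongrightarrow> k (e s) (e s) * D s"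
          by (intro tendsto_mult tendsto_const K_lim[OF True])
        moreover have "indicator {a..b} s = (1 :: real)" using True by simp
        ultimately show ?thesis by simp
      next
        case False
        then have s: "s \<notin> {a..b}" using elim by auto
        then have "K n s = 0" for n using K_out[of s n] by auto
        then show ?thesis using s by simp
      qed
    qed
    show "(\<lambda>s. K n s * D s) \<in> borel_measurable lborel" for n unfolding K_def by measurable
    have "(\<lambda>s. k (e s) (e s)) = (\<lambda>s. if e s then k True True else k False False)" by auto
    moreover have "(\<lambda>s. if e s then k True True else k False False) \<in> borel_measurable borel" by measurable
    ultimately have [measurable]: "(\<lambda>s. k (e s) (e s)) \<in> borel_measurable borel" by simp
    show "(\<lambda>s. indicator {a..b} s *\<^sub>R (k (e s) (e s) * D s)) \<in> borel_measurable lborel" by measurable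
  qed
  then show ?thesis by (simp only: sum_eq[symmetric] c_def set_lebesgue_integral_def)
qed

text \<open>By convexity an increment of the positive part is at most the increment of
  \<open>y\<close> times the indicator of positivity at the later node. Summed over a grid the
  left-hand sides telescope, and the right-hand sides converge.\<close>

lemma positive_part_increment:
  fixes y D :: "real \<Rightarrow> real"
  assumes ab: "a < b" and D: "D \<in> borel_measurable borel" "set_integrable lborel {a..b} D"
    and y: "y \<in> borel_measurable borel" "continuous_on {a..b} y"
    and inc: "\<And>s t. a \<le> s \<Longrightarrow> s < t \<Longrightarrow> t \<le> b \<Longrightarrow> y t - y s = (LINT r:{s<..t}|lborel. D r)"
    and nz: "AE s in lborel. s \<in> {a<..<b} \<longrightarrow> y s \<noteq> 0"
  shows "max 0 (y b) - max 0 (y a) \<le> (LINT s:{a..b}|lborel. of_bool (0 < y s) * D s)"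
proof -
  note [measurable] = y(1)
  have e: "Measurable.pred borel (\<lambda>s. 0 < y s)" by measurable
  have loc: "AE s in lborel. s \<in> {a<..<b} \<longrightarrow> (\<exists>d>0. \<forall>x\<in>{a..b}. \<bar>x - s\<bar> < d \<longrightarrow> (0 < y x) = (0 < y s))"
    using nz
  proof eventually_elim
    case (elim s)
    show ?case
    proof
      assume s: "s \<in> {a<..<b}"
      then have "0 < \<bar>y s\<bar>" using elim by simp
      then obtain d where d: "d > 0" "\<And>x. x \<in> {a..b} \<Longrightarrow> dist x s < d \<Longrightarrow> dist (y x) (y s) < \<bar>y s\<bar>"
        using y(2) s unfolding continuous_on_iff by (metis atLeastAtMost_iff greaterThanLessThan_iff less_imp_le)
      have "(0 < y x) = (0 < y s)" if "x \<in> {a..b}" "\<bar>x - s\<bar> < d" for x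
        using d(2)[of x] that by (auto simp: dist_real_def)
      then show "\<exists>d>0. \<forall>x\<in>{a..b}. \<bar>x - s\<bar> < d \<longrightarrow> (0 < y x) = (0 < y s)" using d(1) by blast
    qed
  qed
  note lim = grid_sum_tendsto[OF ab D e loc, of "\<lambda>p q. of_bool q"]
  show ?thesis
  proof (rule LIMSEQ_le_const[OF lim], intro exI allI impI)
    fix n :: nat
    let ?g = "grid a b n"
    have "max 0 (y b) - max 0 (y a) = (\<Sum>i<Suc n. max 0 (y (?g (Suc i))) - max 0 (y (?g i)))"
      by (subst sum_lessThan_telescope) simp
    also have "\<dots> \<le> (\<Sum>i<Suc n. of_bool (0 < y (?g (Suc i))) * (LINT s:{?g i<..?g (Suc i)}|lborel. D s))"
    proof (rule sum_mono)
      fix i assume "i \<in> {..<Suc n}"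
      then have "y (?g (Suc i)) - y (?g i) = (LINT s:{?g i<..?g (Suc i)}|lborel. D s)"
        using grid_range[OF ab] grid_strict_mono[OF ab] by (intro inc) auto
      then show "max 0 (y (?g (Suc i))) - max 0 (y (?g i)) \<le> of_bool (0 < y (?g (Suc i))) * (LINT s:{?g i<..?g (Suc i)}|lborel. D s)"
        by (simp flip: add: max_def)
    qed
    finally show "max 0 (y b) - max 0 (y a) \<le> (\<Sum>i<Suc n. of_bool (0 < y (?g (Suc i))) * (LINT s:{?g i<..?g (Suc i)}|lborel. D s))" .
  qed
qed

text \<open>Summation by parts. Here \<open>z\<close> stands for the difference of the two
  selections, up to sign, and as \<open>w \<le> 0\<close> at both ends only cells on which the sign
  of \<open>w\<close> changes contribute. There \<open>up\<close> or \<open>down\<close> supplies a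
  point with the favourable sign of \<open>z\<close>, so the contribution is at most the integral of
  \<open>g\<close> over the cell, and such cells disappear in the limit.\<close>

lemma superlevel_integral_nonpos:
  fixes w z D g :: "real \<Rightarrow> real"
  assumes ab: "a < b" and D: "D \<in> borel_measurable borel" "set_integrable lborel {a..b} D"
    and g: "g \<in> borel_measurable borel" "set_integrable lborel {a..b} g" "\<And>s. 0 \<le> g s"
    and w: "good_representative w" "w a \<le> 0" "w b \<le> 0" "AE s in lborel. s \<in> {a<..<b} \<longrightarrow> w s \<noteq> 0"
    and z1: "\<And>x y. a \<le> x \<Longrightarrow> x < y \<Longrightarrow> y \<le> b \<Longrightarrow> (LINT s:{x<..y}|lborel. D s) \<le> z y - z x"
    and z2: "\<And>x y. a \<le> x \<Longrightarrow> x < y \<Longrightarrow> y \<le> b \<Longrightarrow> \<bar>z y - z x\<bar> \<le> (LINT s:{x<..y}|lborel. g s)"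
    and up: "\<And>x y. a \<le> x \<Longrightarrow> x < y \<Longrightarrow> y \<le> b \<Longrightarrow> w x < w y \<Longrightarrow> \<exists>c\<in>{x..y}. 0 \<le> z c"
    and down: "\<And>x y. a \<le> x \<Longrightarrow> x < y \<Longrightarrow> y \<le> b \<Longrightarrow> w y < w x \<Longrightarrow> \<exists>c\<in>{x..y}. z c \<le> 0"
  shows "(LINT s:{a..b}|lborel. of_bool (0 < w s) * D s) \<le> 0"
proof -
  note [measurable] = good_representative_borel[OF w(1)]
  have e: "Measurable.pred borel (\<lambda>s. 0 < w s)" by measurable
  have "AE s in lborel. s \<notin> {x. \<not> isCont w x}"
    by (intro AE_not_in countable_imp_null_set_lborel good_representative_countable_discontinuities w(1))
  then have loc: "AE s in lborel. s \<in> {a<..<b} \<longrightarrow> (\<exists>d>0. \<forall>x\<in>{a..b}. \<bar>x - s\<bar> < d \<longrightarrow> (0 < w x) = (0 < w s))"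
    using w(4)
  proof eventually_elim
    case (elim s)
    show ?case
    proof
      assume s: "s \<in> {a<..<b}"
      then have "0 < \<bar>w s\<bar>" using elim(2) by simp
      have iso: "isCont w s" using elim(1) by simp
      then obtain d where d: "d > 0" "\<And>x. dist x s < d \<Longrightarrow> dist (w x) (w s) < \<bar>w s\<bar>"
        using iso[unfolded continuous_at_eps_delta, rule_format, OF \<open>0 < \<bar>w s\<bar>\<close>] by blast
      have "(0 < w x) = (0 < w s)" if "\<bar>x - s\<bar> < d" for x
        using d(2)[of x] that by (auto simp: dist_real_def)
      then show "\<exists>d>0. \<forall>x\<in>{a..b}. \<bar>x - s\<bar> < d \<longrightarrow> (0 < w x) = (0 < w s)" using d(1) by blast
    qed
  qed
  define c where "c n i = (of_bool (0 < w (grid a b n i)) :: real)" for n i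
  have le: "(\<Sum>i<Suc n. of_bool (0 < w (grid a b n (Suc i))) * (LINT s:{grid a b n i<..grid a b n (Suc i)}|lborel. D s))
    \<le> (\<Sum>i<Suc n. of_bool ((0 < w (grid a b n i)) \<noteq> (0 < w (grid a b n (Suc i)))) * (LINT s:{grid a b n i<..grid a b n (Suc i)}|lborel. g s))" for n
  proof -
    let ?g = "grid a b n"
    have ends: "c n 0 = 0" "c n (Suc n) = 0" using w(2,3) by (auto simp: c_def)
    have "(\<Sum>i<Suc n. c n (Suc i) * (LINT s:{?g i<..?g (Suc i)}|lborel. D s))
        \<le> (\<Sum>i<Suc n. c n (Suc i) * (z (?g (Suc i)) - z (?g i)))"
    proof (rule sum_mono)
      fix i assume "i \<in> {..<Suc n}"
      then have "(LINT s:{?g i<..?g (Suc i)}|lborel. D s) \<le> z (?g (Suc i)) - z (?g i)"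
        using grid_range[OF ab] grid_strict_mono[OF ab] by (intro z1) auto
      then show "c n (Suc i) * (LINT s:{?g i<..?g (Suc i)}|lborel. D s) \<le> c n (Suc i) * (z (?g (Suc i)) - z (?g i))"
        by (intro mult_left_mono) (auto simp: c_def)
    qed
    \<comment> \<open>A discrete product rule; its first part telescopes to 0 because the indicator
      vanishes at both end nodes.\<close>
    also have "\<dots> = (\<Sum>i<Suc n. (c n (Suc i) * z (?g (Suc i)) - c n i * z (?g i)) + (c n i - c n (Suc i)) * z (?g i))"
      by (rule sum.cong) (auto simp: algebra_simps)
    also have "\<dots> = (\<Sum>i<Suc n. c n (Suc i) * z (?g (Suc i)) - c n i * z (?g i)) + (\<Sum>i<Suc n. (c n i - c n (Suc i)) * z (?g i))"
      by (rule sum.distrib)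
    also have "(\<Sum>i<Suc n. c n (Suc i) * z (?g (Suc i)) - c n i * z (?g i)) = 0"
      by (subst sum_lessThan_telescope[of "\<lambda>i. c n i * z (?g i)"]) (simp add: ends)
    also have "0 + (\<Sum>i<Suc n. (c n i - c n (Suc i)) * z (?g i)) \<le>
        (\<Sum>i<Suc n. of_bool ((0 < w (?g i)) \<noteq> (0 < w (?g (Suc i)))) * (LINT s:{?g i<..?g (Suc i)}|lborel. g s))"
      unfolding add_0
    proof (rule sum_mono)
      fix i assume "i \<in> {..<Suc n}"
      then have r: "a \<le> ?g i" "?g i < ?g (Suc i)" "?g (Suc i) \<le> b"
        using grid_range[OF ab] grid_strict_mono[OF ab] by auto
      define G where "G = (LINT s:{?g i<..?g (Suc i)}|lborel. g s)"
      have near: "\<bar>z x - z (?g i)\<bar> \<le> G" if "x \<in> {?g i..?g (Suc i)}" for x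
      proof (cases "x = ?g i")
        case True
        then show ?thesis using g(3) by (simp add: G_def set_lebesgue_integral_def)
      next
        case False
        then have "\<bar>z x - z (?g i)\<bar> \<le> (LINT s:{?g i<..x}|lborel. g s)" using that r by (intro z2) auto
        also have "\<dots> \<le> G"
          unfolding G_def set_lebesgue_integral_def
        proof (rule integral_mono)
          show "integrable lborel (\<lambda>s. indicator {?g i<..x} s *\<^sub>R g s)"
            "integrable lborel (\<lambda>s. indicator {?g i<..?g (Suc i)} s *\<^sub>R g s)"
            unfolding set_integrable_def[symmetric]
            by (rule set_integrable_subset[OF g(2)]; use r that in auto)+
          show "indicator {?g i<..x} s *\<^sub>R g s \<le> indicator {?g i<..?g (Suc i)} s *\<^sub>R g s" for s
            using that g(3)[of s] by (auto simp: indicator_def)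
        qed
        finally show ?thesis .
      qed
      \<comment> \<open>Leaving the positive set contributes \<open>z\<close> at the left node, and
        \<open>down\<close> finds a point of the cell with \<open>z \<le> 0\<close>; entering it
        contributes \<open>- z\<close>, which is bounded through \<open>up\<close>.\<close>
      consider "(0 < w (?g i)) = (0 < w (?g (Suc i)))" | "0 < w (?g i)" "\<not> 0 < w (?g (Suc i))" | "\<not> 0 < w (?g i)" "0 < w (?g (Suc i))"
        by blast
      then have "(c n i - c n (Suc i)) * z (?g i) \<le> of_bool ((0 < w (?g i)) \<noteq> (0 < w (?g (Suc i)))) * G"
      proof cases
        case 1
        then show ?thesis by (simp add: c_def)
      next
        case 2
        then obtain x where "x \<in> {?g i..?g (Suc i)}" "z x \<le> 0" using down[OF r] by fastforce
        then show ?thesis using near[of x] 2 by (simp add: c_def)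
      next
        case 3
        then obtain x where "x \<in> {?g i..?g (Suc i)}" "0 \<le> z x" using up[OF r] by fastforce
        then show ?thesis using near[of x] 3 by (simp add: c_def)
      qed
      then show "(c n i - c n (Suc i)) * z (?g i) \<le> of_bool ((0 < w (?g i)) \<noteq> (0 < w (?g (Suc i)))) * (LINT s:{?g i<..?g (Suc i)}|lborel. g s)"
        by (simp only: G_def)
    qed
    finally show ?thesis by (simp only: c_def)
  qed
  \<comment> \<open>In the limit both arguments of the weight coincide, so the weight that marks
    sign changes becomes 0.\<close>
  have "(LINT s:{a..b}|lborel. of_bool (0 < w s) * D s) \<le> (LINT s:{a..b}|lborel. of_bool ((0 < w s) \<noteq> (0 < w s)) * g s)"
    by (rule LIMSEQ_le[OF grid_sum_tendsto[OF ab D e loc, of "\<lambda>p q. of_bool q"]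
          grid_sum_tendsto[OF ab g(1,2) e loc, of "\<lambda>p q. of_bool (p \<noteq> q)"]]) (use le in blast)
  then show ?thesis by simp
qed

section \<open>Null levels and comparison on a rectangle\<close>

lemma not_AE_notin_interval:
  fixes x y :: real
  assumes "x < y" "AE s in lborel. s \<notin> {x<..<y}"
  shows False
proof -
  have "{s \<in> space lborel. \<not> s \<notin> {x<..<y}} = {x<..<y}" by auto
  then have "emeasure lborel {x<..<y} = 0"
    using assms(2) AE_iff_measurable[of "{x<..<y}" lborel "\<lambda>s. s \<notin> {x<..<y}"] by simp
  then show False using assms(1) by simp
qed

text \<open>A violation at one point spreads to a whole interval, which is not a null set.\<close>

lemma good_representative_le_if_AE:
  assumes w: "good_representative w" and ae: "AE s in lborel. s \<in> {a<..<b} \<longrightarrow> w s \<le> c"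
    and x: "x \<in> {a<..<b}"
  shows "w x \<le> c"
proof (rule ccontr)
  assume "\<not> ?thesis"
  then have "- w x < - c" by simp
  moreover have "0 < min (x - a) (b - x)" using x by simp
  ultimately obtain y z where yz: "x - min (x - a) (b - x) < y" "y < z" "z < x + min (x - a) (b - x)"
    "\<And>s. y < s \<Longrightarrow> s < z \<Longrightarrow> - w s < - c"
    using good_representative_near_less[OF good_representative_minus[OF w]] by blast
  have "AE s in lborel. s \<notin> {y<..<z}"
    using ae by eventually_elim (use yz in fastforce)
  then show False using not_AE_notin_interval yz(2) by blast
qed

text \<open>The distribution of \<open>Y\<close> over the rectangle is a finite measure, so it has
  at most countably many atoms, while an interval of levels is uncountable.\<close>

lemma exists_null_level:
  fixes Y :: "real \<times> real \<Rightarrow> real"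
  assumes Y: "Y \<in> borel_measurable lborel2" and d: "c < d"
  shows "\<exists>\<delta>\<in>{c<..<d}. AE z in lborel2. fst z \<in> {t1..t2} \<longrightarrow> snd z \<in> {a..b} \<longrightarrow> Y z \<noteq> \<delta>"
proof -
  define R where "R = {t1..t2} \<times> {a..b}"
  have Rm: "R \<in> sets lborel2" unfolding R_def by (intro pair_measureI) auto
  have "emeasure lborel2 R = emeasure lborel {t1..t2} * emeasure lborel {a..b}"
    unfolding R_def by (rule lborel.emeasure_pair_measure_Times) auto
  also have "\<dots> < \<infinity>" by (auto simp: ennreal_mult_less_top emeasure_lborel_Icc_eq)
  finally have fin: "emeasure lborel2 R \<noteq> \<infinity>" by simp
  define N where "N = distr (restrict_space lborel2 R) borel Y"
  have Y': "Y \<in> measurable (restrict_space lborel2 R) borel" using Y by (rule measurable_restrict_space1)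
  have sp: "space (restrict_space lborel2 R) = R" using sets.sets_into_space[OF Rm] by (auto simp: space_restrict_space)
  have "finite_measure N"
    using fin Rm unfolding N_def
    by (intro finite_measureI) (simp add: emeasure_distr[OF Y'] sp emeasure_restrict_space)
  then interpret N: finite_measure N .
  have "uncountable ({c<..<d} - {x. measure N {x} \<noteq> 0})"
    by (intro uncountable_minus_countable N.countable_support) (simp add: d uncountable_open_interval)
  then have "{c<..<d} - {x. measure N {x} \<noteq> 0} \<noteq> {}" by force
  then obtain \<delta> where "\<delta> \<in> {c<..<d} - {x. measure N {x} \<noteq> 0}" by blast
  then have \<delta>: "\<delta> \<in> {c<..<d}" "measure N {\<delta>} = 0" by auto
  have "emeasure N {\<delta>} = 0" using \<delta>(2) by (simp add: N.emeasure_eq_measure)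
  then have "emeasure (restrict_space lborel2 R) (Y -` {\<delta>} \<inter> R) = 0"
    unfolding N_def by (subst (asm) emeasure_distr[OF Y']) (auto simp: sp)
  then have "emeasure lborel2 (Y -` {\<delta>} \<inter> R) = 0"
    using Rm by (subst (asm) emeasure_restrict_space) auto
  moreover have "Y -` {\<delta>} \<inter> R \<in> sets lborel2"
  proof -
    have "Y -` {\<delta>} \<inter> space lborel2 \<in> sets lborel2" using Y by (rule measurable_sets) simp
    then have "(Y -` {\<delta>} \<inter> space lborel2) \<inter> R \<in> sets lborel2" using Rm by (rule sets.Int)
    then show ?thesis by (simp add: space_pair_measure)
  qed
  ultimately have "AE z in lborel2. z \<notin> Y -` {\<delta>} \<inter> R" by (intro AE_not_in) auto
  then have "AE z in lborel2. fst z \<in> {t1..t2} \<longrightarrow> snd z \<in> {a..b} \<longrightarrow> Y z \<noteq> \<delta>"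
    by eventually_elim (auto simp: R_def mem_Times_iff)
  then show ?thesis using \<delta>(1) by blast
qed

lemma set_integral_from_continuous:
  fixes D :: "real \<Rightarrow> real"
  assumes D: "set_integrable lborel {a..b} D"
  shows "continuous_on {a..b} (\<lambda>t. LINT s:{a<..t}|lborel. D s)"
    and "\<And>s t. a \<le> s \<Longrightarrow> s < t \<Longrightarrow> t \<le> b \<Longrightarrow>
      (LINT r:{a<..t}|lborel. D r) - (LINT r:{a<..s}|lborel. D r) = (LINT r:{s<..t}|lborel. D r)"
proof -
  have sub: "set_integrable lborel S D" if "S \<subseteq> {a..b}" "S \<in> sets borel" for S
    using set_integrable_subset[OF D] that by simp
  have eq: "(LINT s:{a<..t}|lborel. D s) = integral {a..t} D" if "t \<in> {a..b}" for t
  proof -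
    have "(LINT s:{a<..t}|lborel. D s) = integral {a<..t} D"
      by (rule set_borel_integral_eq_integral(2)[OF sub]) (use that in auto)
    also have "\<dots> = integral {a..t} D"
    proof (rule integral_subset_negligible)
      show "negligible ({a..t} - {a<..t})"
        by (rule negligible_subset[of "{a}"]) auto
    qed auto
    finally show ?thesis .
  qed
  have "continuous_on {a..b} (\<lambda>t. integral {a..t} D)"
    by (rule indefinite_integral_continuous_1[OF set_borel_integral_eq_integral(1)[OF D]])
  then show "continuous_on {a..b} (\<lambda>t. LINT s:{a<..t}|lborel. D s)"
    by (rule continuous_on_eq) (simp add: eq)
  fix s t assume st: "a \<le> s" "s < t" "t \<le> b"
  have "{a<..t} = {a<..s} \<union> {s<..t}" using st by auto
  moreover have "(LINT r:{a<..s} \<union> {s<..t}|lborel. D r) = (LINT r:{a<..s}|lborel. D r) + (LINT r:{s<..t}|lborel. D r)"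
    by (rule set_integral_Un) (use st in \<open>auto intro!: sub\<close>)
  ultimately show "(LINT r:{a<..t}|lborel. D r) - (LINT r:{a<..s}|lborel. D r) = (LINT r:{s<..t}|lborel. D r)"
    by simp
qed

text \<open>The integral of \<open>V - \<gamma>\<close> over the set where
  \<open>w + \<delta>\<close> is positive is estimated twice. Along time it dominates the integral
  of the positive part of \<open>w + \<delta>\<close> at \<open>t2\<close>; along space it is
  nonpositive at almost every time. So that positive part vanishes. In \<open>slope\<close>,
  \<open>z\<close> is the signed difference of the selections and \<open>l\<close> bounds the growth
  rate of the one that belongs to the barrier.\<close>

lemma comparison:
  fixes w V :: "real \<Rightarrow> real \<Rightarrow> real" and \<gamma> :: "real \<Rightarrow> real"
  assumes ab: "a < b" and t12: "t1 < t2" and d0: "0 < d0"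
    and V: "(\<lambda>(t, x). V t x) \<in> borel_measurable lborel2"
      "integrable lborel2 (\<lambda>(t, x). indicator {a..b} x * V t x)"
    and \<gamma>: "\<gamma> \<in> borel_measurable borel" "set_integrable lborel {t1..t2} \<gamma>" "\<And>s. s \<in> {t1..t2} \<Longrightarrow> l \<le> \<gamma> s"
    and good: "\<And>t. t \<in> {t1..t2} \<Longrightarrow> good_representative (w t)"
    and incr: "\<And>t. t1 < t \<Longrightarrow> t \<le> t2 \<Longrightarrow>
       AE x in lborel. w t x - w t1 x = (LINT s:{t1<..t}|lborel. V s x - \<gamma> s)"
    and bdry: "\<And>t. t \<in> {t1..t2} \<Longrightarrow> w t a \<le> - d0" "\<And>t. t \<in> {t1..t2} \<Longrightarrow> w t b \<le> - d0"
    and init: "\<And>x. x \<in> {a..b} \<Longrightarrow> w t1 x \<le> - d0"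
    and slope: "AE t in lborel. t \<in> {t1..t2} \<longrightarrow> (\<exists>z. \<forall>x y. a \<le> x \<longrightarrow> x < y \<longrightarrow> y \<le> b \<longrightarrow>
        (LINT s:{x<..y}|lborel. V t s - l) \<le> z y - z x \<and>
        \<bar>z y - z x\<bar> \<le> (LINT s:{x<..y}|lborel. \<bar>V t s\<bar> + K) \<and>
        (w t x < w t y \<longrightarrow> (\<exists>c\<in>{x..y}. 0 \<le> z c)) \<and> (w t y < w t x \<longrightarrow> (\<exists>c\<in>{x..y}. z c \<le> 0)))"
    and K: "0 \<le> K" and x: "x \<in> {a<..<b}"
  shows "w t2 x \<le> - d0 / 2"
proof -
  have w1 [measurable]: "w t1 \<in> borel_measurable borel" and w2 [measurable]: "w t2 \<in> borel_measurable borel"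
    using good t12 good_representative_borel by auto
  note [measurable] = V(1) \<gamma>(1)
  have Vt [measurable]: "V t \<in> borel_measurable borel" for t
    using measurable_compose[OF measurable_Pair1' V(1), of t] by simp
  \<comment> \<open>The hypotheses control \<open>w\<close> at each time separately.
    \<open>Y0\<close>, built from the increments, is jointly measurable; it equals \<open>w\<close>
    almost everywhere at each time and is continuous in time for almost every
    \<open>x\<close>.\<close>
  define Y0 where "Y0 t x = w t1 x + (LINT s:{t1<..t}|lborel. V s x - \<gamma> s)" for t x
  have Y0m: "(\<lambda>(t, x). Y0 t x) \<in> borel_measurable lborel2"
  proof -
    have "(\<lambda>z. w t1 (snd z) + (LINT s|lborel. of_bool (t1 < s \<and> s \<le> fst z) * (V s (snd z) - \<gamma> s))) \<in> borel_measurable lborel2"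
      by measurable
    also have "(\<lambda>z. w t1 (snd z) + (LINT s|lborel. of_bool (t1 < s \<and> s \<le> fst z) * (V s (snd z) - \<gamma> s))) = (\<lambda>(t, x). Y0 t x)"
      unfolding Y0_def set_lebesgue_integral_def
      by (auto simp: fun_eq_iff indicator_def intro!: Bochner_Integration.integral_cong)
    finally show ?thesis .
  qed
  \<comment> \<open>Raising \<open>w\<close> by \<delta> below \<open>d0\<close> leaves it negative
    on the parabolic boundary, and \<delta> above \<open>d0 / 2\<close> gives the margin in the
    conclusion. Within this range the level is chosen so that the zero set of
    \<open>w + \<delta>\<close> is null.\<close>
  obtain \<delta> where \<delta>: "d0 / 2 < \<delta>" "\<delta> < d0"
    and nz: "AE z in lborel2. fst z \<in> {t1..t2} \<longrightarrow> snd z \<in> {a..b} \<longrightarrow> Y0 (fst z) (snd z) \<noteq> - \<delta>"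
  proof -
    obtain \<delta> where "\<delta> \<in> {-d0<..<-d0/2}" "AE z in lborel2. fst z \<in> {t1..t2} \<longrightarrow> snd z \<in> {a..b} \<longrightarrow> (\<lambda>(t, x). Y0 t x) z \<noteq> \<delta>"
      using exists_null_level[OF Y0m, of "-d0" "-d0/2" t1 t2 a b] d0 by (auto simp del: greaterThanLessThan_iff atLeastAtMost_iff)
    then show ?thesis by (intro that[of "- \<delta>"]) (auto simp: split_beta)
  qed
  define Y where "Y t x = Y0 t x + \<delta>" for t x
  have Ym [measurable]: "(\<lambda>(t, x). Y t x) \<in> borel_measurable lborel2"
    using Y0m unfolding Y_def by measurable
  have Yne: "Y t x = 0 \<longleftrightarrow> Y0 t x = - \<delta>" for t x by (auto simp: Y_def)
  have nz1: "AE t in lborel. AE x in lborel. t \<in> {t1..t2} \<longrightarrow> x \<in> {a..b} \<longrightarrow> Y t x \<noteq> 0"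
    using lborel_pair.AE_pair[OF nz] by (simp add: Yne)
  have nz2: "AE x in lborel. AE t in lborel. t \<in> {t1..t2} \<longrightarrow> x \<in> {a..b} \<longrightarrow> Y t x \<noteq> 0"
    using AE_lborel2_swap[OF nz] by (simp add: Yne)
  define D where "D t x = indicator {t1..t2} t * (indicator {a..b} x * (V t x - \<gamma> t))" for t x
  have Dm [measurable]: "(\<lambda>(t, x). D t x) \<in> borel_measurable lborel2" unfolding D_def by measurable
  have Di: "integrable lborel2 (\<lambda>(t, x). D t x)"
  proof -
    have g: "integrable lborel2 (\<lambda>z. (indicator {t1..t2} (fst z) * \<gamma> (fst z)) * indicator {a..b} (snd z))"
    proof (rule lborel_pair.Fubini_integrable)
      show "integrable lborel (\<lambda>t. LINT x|lborel. norm ((indicator {t1..t2} (fst (t, x)) * \<gamma> (fst (t, x))) * indicator {a..b} (snd (t, x))))"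
        using set_integrable_abs[OF \<gamma>(2)] ab by (simp add: set_integrable_def abs_mult)
    qed (use ab in \<open>auto intro!: integrable_real_indicator\<close>)
    have v: "integrable lborel2 (\<lambda>z. (case z of (t, x) \<Rightarrow> indicator {a..b} x * V t x) * indicator {t1..t2} (fst z))"
      by (rule integrable_mult_bounded[OF V(2), of _ 1]) (auto simp: indicator_def)
    show ?thesis
      using Bochner_Integration.integrable_diff[OF v g] by (simp add: D_def split_beta' algebra_simps)
  qed
  have DEi: "integrable lborel2 (\<lambda>(t, x). of_bool (0 < Y t x) * D t x)"
  proof -
    have "integrable lborel2 (\<lambda>z. (case z of (t, x) \<Rightarrow> D t x) * of_bool (0 < (case z of (t, x) \<Rightarrow> Y t x)))"
      by (rule integrable_mult_bounded[OF Di, of _ 1]) auto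
    then show ?thesis by (simp add: split_beta' mult.commute)
  qed
  define R where "R x = (LINT t|lborel. of_bool (0 < Y t x) * D t x)" for x
  have Ri: "integrable lborel R" using lborel_pair.integrable_snd[OF DEi] by (simp add: R_def[abs_def])
  \<comment> \<open>At fixed \<open>x\<close>, along time; the initial term drops out because
    \<open>Y t1 x \<le> 0\<close>.\<close>
  have pos: "AE x in lborel. x \<in> {a..b} \<longrightarrow> max 0 (Y t2 x) \<le> R x"
    using nz2 lborel_pair.AE_integrable_snd[OF Di]
  proof eventually_elim
    case (elim x)
    show ?case
    proof
      assume x: "x \<in> {a..b}"
      have i: "set_integrable lborel {t1..t2} (\<lambda>t. V t x - \<gamma> t)"
        using elim(2) x by (simp add: set_integrable_def D_def)
      note c = set_integral_from_continuous[OF i]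
      have "max 0 (Y t2 x) - max 0 (Y t1 x) \<le> (LINT s:{t1..t2}|lborel. of_bool (0 < Y s x) * (V s x - \<gamma> s))"
      proof (rule positive_part_increment[OF t12 _ i])
        show "(\<lambda>t. V t x - \<gamma> t) \<in> borel_measurable borel" by measurable
        show "(\<lambda>t. Y t x) \<in> borel_measurable borel" by measurable
        show "continuous_on {t1..t2} (\<lambda>t. Y t x)" unfolding Y_def Y0_def by (intro continuous_intros c(1))
        show "Y t x - Y s x = (LINT r:{s<..t}|lborel. V r x - \<gamma> r)" if "t1 \<le> s" "s < t" "t \<le> t2" for s t
          using c(2)[OF that] by (simp add: Y_def Y0_def)
        show "AE s in lborel. s \<in> {t1<..<t2} \<longrightarrow> Y s x \<noteq> 0"
          using elim(1) by eventually_elim (use x in auto)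
      qed
      moreover have "Y t1 x \<le> 0" using init[OF x] \<delta> by (simp add: Y_def Y0_def set_lebesgue_integral_def)
      moreover have "(LINT s:{t1..t2}|lborel. of_bool (0 < Y s x) * (V s x - \<gamma> s)) = R x"
        unfolding R_def set_lebesgue_integral_def using x by (simp add: D_def mult_ac)
      ultimately show "max 0 (Y t2 x) \<le> R x" by simp
    qed
  qed
  \<comment> \<open>At fixed time, along space. Here \<gamma>, which is at least \<open>l\<close>,
    may be replaced by the growth rate \<open>l\<close>.\<close>
  have neg: "AE t in lborel. (LINT x|lborel. of_bool (0 < Y t x) * D t x) \<le> 0"
    using slope nz1 lborel_pair.AE_integrable_fst[OF Di]
  proof eventually_elim
    case (elim t)
    show ?case
    proof (cases "t \<in> {t1..t2}")
      case False
      then show ?thesis by (simp add: D_def)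
    next
      case t: True
      obtain z where z: "\<And>x y. a \<le> x \<Longrightarrow> x < y \<Longrightarrow> y \<le> b \<Longrightarrow>
        (LINT s:{x<..y}|lborel. V t s - l) \<le> z y - z x \<and>
        \<bar>z y - z x\<bar> \<le> (LINT s:{x<..y}|lborel. \<bar>V t s\<bar> + K) \<and>
        (w t x < w t y \<longrightarrow> (\<exists>c\<in>{x..y}. 0 \<le> z c)) \<and> (w t y < w t x \<longrightarrow> (\<exists>c\<in>{x..y}. z c \<le> 0))"
        using elim(1) t by blast
      have Yw: "AE x in lborel. Y t x = w t x + \<delta>"
      proof (cases "t = t1")
        case True
        then show ?thesis by (simp add: Y_def Y0_def set_lebesgue_integral_def)
      next
        case False
        then have "AE x in lborel. w t x - w t1 x = (LINT s:{t1<..t}|lborel. V s x - \<gamma> s)"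
          using t by (intro incr) auto
        then show ?thesis by eventually_elim (simp add: Y_def Y0_def)
      qed
      have ic: "set_integrable lborel {a..b} (\<lambda>x. c)" for c :: real
        using ab by (auto simp: set_integrable_def intro!: integrable_real_indicator)
      have iV: "set_integrable lborel {a..b} (V t)"
      proof -
        have "set_integrable lborel {a..b} (\<lambda>x. V t x - \<gamma> t)"
          using elim(3) t by (simp add: set_integrable_def D_def)
        from set_integral_add(1)[OF this ic[of "\<gamma> t"]] show ?thesis by simp
      qed
      have gw [measurable]: "w t \<in> borel_measurable borel" and gd: "good_representative (\<lambda>x. w t x + \<delta>)"
        using good[OF t] by (auto intro: good_representative_borel good_representative_add)
      have il: "set_integrable lborel {a..b} (\<lambda>x. V t x - l)" by (rule set_integral_diff(1)[OF iV ic])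
      have main: "(LINT s:{a..b}|lborel. of_bool (0 < w t s + \<delta>) * (V t s - l)) \<le> 0"
      proof (rule superlevel_integral_nonpos[OF ab _ il, of "\<lambda>s. \<bar>V t s\<bar> + K" _ z])
        show "set_integrable lborel {a..b} (\<lambda>s. \<bar>V t s\<bar> + K)"
          by (intro set_integral_add(1) ic set_integrable_abs iV)
        show "w t a + \<delta> \<le> 0" "w t b + \<delta> \<le> 0" using bdry[OF t] \<delta> by auto
        show "AE s in lborel. s \<in> {a<..<b} \<longrightarrow> w t s + \<delta> \<noteq> 0"
          using elim(2) Yw by eventually_elim (use t in auto)
      qed (use z gd K in auto)
      have "(LINT x|lborel. of_bool (0 < Y t x) * D t x) = (LINT x:{a..b}|lborel. of_bool (0 < w t x + \<delta>) * (V t x - \<gamma> t))"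
        unfolding set_lebesgue_integral_def
        by (rule integral_cong_AE) (use Yw t in \<open>auto simp: D_def elim!: AE_mp\<close>)
      also have "\<dots> \<le> (LINT s:{a..b}|lborel. of_bool (0 < w t s + \<delta>) * (V t s - l))"
        unfolding set_lebesgue_integral_def
      proof (rule integral_mono)
        have i: "integrable lborel (\<lambda>x. (indicator {a..b} x *\<^sub>R (V t x - c)) * of_bool (0 < w t x + \<delta>))" for c
          by (rule integrable_mult_bounded[OF set_integral_diff(1)[OF iV ic, unfolded set_integrable_def], of _ 1]) auto
        show "integrable lborel (\<lambda>x. indicator {a..b} x *\<^sub>R (of_bool (0 < w t x + \<delta>) * (V t x - \<gamma> t)))"
          "integrable lborel (\<lambda>x. indicator {a..b} x *\<^sub>R (of_bool (0 < w t x + \<delta>) * (V t x - l)))"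
          using i[of "\<gamma> t"] i[of l] by (simp_all add: mult_ac)
        show "indicator {a..b} x *\<^sub>R (of_bool (0 < w t x + \<delta>) * (V t x - \<gamma> t)) \<le>
          indicator {a..b} x *\<^sub>R (of_bool (0 < w t x + \<delta>) * (V t x - l))" for x
          using \<gamma>(3)[OF t] by (auto simp: indicator_def)
      qed
      also have "\<dots> \<le> 0" by (rule main)
      finally show ?thesis .
    qed
  qed
  have "(LINT x|lborel. R x) = (LINT t|lborel. LINT x|lborel. of_bool (0 < Y t x) * D t x)"
    unfolding R_def by (rule lborel_pair.Fubini_integral[OF DEi])
  also have "\<dots> \<le> 0"
    using Bochner_Integration.integral_nonneg_AE[of "\<lambda>t. - (LINT x|lborel. of_bool (0 < Y t x) * D t x)" lborel] neg
    by simp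
  finally have R0: "(LINT x|lborel. R x) \<le> 0" .
  define P where "P x = indicator {a..b} x * max 0 (Y t2 x)" for x
  have Pm [measurable]: "P \<in> borel_measurable borel" unfolding P_def by measurable
  have R_out: "R x = 0" if "x \<notin> {a..b}" for x using that by (simp add: R_def D_def)
  have PR: "AE x in lborel. P x \<le> R x"
    using pos by eventually_elim (auto simp: P_def indicator_def R_out)
  have P0: "0 \<le> P x" for x by (simp add: P_def)
  have Pi: "integrable lborel P"
    by (rule Bochner_Integration.integrable_bound[OF Ri]) (use PR P0 in \<open>auto elim!: AE_mp\<close>)
  have "(LINT x|lborel. P x) \<le> (LINT x|lborel. R x)" by (rule integral_mono_AE[OF Pi Ri PR])
  then have "(LINT x|lborel. P x) = 0"
    using R0 Bochner_Integration.integral_nonneg[of lborel P] P0 by (simp add: antisym)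
  then have "AE x in lborel. P x = 0"
    using integral_nonneg_eq_0_iff_AE[OF Pi] P0 by simp
  moreover have "AE x in lborel. w t2 x - w t1 x = (LINT s:{t1<..t2}|lborel. V s x - \<gamma> s)"
    using t12 by (intro incr) auto
  ultimately have "AE x in lborel. x \<in> {a<..<b} \<longrightarrow> w t2 x \<le> - \<delta>"
  proof eventually_elim
    case (elim x)
    show ?case
    proof
      assume "x \<in> {a<..<b}"
      then have "max 0 (Y t2 x) = 0" using elim(1) by (simp add: P_def)
      moreover have "Y t2 x = w t2 x + \<delta>" using elim(2) by (simp add: Y_def Y0_def)
      ultimately show "w t2 x \<le> - \<delta>" by linarith
    qed
  qed
  moreover have "good_representative (w t2)" using t12 by (intro good) simp
  ultimately have "w t2 x \<le> - \<delta>" using x by (intro good_representative_le_if_AE)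
  then show ?thesis using \<delta> by simp
qed

section \<open>Comparison with barriers\<close>

lemma subdifferential_mono:
  assumes "s \<in> subdifferential W p" "r \<in> subdifferential W q" "p < q"
  shows "s \<le> r"
proof -
  have "W p + s * (q - p) \<le> W q" "W q + r * (p - q) \<le> W p"
    using assms by (auto simp: subdifferential_def)
  then have "s * (q - p) \<le> r * (q - p)" by (simp add: algebra_simps)
  then show ?thesis using assms(3) by simp
qed

text \<open>A strict inequality on a closed segment persists on a slightly larger open interval;
  test functions need that room beyond the endpoints.\<close>

lemma negative_near_segment:
  fixes h :: "real \<Rightarrow> real"
  assumes h: "continuous_on {a0<..<b0} h" and xy: "a0 < x" "x \<le> y" "y < b0"
    and neg: "\<And>p. p \<in> {x..y} \<Longrightarrow> h p < 0"
  obtains s r where "a0 \<le> s" "s < x" "y < r" "r \<le> b0" "\<And>p. p \<in> {s<..<r} \<Longrightarrow> h p < 0"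
proof -
  have "open ({a0<..<b0} \<inter> h -` {..<0})" by (intro continuous_open_preimage h) auto
  moreover have "x \<in> {a0<..<b0} \<inter> h -` {..<0}" "y \<in> {a0<..<b0} \<inter> h -` {..<0}" using xy neg by auto
  ultimately obtain e1 e2 where e: "e1 > 0" "ball x e1 \<subseteq> {a0<..<b0} \<inter> h -` {..<0}"
      "e2 > 0" "ball y e2 \<subseteq> {a0<..<b0} \<inter> h -` {..<0}"
    unfolding open_contains_ball by blast
  show ?thesis
  proof (rule that[of "max a0 (x - e1)" "min b0 (y + e2)"])
    fix p assume p: "p \<in> {max a0 (x - e1)<..<min b0 (y + e2)}"
    consider "p \<in> ball x e1" | "p \<in> {x..y}" | "p \<in> ball y e2" using p by (force simp: dist_real_def)
    then show "h p < 0" using e neg by cases auto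
  qed (use e xy in auto)
qed

lemma periodic1_cong_Ints:
  fixes q :: "real \<Rightarrow> 'a"
  assumes "periodic1 q" "y - p \<in> \<int>"
  shows "q y = q p"
  using assms periodic1_int[OF assms(1), of p] by (metis Ints_cases add_diff_cancel_left' add.commute diff_add_cancel)

text \<open>\<open>q\<close> is the selection of the solution at one fixed time, \<open>om\<close>
  that of a barrier \<open>f\<close> with slope \<open>F\<close>. The interval is shorter than a
  period, so it projects injectively to an arc.\<close>

context
  fixes W u a q f F om :: "real \<Rightarrow> real" and cp cm a0 b0 :: real and \<mu> \<nu>
  assumes dec: "derivative_decomposition u a \<mu> \<nu>"
    and u: "periodic1 u" "good_representative u" "integrable torus_measure u"
    and q: "periodic1 q" "continuous_on UNIV q"
      "AE x in torus_measure. q x \<in> subdifferential W (a x)"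
      "AE x in \<mu>. q x = cp" "AE x in \<nu>. q x = - cm"
    and W: "\<And>p s. s \<in> subdifferential W p \<Longrightarrow> - cm \<le> s \<and> s \<le> cp"
    and f: "\<And>x. (f has_real_derivative F x) (at x)" "continuous_on UNIV F"
    and ab0: "b0 < a0 + 1"
    and om: "continuous_on {a0<..<b0} om" "\<And>x. x \<in> {a0<..<b0} \<Longrightarrow> om x \<in> subdifferential W (F x)"
begin

text \<open>If the slope of the solution exceeded that of the barrier, monotonicity of the
  subdifferential would give \<open>om \<le> q\<close>. The positive singular part lives where
  \<open>q = cp\<close>, an upper bound of all subgradients, and \<open>q < om \<le> cp\<close>
  excludes such points.\<close>

lemma selection_below_nonincreasing:
  assumes xy: "a0 < x" "x < y" "y < b0" and below: "\<And>c. c \<in> {x..y} \<Longrightarrow> q c < om c"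
  shows "u y - f y \<le> u x - f x"
proof -
  have "continuous_on {a0<..<b0} (\<lambda>p. q p - om p)"
    by (intro continuous_intros om continuous_on_subset[OF q(2)]) auto
  then obtain s r where sr: "a0 \<le> s" "s < x" "y < r" "r \<le> b0" "\<And>p. p \<in> {s<..<r} \<Longrightarrow> q p - om p < 0"
    by (rule negative_near_segment[of a0 b0 _ x y]) (use xy below in force)+
  show ?thesis
  proof (rule decomposition_nonincreasing[OF dec u f])
    show "r < s + 1" using sr(1,4) ab0 by linarith
    show "AE x in torus_measure. \<forall>y\<in>{s<..<r}. y - x \<in> \<int> \<longrightarrow> a x \<le> F y"
      using q(3)
    proof eventually_elim
      case (elim p)
      show ?case
      proof (intro ballI impI, rule ccontr)
        fix y assume y: "y \<in> {s<..<r}" "y - p \<in> \<int>" "\<not> a p \<le> F y"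
        then have "om y \<le> q p" using sr(1,4) om(2)[of y] by (intro subdifferential_mono[OF _ elim]) auto
        then show False using sr(5)[OF y(1)] periodic1_cong_Ints[OF q(1) y(2)] by simp
      qed
    qed
    show "AE x in \<mu>. \<forall>y\<in>{s<..<r}. y - x \<notin> \<int>"
      using q(4)
    proof eventually_elim
      case (elim p)
      show ?case
      proof (intro ballI notI)
        fix y assume y: "y \<in> {s<..<r}" "y - p \<in> \<int>"
        then show False using sr(1,4) sr(5)[OF y(1)] periodic1_cong_Ints[OF q(1) y(2)] W[OF om(2)[of y]] elim by auto
      qed
    qed
  qed (use sr xy in auto)
qed

text \<open>The mirror image: both functions change sign, the singular parts exchange roles, and the
  lower bound \<open>- cm\<close> of the subgradients takes the place of \<open>cp\<close>.\<close>

lemma selection_above_nondecreasing: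
  assumes xy: "a0 < x" "x < y" "y < b0" and above: "\<And>c. c \<in> {x..y} \<Longrightarrow> om c < q c"
  shows "u x - f x \<le> u y - f y"
proof -
  have "continuous_on {a0<..<b0} (\<lambda>p. om p - q p)"
    by (intro continuous_intros om continuous_on_subset[OF q(2)]) auto
  then obtain s r where sr: "a0 \<le> s" "s < x" "y < r" "r \<le> b0" "\<And>p. p \<in> {s<..<r} \<Longrightarrow> om p - q p < 0"
    by (rule negative_near_segment[of a0 b0 _ x y]) (use xy above in force)+
  have "- u y - - f y \<le> - u x - - f x"
  proof (rule decomposition_nonincreasing[OF derivative_decomposition_minus[OF dec]])
    show "periodic1 (\<lambda>x. - u x)" using u(1) by (simp add: periodic1_def)
    show "good_representative (\<lambda>x. - u x)" by (rule good_representative_minus[OF u(2)])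
    show "integrable torus_measure (\<lambda>x. - u x)" using u(3) by simp
    show "((\<lambda>x. - f x) has_real_derivative - F x) (at x)" for x by (rule DERIV_minus[OF f(1)])
    show "continuous_on UNIV (\<lambda>x. - F x)" by (rule continuous_on_minus[OF f(2)])
    show "r < s + 1" using sr(1,4) ab0 by linarith
    show "AE x in torus_measure. \<forall>y\<in>{s<..<r}. y - x \<in> \<int> \<longrightarrow> - a x \<le> - F y"
      using q(3)
    proof eventually_elim
      case (elim p)
      show ?case
      proof (intro ballI impI, rule ccontr)
        fix y assume y: "y \<in> {s<..<r}" "y - p \<in> \<int>" "\<not> - a p \<le> - F y"
        then have "q p \<le> om y" using sr(1,4) om(2)[of y] by (intro subdifferential_mono[OF elim]) auto
        then show False using sr(5)[OF y(1)] periodic1_cong_Ints[OF q(1) y(2)] by simp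
      qed
    qed
    show "AE x in \<nu>. \<forall>y\<in>{s<..<r}. y - x \<notin> \<int>"
      using q(5)
    proof eventually_elim
      case (elim p)
      show ?case
      proof (intro ballI notI)
        fix y assume y: "y \<in> {s<..<r}" "y - p \<in> \<int>"
        then show False using sr(1,4) sr(5)[OF y(1)] periodic1_cong_Ints[OF q(1) y(2)] W[OF om(2)[of y]] elim by auto
      qed
    qed
  qed (use sr xy in auto)
  then show ?thesis by simp
qed

end

text \<open>The sign \<open>\<sigma>\<close> selects between barriers from above (\<open>\<sigma> = 1\<close>) and from below (\<open>\<sigma> = -1\<close>).\<close>

lemma barrier_comparison:
  fixes \<sigma> :: real
  assumes en: "energy_solution W cp cm T u" and cont: "L2_continuous T u"
    and good: "\<forall>t\<in>{0<..<T}. good_representative (u t)"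
    and W: "\<And>p s. s \<in> subdifferential W p \<Longrightarrow> - cm \<le> s \<and> s \<le> cp"
    and \<sigma>: "\<sigma> = 1 \<or> \<sigma> = -1"
    and f: "\<And>x. (f has_real_derivative F x) (at x)" "continuous_on UNIV F"
    and om: "\<And>x. x \<in> {a0<..<b0} \<Longrightarrow> om x \<in> subdifferential W (F x)"
      "\<And>x y. a0 < x \<Longrightarrow> x < y \<Longrightarrow> y < b0 \<Longrightarrow> \<bar>om y - om x\<bar> \<le> K * (y - x)"
      "\<And>x y. a0 < x \<Longrightarrow> x < y \<Longrightarrow> y < b0 \<Longrightarrow> \<sigma> * (om y - om x) \<le> l * (y - x)"
    and ab: "a0 < a" "a < b" "b < b0" "b0 < a0 + 1" and K: "0 \<le> K"
    and t: "0 < t1" "t1 < t2" "t2 < T"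
    and g: "\<And>s. s \<in> {t1..t2} \<Longrightarrow> (g has_real_derivative g' s) (at s)" "continuous_on {t1..t2} g'"
      "\<And>s. s \<in> {t1..t2} \<Longrightarrow> l \<le> \<sigma> * g' s"
    and d0: "0 < d0"
    and bdry: "\<And>t. t \<in> {t1..t2} \<Longrightarrow> \<sigma> * (u t a - f a - g t) \<le> - d0"
      "\<And>t. t \<in> {t1..t2} \<Longrightarrow> \<sigma> * (u t b - f b - g t) \<le> - d0"
    and init: "\<And>x. x \<in> {a..b} \<Longrightarrow> \<sigma> * (u t1 x - f x - g t1) \<le> - d0"
    and x: "x \<in> {a<..<b}"
  shows "\<sigma> * (u t2 x - f x - g t2) \<le> - d0 / 2"
proof -
  obtain V :: "real \<Rightarrow> real \<Rightarrow> real" where V: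
    "(\<lambda>(t, x). V t x) \<in> borel_measurable lborel2"
    "\<And>c. integrable lborel2 (\<lambda>(t, x). indicator {c..<c+1} x * V t x)"
    "\<And>t1 t2. 0 < t1 \<Longrightarrow> t1 < t2 \<Longrightarrow> t2 < T \<Longrightarrow>
       AE x in lborel. u t2 x - u t1 x = (LINT t:{t1<..t2}|lborel. V t x)"
    "AE t in lborel. t \<in> {0<..<T} \<longrightarrow> continuous_selection W cp cm (u t) (V t)"
    using energy_solution_data[OF en cont good] by blast
  note [measurable] = V(1)
  have \<sigma>2: "\<sigma> * \<sigma> = 1" "\<bar>\<sigma>\<bar> = 1" using \<sigma> by auto
  define w where "w t x = \<sigma> * (u t x - f x - g t)" for t x
  \<comment> \<open>Cut off outside the time interval, since \<open>g'\<close> is controlled only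
    there.\<close>
  define \<gamma> where "\<gamma> s = \<sigma> * (indicator {t1..t2} s * g' s)" for s
  have g'm: "(\<lambda>s. indicator {t1..t2} s *\<^sub>R g' s) \<in> borel_measurable borel"
    using g(2) by (intro borel_measurable_continuous_on_indicator) auto
  have g'i: "set_integrable lborel {t1..t2} g'"
    using borel_integrable_atLeastAtMost'[OF g(2)] .
  have \<gamma>m [measurable]: "\<gamma> \<in> borel_measurable borel" using g'm unfolding \<gamma>_def by simp
  have \<gamma>i: "set_integrable lborel {t1..t2} \<gamma>"
  proof -
    have "(\<lambda>s. indicator {t1..t2} s *\<^sub>R \<gamma> s) = (\<lambda>s. \<sigma> * (indicator {t1..t2} s *\<^sub>R g' s))"
      by (auto simp: \<gamma>_def indicator_def fun_eq_iff)
    then show ?thesis using g'i unfolding set_integrable_def by simp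
  qed
  have cf: "continuous_on UNIV f" using f(1) by (meson DERIV_isCont continuous_at_imp_continuous_on)
  have com: "continuous_on {a0<..<b0} om"
  proof -
    have "K-lipschitz_on {a0<..<b0} om"
    proof (rule lipschitz_onI[OF _ K])
      fix x y assume "x \<in> {a0<..<b0}" "y \<in> {a0<..<b0}"
      then show "dist (om x) (om y) \<le> K * dist x y"
        using om(2)[of x y] om(2)[of y x] by (cases x y rule: linorder_cases) (auto simp: dist_real_def abs_minus_commute)
    qed
    then show ?thesis by (rule lipschitz_on_continuous_on)
  qed
  have w2: "w t2 x \<le> - d0 / 2"
  proof (rule comparison[OF ab(2) t(2) d0, of "\<lambda>t x. \<sigma> * V t x" \<gamma> l w K])
    show "(\<lambda>(t, x). \<sigma> * V t x) \<in> borel_measurable lborel2" by measurable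
    show "integrable lborel2 (\<lambda>(t, x). indicator {a..b} x * (\<sigma> * V t x))"
    proof -
      have "integrable lborel2 (\<lambda>z. (case z of (t, x) \<Rightarrow> indicator {a..<a+1} x * V t x) * (\<sigma> * indicator {a..b} (snd z)))"
        using \<sigma>2 by (intro integrable_mult_bounded[OF V(2), of _ 1]) (auto simp: indicator_def abs_mult)
      moreover have "(\<lambda>z. (case z of (t, x) \<Rightarrow> indicator {a..<a+1} x * V t x) * (\<sigma> * indicator {a..b} (snd z)))
         = (\<lambda>(t, x). indicator {a..b} x * (\<sigma> * V t x))"
        using ab by (auto simp: fun_eq_iff indicator_def)
      ultimately show ?thesis by simp
    qed
    show "l \<le> \<gamma> s" if "s \<in> {t1..t2}" for s using g(3)[OF that] that by (simp add: \<gamma>_def)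
    show "good_representative (w s)" if "s \<in> {t1..t2}" for s
    proof -
      have gu: "good_representative (u s)" using good that t by auto
      have "good_representative (\<lambda>x. u s x + (- f x - g s))"
        by (intro good_representative_add gu continuous_intros cf)
      moreover from this have "good_representative (\<lambda>x. - (u s x + (- f x - g s)))" by (rule good_representative_minus)
      ultimately show ?thesis using \<sigma> by (auto simp: w_def[abs_def] algebra_simps)
    qed
    show "AE x in lborel. w t x - w t1 x = (LINT s:{t1<..t}|lborel. \<sigma> * V s x - \<gamma> s)" if t': "t1 < t" "t \<le> t2" for t
    proof -
      \<comment> \<open>\<open>V\<close> is integrable on one unit cell in \<open>x\<close> at a
        time; countably many cells cover the line, and the floor of \<open>x\<close> selects the
        right one.\<close>
      have "AE x in lborel. \<forall>k::int. integrable lborel (\<lambda>t. indicator {of_int k..<of_int k+1} x * V t x)"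
        using lborel_pair.AE_integrable_snd[OF V(2)] by (intro AE_all_countable[THEN iffD2] allI)
      moreover have "AE x in lborel. u t x - u t1 x = (LINT s:{t1<..t}|lborel. V s x)"
        by (rule V(3)) (use t t' in auto)
      ultimately show ?thesis
      proof eventually_elim
        case (elim x)
        have "indicator {of_int \<lfloor>x\<rfloor>..<of_int \<lfloor>x\<rfloor>+1} x = (1::real)"
          using floor_correct[of x] by (simp add: indicator_def)
        then have "integrable lborel (\<lambda>t. V t x)" using elim(1)[rule_format, of "\<lfloor>x\<rfloor>"] by simp
        then have iV: "set_integrable lborel {t1<..t} (\<lambda>s. \<sigma> * V s x)"
          unfolding set_integrable_def by (intro integrable_mult_indicator integrable_mult_right) auto
        have i\<gamma>: "set_integrable lborel {t1<..t} \<gamma>"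
          by (rule set_integrable_subset[OF \<gamma>i]) (use t' in auto)
        have "(LINT s:{t1<..t}|lborel. \<gamma> s) = \<sigma> * (g t - g t1)"
        proof -
          have "(LINT s:{t1<..t}|lborel. \<gamma> s) = integral {t1<..t} \<gamma>"
            by (rule set_borel_integral_eq_integral(2)[OF i\<gamma>])
          also have "\<dots> = integral {t1..t} \<gamma>"
            by (rule integral_subset_negligible) (auto intro: negligible_subset[of "{t1}"])
          also have "\<dots> = integral {t1..t} (\<lambda>s. \<sigma> * g' s)"
            by (rule integral_cong) (use t' in \<open>auto simp: \<gamma>_def\<close>)
          also have "\<dots> = \<sigma> * g t - \<sigma> * g t1"
          proof (rule integral_unique, rule fundamental_theorem_of_calculus)
            fix s assume "s \<in> {t1..t}"
            then have "((\<lambda>s. \<sigma> * g s) has_real_derivative \<sigma> * g' s) (at s)"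
              using t' by (intro DERIV_cmult g(1)) auto
            then show "((\<lambda>s. \<sigma> * g s) has_vector_derivative \<sigma> * g' s) (at s within {t1..t})"
              by (simp add: has_real_derivative_iff_has_vector_derivative has_vector_derivative_at_within)
          qed (use t' in simp)
          finally show ?thesis by (simp add: algebra_simps)
        qed
        then have "(LINT s:{t1<..t}|lborel. \<sigma> * V s x - \<gamma> s) = \<sigma> * (u t x - u t1 x) - \<sigma> * (g t - g t1)"
          using set_integral_diff(2)[OF iV i\<gamma>] elim(2) by simp
        then show ?case by (simp add: w_def algebra_simps)
      qed
    qed
    show "w t a \<le> - d0" "w t b \<le> - d0" if "t \<in> {t1..t2}" for t using bdry that by (auto simp: w_def)
    show "w t1 x \<le> - d0" if "x \<in> {a..b}" for x using init that by (auto simp: w_def)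
    show "AE t in lborel. t \<in> {t1..t2} \<longrightarrow> (\<exists>z. \<forall>x y. a \<le> x \<longrightarrow> x < y \<longrightarrow> y \<le> b \<longrightarrow>
        (LINT s:{x<..y}|lborel. \<sigma> * V t s - l) \<le> z y - z x \<and>
        \<bar>z y - z x\<bar> \<le> (LINT s:{x<..y}|lborel. \<bar>\<sigma> * V t s\<bar> + K) \<and>
        (w t x < w t y \<longrightarrow> (\<exists>c\<in>{x..y}. 0 \<le> z c)) \<and> (w t y < w t x \<longrightarrow> (\<exists>c\<in>{x..y}. z c \<le> 0)))"
      using V(4) lborel_pair.AE_integrable_fst[OF V(2)[of a0]]
    proof eventually_elim
      case (elim t)
      show ?case
      proof
        assume "t \<in> {t1..t2}"
        then have tT: "t \<in> {0<..<T}" using t by auto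
        obtain A \<mu> \<nu> q where q: "derivative_decomposition (u t) A \<mu> \<nu>"
          "periodic1 q" "continuous_on UNIV q" "AE x in torus_measure. q x \<in> subdifferential W (A x)"
          "AE x in \<mu>. q x = cp" "AE x in \<nu>. q x = - cm"
          "\<And>x y. x < y \<Longrightarrow> y < x + 1 \<Longrightarrow> q y - q x = (LINT s:{x<..y}|lborel. V t s)"
          using elim(1) tT unfolding continuous_selection_def by blast
        have L: "L2_torus (u t)" using cont tT by (simp add: L2_continuous_def)
        have ut: "periodic1 (u t)" "good_representative (u t)" "integrable torus_measure (u t)"
          using L good tT L2_torus_integrable by (auto simp: L2_torus_def)
        have below: "u t y - f y \<le> u t x - f x"
          if "a0 < x" "x < y" "y < b0" "\<And>c. c \<in> {x..y} \<Longrightarrow> q c < om c" for x y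
          by (rule selection_below_nonincreasing[OF q(1) ut q(2-6) _ f ab(4) com]) (fact W om(1) that)+
        have above: "u t x - f x \<le> u t y - f y"
          if "a0 < x" "x < y" "y < b0" "\<And>c. c \<in> {x..y} \<Longrightarrow> om c < q c" for x y
          by (rule selection_above_nondecreasing[OF q(1) ut q(2-6) _ f ab(4) com]) (fact W om(1) that)+
        have iV: "set_integrable lborel {x<..y} (V t)" if "a \<le> x" "y \<le> b" for x y
        proof -
          have "set_integrable lborel {a0..<a0+1} (V t)" using elim(2) by (simp add: set_integrable_def)
          then show ?thesis by (rule set_integrable_subset) (use that ab in auto)
        qed
        have ic: "set_integrable lborel {x<..y} (\<lambda>s. c)" if "x < y" for x y c :: real
          using that by (auto simp: set_integrable_def intro!: integrable_real_indicator)
        have Ic: "(LINT s:{x<..y}|lborel. c) = c * (y - x)" if "x < y" for x y c :: real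
          using that by (simp add: set_lebesgue_integral_def)
        \<comment> \<open>Its increments are those of the solution's selection minus those of the
          barrier's, signed by \<sigma>; the latter grow at most at rate \<open>l\<close>, whence
          the first inequality.\<close>
        define z where "z x = \<sigma> * (q x - om x)" for x
        show "\<exists>z. \<forall>x y. a \<le> x \<longrightarrow> x < y \<longrightarrow> y \<le> b \<longrightarrow>
          (LINT s:{x<..y}|lborel. \<sigma> * V t s - l) \<le> z y - z x \<and>
          \<bar>z y - z x\<bar> \<le> (LINT s:{x<..y}|lborel. \<bar>\<sigma> * V t s\<bar> + K) \<and>
          (w t x < w t y \<longrightarrow> (\<exists>c\<in>{x..y}. 0 \<le> z c)) \<and> (w t y < w t x \<longrightarrow> (\<exists>c\<in>{x..y}. z c \<le> 0))"
        proof (intro exI[of _ z] allI impI conjI)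
          fix x y assume xy: "a \<le> x" "x < y" "y \<le> b"
          have qd: "q y - q x = (LINT s:{x<..y}|lborel. V t s)" by (rule q(7)) (use xy ab in auto)
          have zd: "z y - z x = \<sigma> * (q y - q x) - \<sigma> * (om y - om x)" by (simp add: z_def algebra_simps)
          have o: "\<bar>om y - om x\<bar> \<le> K * (y - x)" "\<sigma> * (om y - om x) \<le> l * (y - x)"
            using om(2,3)[of x y] xy ab by auto
          have "(LINT s:{x<..y}|lborel. \<sigma> * V t s - l) = \<sigma> * (q y - q x) - l * (y - x)"
            using set_integral_diff(2)[OF set_integrable_mult_right ic, of \<sigma> x y "V t" l] iV[OF xy(1,3)] xy(2)
            by (simp add: qd Ic)
          then show "(LINT s:{x<..y}|lborel. \<sigma> * V t s - l) \<le> z y - z x" using zd o by simp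
          have "(LINT s:{x<..y}|lborel. \<bar>V t s\<bar> + K) = (LINT s:{x<..y}|lborel. \<bar>V t s\<bar>) + K * (y - x)"
            using set_integral_add(2)[OF set_integrable_abs[OF iV[OF xy(1,3)]] ic[OF xy(2)], of K] by (simp add: Ic xy)
          moreover have "\<bar>q y - q x\<bar> \<le> (LINT s:{x<..y}|lborel. \<bar>V t s\<bar>)"
            unfolding qd set_lebesgue_integral_def
            using integral_abs_bound[of lborel "\<lambda>s. indicator {x<..y} s *\<^sub>R V t s"] by (simp add: abs_mult)
          moreover have "\<bar>z y - z x\<bar> \<le> \<bar>q y - q x\<bar> + \<bar>om y - om x\<bar>"
            unfolding zd using \<sigma> by auto
          ultimately show "\<bar>z y - z x\<bar> \<le> (LINT s:{x<..y}|lborel. \<bar>\<sigma> * V t s\<bar> + K)"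
            using o(1) \<sigma>2 by (simp add: abs_mult)
          have r: "a0 < x" "y < b0" using xy ab by auto
          \<comment> \<open>If \<open>z\<close> were negative throughout, \<open>q\<close> would lie
            below \<open>om\<close> for \<sigma> = 1 and above it for \<sigma> = -1; in either case
            \<open>w\<close> could not increase.\<close>
          show "\<exists>c\<in>{x..y}. 0 \<le> z c" if "w t x < w t y"
          proof (rule ccontr)
            assume no: "\<not> ?thesis"
            have zc: "z c < 0" if "c \<in> {x..y}" for c using no that by (meson not_le)
            from \<sigma> show False
            proof
              assume s1: "\<sigma> = 1"
              have "q c < om c" if "c \<in> {x..y}" for c using zc[OF that] s1 by (simp add: z_def)
              then have "u t y - f y \<le> u t x - f x" by (intro below r xy(2))
              then show False using \<open>w t _ < w t _\<close> s1 by (simp add: w_def)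
            next
              assume s1: "\<sigma> = - 1"
              have "om c < q c" if "c \<in> {x..y}" for c using zc[OF that] s1 by (simp add: z_def)
              then have "u t x - f x \<le> u t y - f y" by (intro above r xy(2))
              then show False using \<open>w t _ < w t _\<close> s1 by (simp add: w_def)
            qed
          qed
          show "\<exists>c\<in>{x..y}. z c \<le> 0" if "w t y < w t x"
          proof (rule ccontr)
            assume no: "\<not> ?thesis"
            have zc: "0 < z c" if "c \<in> {x..y}" for c using no that by (meson not_le)
            from \<sigma> show False
            proof
              assume s1: "\<sigma> = 1"
              have "om c < q c" if "c \<in> {x..y}" for c using zc[OF that] s1 by (simp add: z_def)
              then have "u t x - f x \<le> u t y - f y" by (intro above r xy(2))
              then show False using \<open>w t _ < w t _\<close> s1 by (simp add: w_def)
            next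
              assume s1: "\<sigma> = - 1"
              have "q c < om c" if "c \<in> {x..y}" for c using zc[OF that] s1 by (simp add: z_def)
              then have "u t y - f y \<le> u t x - f x" by (intro below r xy(2))
              then show False using \<open>w t _ < w t _\<close> s1 by (simp add: w_def)
            qed
          qed
        qed
      qed
    qed
  qed (use K x \<gamma>i in auto)
  then show ?thesis by (simp add: w_def)
qed

section \<open>The energy density and the nonlocal curvature\<close>

text \<open>The case \<open>A = B\<close> is allowed and means that the derivative does not jump at
  \<open>p\<close>. Carrying the inclusion into the subdifferential along makes the notion stable
  under sums.\<close>

definition kink :: "(real \<Rightarrow> real) \<Rightarrow> real \<Rightarrow> real \<Rightarrow> real \<Rightarrow> real \<Rightarrow> bool" where
  "kink W p A B e \<longleftrightarrow> 0 < e \<and> A \<le> B \<and> {A..B} \<subseteq> subdifferential W p \<and>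
     (\<forall>q. p - e < q \<longrightarrow> q \<le> p \<longrightarrow> W q = W p + A * (q - p)) \<and>
     (\<forall>q. p \<le> q \<longrightarrow> q < p + e \<longrightarrow> W q = W p + B * (q - p))"

text \<open>One summand of the energy; \<open>d\<close> is 1 for the positive parts and -1 for the
  negative ones. The radius is the distance from \<open>p\<close> to the corner, and arbitrary at
  the corner itself.\<close>

lemma kink_affine_part:
  fixes c d b p :: real
  assumes "0 \<le> c" and d: "d = 1 \<or> d = -1"
  shows "\<exists>A B e. kink (\<lambda>q. c * max 0 (d * (q + b))) p A B e"
proof -
  consider "d * (p + b) > 0" | "d * (p + b) < 0" | "p + b = 0" using d by force
  then show ?thesis
  proof cases
    case 1
    have g: "c * max 0 (d * (p + b)) + (c * d) * (q - p) \<le> c * max 0 (d * (q + b))" for q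
    proof -
      have "max 0 (d * (p + b)) + d * (q - p) \<le> max 0 (d * (q + b))" using 1 by (simp add: max_def algebra_simps)
      from mult_left_mono[OF this assms(1)] show ?thesis by (simp add: algebra_simps)
    qed
    have l: "c * max 0 (d * (q + b)) = c * max 0 (d * (p + b)) + (c * d) * (q - p)" if "\<bar>q - p\<bar> < d * (p + b)" for q
    proof -
      have "0 < d * (q + b)" using that 1 d by auto
      then show ?thesis using 1 by (simp add: max_def algebra_simps)
    qed
    show ?thesis
      by (rule exI[of _ "c * d"], rule exI[of _ "c * d"], rule exI[of _ "d * (p + b)"])
         (use 1 g l in \<open>auto simp: kink_def subdifferential_def\<close>)
  next
    case 2
    have l: "c * max 0 (d * (q + b)) = 0" if "\<bar>q - p\<bar> < - (d * (p + b))" for q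
    proof -
      have "d * (q + b) < 0" using that 2 d by auto
      then show ?thesis by simp
    qed
    show ?thesis
      by (rule exI[of _ 0], rule exI[of _ 0], rule exI[of _ "- (d * (p + b))"])
         (use 2 l assms in \<open>auto simp: kink_def subdifferential_def\<close>)
  next
    case 3
    then have b: "b = - p" by simp
    have s: "s * y \<le> c * max 0 (d * y)" if "min 0 (c * d) \<le> s" "s \<le> max 0 (c * d)" for s y
    proof (cases "0 \<le> y")
      case True
      have "s * y \<le> max 0 (c * d) * y" using that True by (intro mult_right_mono) auto
      also have "\<dots> \<le> c * max 0 (d * y)" using assms True d by auto
      finally show ?thesis .
    next
      case False
      have "s * y \<le> min 0 (c * d) * y" using that False by (intro mult_right_mono_neg) auto
      also have "\<dots> \<le> c * max 0 (d * y)" using assms False d by auto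
      finally show ?thesis .
    qed
    have "{min 0 (c * d)..max 0 (c * d)} \<subseteq> subdifferential (\<lambda>q. c * max 0 (d * (q + b))) p"
    proof
      fix x assume x: "x \<in> {min 0 (c * d)..max 0 (c * d)}"
      show "x \<in> subdifferential (\<lambda>q. c * max 0 (d * (q + b))) p"
        unfolding subdifferential_def mem_Collect_eq b
      proof
        fix q
        have "x * (q + - p) \<le> c * max 0 (d * (q + - p))" using x by (intro s) auto
        then show "c * max 0 (d * (p + - p)) + x * (q - p) \<le> c * max 0 (d * (q + - p))" by simp
      qed
    qed
    moreover have "c * max 0 (d * (q + b)) = min 0 (c * d) * (q - p)" if "q \<le> p" for q
      using assms(1) d that unfolding b by (auto simp: max_def min_def algebra_simps)
    moreover have "c * max 0 (d * (q + b)) = max 0 (c * d) * (q - p)" if "p \<le> q" for q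
      using assms(1) d that unfolding b by (auto simp: max_def min_def algebra_simps)
    ultimately have "kink (\<lambda>q. c * max 0 (d * (q + b))) p (min 0 (c * d)) (max 0 (c * d)) 1"
      unfolding kink_def using b by simp
    then show ?thesis by blast
  qed
qed

lemma kink_add:
  assumes "kink U p A1 B1 e1" "kink V p A2 B2 e2"
  shows "kink (\<lambda>q. U q + V q) p (A1 + A2) (B1 + B2) (min e1 e2)"
proof -
  have AB: "A1 \<le> B1" "A2 \<le> B2" and sub: "{A1..B1} \<subseteq> subdifferential U p" "{A2..B2} \<subseteq> subdifferential V p"
    using assms unfolding kink_def by blast+
  have "{A1 + A2..B1 + B2} \<subseteq> subdifferential (\<lambda>q. U q + V q) p"
  proof
    fix s assume s: "s \<in> {A1 + A2..B1 + B2}"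
    \<comment> \<open>Splits \<open>s\<close> into \<open>r\<close> and \<open>s - r\<close>,
      admissible for \<open>U\<close> and for \<open>V\<close>: the smallest value that is at least
      \<open>A1\<close> and leaves at most \<open>B2\<close> for the second summand.\<close>
    define r where "r = max A1 (s - B2)"
    have "r \<in> {A1..B1}" "s - r \<in> {A2..B2}" using s AB by (auto simp: r_def max_def)
    then have "r \<in> subdifferential U p" "s - r \<in> subdifferential V p" using sub by auto
    then have *: "U p + r * (q - p) \<le> U q" "V p + (s - r) * (q - p) \<le> V q" for q by (auto simp: subdifferential_def)
    show "s \<in> subdifferential (\<lambda>q. U q + V q) p"
      unfolding subdifferential_def mem_Collect_eq
    proof
      fix q
      show "U p + V p + s * (q - p) \<le> U q + V q" using *(1)[of q] *(2)[of q] by (simp add: algebra_simps)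
    qed
  qed
  moreover have "U q + V q = U p + V p + (A1 + A2) * (q - p)" if "p - min e1 e2 < q" "q \<le> p" for q
  proof -
    have "p - e1 < q" "p - e2 < q" using that by auto
    then have "U q = U p + A1 * (q - p)" "V q = V p + A2 * (q - p)"
      using assms that(2) unfolding kink_def by blast+
    then show ?thesis by (simp add: algebra_simps)
  qed
  moreover have "U q + V q = U p + V p + (B1 + B2) * (q - p)" if "p \<le> q" "q < p + min e1 e2" for q
  proof -
    have "q < p + e1" "q < p + e2" using that by auto
    then have "U q = U p + B1 * (q - p)" "V q = V p + B2 * (q - p)"
      using assms that(1) unfolding kink_def by blast+
    then show ?thesis by (simp add: algebra_simps)
  qed
  moreover have "0 < e1" "0 < e2" using assms unfolding kink_def by blast+
  then have "0 < min e1 e2" by simp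
  moreover have "A1 + A2 \<le> B1 + B2" using AB by simp
  ultimately show ?thesis unfolding kink_def by blast
qed

lemma kink_sum:
  assumes "finite I" "\<And>i. i \<in> I \<Longrightarrow> \<exists>A B e. kink (U i) p A B e"
  shows "\<exists>A B e. kink (\<lambda>q. \<Sum>i\<in>I. U i q) p A B e"
  using assms
proof (induction I rule: finite_induct)
  case empty
  have "kink (\<lambda>q. 0) p 0 0 1" by (auto simp: kink_def subdifferential_def)
  then show ?case by auto
next
  case (insert i I)
  obtain A1 B1 e1 where 1: "kink (U i) p A1 B1 e1" using insert.prems by blast
  obtain A2 B2 e2 where 2: "kink (\<lambda>q. \<Sum>i\<in>I. U i q) p A2 B2 e2" using insert by blast
  show ?case using kink_add[OF 1 2] insert.hyps by auto
qed

lemma energy_density_kink: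
  assumes "\<forall>j\<in>{1..Np}. \<alpha>p j > 0" "\<forall>j\<in>{1..Nm}. \<alpha>m j > 0"
  shows "\<exists>A B e. kink (energy_density Np \<alpha>p \<beta>p Nm \<alpha>m \<beta>m) p A B e"
proof -
  have "\<exists>A B e. kink (\<lambda>q. \<Sum>j=1..Np. \<alpha>p j * max 0 (1 * (q + \<beta>p j))) p A B e"
    by (intro kink_sum kink_affine_part) (use assms in \<open>auto intro: less_imp_le\<close>)
  moreover have "\<exists>A B e. kink (\<lambda>q. \<Sum>j=1..Nm. \<alpha>m j * max 0 (-1 * (q + \<beta>m j))) p A B e"
    by (intro kink_sum kink_affine_part) (use assms in \<open>auto intro: less_imp_le\<close>)
  ultimately show ?thesis
    unfolding energy_density_def[abs_def] using kink_add by fastforce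
qed

text \<open>It is enough to test the subgradient inequality at \<open>p + 1\<close> and
  \<open>p - 1\<close>, because a unit step raises each truncated linear term by at most its
  coefficient, and only the terms of one kind.\<close>

lemma energy_density_subdifferential_bounds:
  assumes "\<forall>j\<in>{1..Np}. \<alpha>p j > 0" "\<forall>j\<in>{1..Nm}. \<alpha>m j > 0"
    and s: "s \<in> subdifferential (energy_density Np \<alpha>p \<beta>p Nm \<alpha>m \<beta>m) p"
  shows "- (\<Sum>j=1..Nm. \<alpha>m j) \<le> s \<and> s \<le> (\<Sum>j=1..Np. \<alpha>p j)"
proof -
  let ?W = "energy_density Np \<alpha>p \<beta>p Nm \<alpha>m \<beta>m"
  have le: "c * max 0 x \<le> c * max 0 y + c * 1" if "0 < c" "x \<le> y + 1" for c x y :: real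
    unfolding distrib_left[symmetric] using that by (intro mult_left_mono) auto
  have le': "c * max 0 x \<le> c * max 0 y" if "0 < c" "x \<le> y" for c x y :: real
    using that by (intro mult_left_mono) auto
  have "?W (p + 1) \<le> ?W p + (\<Sum>j=1..Np. \<alpha>p j)"
  proof -
    have "(\<Sum>j=1..Np. \<alpha>p j * max 0 (p + 1 + \<beta>p j)) \<le> (\<Sum>j=1..Np. \<alpha>p j * max 0 (p + \<beta>p j) + \<alpha>p j * 1)"
      using assms(1) by (intro sum_mono le) auto
    moreover have "(\<Sum>j=1..Nm. \<alpha>m j * max 0 (- (p + 1 + \<beta>m j))) \<le> (\<Sum>j=1..Nm. \<alpha>m j * max 0 (- (p + \<beta>m j)))"
      using assms(2) by (intro sum_mono le') auto
    ultimately show ?thesis by (simp add: energy_density_def sum.distrib)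
  qed
  moreover have "?W (p - 1) \<le> ?W p + (\<Sum>j=1..Nm. \<alpha>m j)"
  proof -
    have "(\<Sum>j=1..Nm. \<alpha>m j * max 0 (- (p - 1 + \<beta>m j))) \<le> (\<Sum>j=1..Nm. \<alpha>m j * max 0 (- (p + \<beta>m j)) + \<alpha>m j * 1)"
      using assms(2) by (intro sum_mono le) auto
    moreover have "(\<Sum>j=1..Np. \<alpha>p j * max 0 (p - 1 + \<beta>p j)) \<le> (\<Sum>j=1..Np. \<alpha>p j * max 0 (p + \<beta>p j))"
      using assms(1) by (intro sum_mono le') auto
    ultimately show ?thesis by (simp add: energy_density_def sum.distrib)
  qed
  moreover have "?W p + s * (p + 1 - p) \<le> ?W (p + 1)" "?W p + s * (p - 1 - p) \<le> ?W (p - 1)"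
    using s unfolding subdifferential_def mem_Collect_eq by blast+
  ultimately show ?thesis by simp
qed

text \<open>The kink at \<open>q\<close> has its own left slope \<open>A'\<close>, which is a
  subgradient there. On a short stretch to the left of \<open>q\<close> the affine formula around
  \<open>p\<close> holds as well, so the two slopes agree.\<close>

lemma kink_subdifferential_near:
  assumes k: "kink W p A B e" and all: "\<And>q. \<exists>A B e. kink W q A B e"
  shows "p < q \<Longrightarrow> q < p + e \<Longrightarrow> B \<in> subdifferential W q"
    and "p - e < q \<Longrightarrow> q < p \<Longrightarrow> A \<in> subdifferential W q"
proof -
  obtain A' B' e' where k': "kink W q A' B' e'" using all by blast
  have "A' \<le> B'" "{A'..B'} \<subseteq> subdifferential W q" and e': "0 < e'" using k' unfolding kink_def by blast+
  then have sub: "A' \<in> subdifferential W q" by auto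
  have L': "W r = W q + A' * (r - q)" if "q - e' < r" "r \<le> q" for r using k' that unfolding kink_def by blast
  have L: "W r = W p + A * (r - p)" if "p - e < r" "r \<le> p" for r using k that unfolding kink_def by blast
  have R: "W r = W p + B * (r - p)" if "p \<le> r" "r < p + e" for r using k that unfolding kink_def by blast
  {
    assume q: "p < q" "q < p + e"
    define h where "h = min e' (q - p) / 2"
    have h: "0 < h" "h < e'" "h < q - p" using e' q by (auto simp: h_def min_def)
    have "W (q - h) = W q + A' * (- h)" using L'[of "q - h"] h by simp
    moreover have "W (q - h) = W p + B * (q - h - p)" "W q = W p + B * (q - p)"
      using q h by (intro R; linarith)+
    ultimately have "A' * h = B * h" by (simp add: algebra_simps)
    then show "B \<in> subdifferential W q" using sub h by simp
  next
    assume q: "p - e < q" "q < p"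
    define h where "h = min e' (q - (p - e)) / 2"
    have h: "0 < h" "h < e'" "h < q - (p - e)" using e' q by (auto simp: h_def min_def)
    have "W (q - h) = W q + A' * (- h)" using L'[of "q - h"] h by simp
    moreover have "W (q - h) = W p + A * (q - h - p)" "W q = W p + A * (q - p)"
      using q h by (intro L; linarith)+
    ultimately have "A' * h = A * h" by (simp add: algebra_simps)
    then show "A \<in> subdifferential W q" using sub h by simp
  }
qed

lemma kink_deriv_jump:
  assumes k: "kink W p A B e"
  shows "deriv_jump W p = B - A"
proof -
  have e: "0 < e" using k unfolding kink_def by blast
  have L: "W r = W p + A * (r - p)" if "p - e < r" "r \<le> p" for r using k that unfolding kink_def by blast
  have R: "W r = W p + B * (r - p)" if "p \<le> r" "r < p + e" for r using k that unfolding kink_def by blast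
  have d: "((\<lambda>q. W p + C * (q - p)) has_vector_derivative C) (at p within S)" for C S
    by (auto intro!: derivative_eq_intros simp flip: has_real_derivative_iff_has_vector_derivative)
  have "(W has_vector_derivative B) (at p within {p..})"
    by (rule has_vector_derivative_transform_within[OF d e]) (auto intro!: R[symmetric] simp: dist_real_def)
  then have "(W has_vector_derivative B) (at_right p)"
    by (rule has_vector_derivative_within_subset) auto
  then have "right_deriv W p = B"
    unfolding right_deriv_def by (intro vector_derivative_within) (auto simp: trivial_limit_at_right_real)
  moreover have "(W has_vector_derivative A) (at p within {..p})"
    by (rule has_vector_derivative_transform_within[OF d e]) (auto intro!: L[symmetric] simp: dist_real_def)
  then have "(W has_vector_derivative A) (at_left p)"
    by (rule has_vector_derivative_within_subset) auto
  then have "left_deriv W p = A"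
    unfolding left_deriv_def by (intro vector_derivative_within) (auto simp: trivial_limit_at_left_real)
  ultimately show ?thesis by (simp add: deriv_jump_def)
qed

lemma kink_deriv_deriv:
  assumes k: "kink W p A A e"
  shows "deriv (deriv W) p = 0"
proof -
  have e: "0 < e" using k unfolding kink_def by blast
  have W: "W q = W p + A * (q - p)" if "q \<in> {p - e<..<p + e}" for q
  proof (cases "q \<le> p")
    case True
    then show ?thesis using k that unfolding kink_def greaterThanLessThan_iff by blast
  next
    case False
    then have "p \<le> q" "q < p + e" using that by auto
    then show ?thesis using k unfolding kink_def by blast
  qed
  have "deriv W q = A" if "q \<in> {p - e<..<p + e}" for q
  proof -
    have "deriv W q = deriv (\<lambda>q. W p + A * (q - p)) q"
      by (rule deriv_eq_on_open[OF _ W that]) auto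
    also have "\<dots> = A" by (rule DERIV_imp_deriv) (auto intro!: derivative_eq_intros)
    finally show ?thesis .
  qed
  then have "deriv (deriv W) p = deriv (\<lambda>_. A) p"
    using deriv_eq_on_open[of "{p - e<..<p + e}" "deriv W" "\<lambda>_. A" p] e by simp
  then show ?thesis by simp
qed

section \<open>The obstacle problem on a facet\<close>

lemma H1_interval_FTC:
  assumes ab: "a < b" and H: "H1_interval a b \<xi> \<eta>"
  shows "\<eta> integrable_on {a..b}" "integrable (lebesgue_on {a..b}) \<eta>"
    and "\<And>y. y \<in> {a..b} \<Longrightarrow> \<xi> y = \<xi> a + integral {a..y} \<eta>"
proof -
  have \<eta>: "\<eta> \<in> borel_measurable (lebesgue_on {a..b})" "integrable (lebesgue_on {a..b}) (\<lambda>x. (\<eta> x)\<^sup>2)"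
    and c: "continuous_on {a..b} \<xi>"
    and weak: "\<And>\<psi>. test_fun a b \<psi> \<Longrightarrow> (LINT x|lebesgue_on {a..b}. \<xi> x * deriv \<psi> x) = - (LINT x|lebesgue_on {a..b}. \<eta> x * \<psi> x)"
    using H by (auto simp: H1_interval_def square_integrable_def)
  have i1: "integrable (lebesgue_on {a..b}) (\<lambda>x. 1 + (\<eta> x)\<^sup>2)"
    using continuous_imp_integrable_real[of a b "\<lambda>_. 1"] \<eta>(2) by (intro Bochner_Integration.integrable_add) auto
  show i: "integrable (lebesgue_on {a..b}) \<eta>"
    by (rule Bochner_Integration.integrable_bound[OF i1 \<eta>(1)])
       (use abs_le_one_plus_square in \<open>auto simp: abs_of_nonneg\<close>)
  show io: "\<eta> integrable_on {a..b}" by (rule integrable_on_lebesgue_on[OF i]) simp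
  \<comment> \<open>The claim is that \<open>h\<close> is constant: on the open interval by du
    Bois-Reymond, then up to the endpoints by continuity.\<close>
  define h where "h y = \<xi> y - integral {a..y} \<eta>" for y
  have ch: "continuous_on {a..b} h"
    unfolding h_def by (intro continuous_intros c indefinite_integral_continuous_1 io)
  have step: "h y = h x" if "a < x" "x < y" "y < b" for x y
  proof -
    have sub: "integrable (lebesgue_on {x<..y}) \<eta>"
    proof -
      have "integrable lebesgue (\<lambda>s. indicator {a..b} s *\<^sub>R \<eta> s)"
        using i integrable_restrict_space[of "{a..b}" lebesgue \<eta>] by simp
      from integrable_mult_indicator[OF _ this, of "{x<..y}"]
      have "integrable lebesgue (\<lambda>s. indicator {x<..y} s *\<^sub>R (indicator {a..b} s *\<^sub>R \<eta> s))" by simp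
      moreover have "(\<lambda>s. indicator {x<..y} s *\<^sub>R (indicator {a..b} s *\<^sub>R \<eta> s)) = (\<lambda>s. indicator {x<..y} s *\<^sub>R \<eta> s)"
        using that by (simp add: fun_eq_iff indicator_def)
      ultimately show ?thesis using integrable_restrict_space[of "{x<..y}" lebesgue \<eta>] by simp
    qed
    have "\<xi> y - \<xi> x = (LINT s|lebesgue_on {x<..y}. \<eta> s)"
    proof (rule du_Bois_Reymond_interval[of "{a..b}" a b])
      fix n :: real assume "0 < n" "y + 1 / n < b"
      then show "(LINT s|lebesgue_on {a..b}. \<xi> s * deriv (trap n x y) s) = - (LINT s|lebesgue_on {a..b}. \<eta> s * trap n x y s)"
        using that by (intro weak test_fun_trap) auto
    qed (use that i c in \<open>auto intro: continuous_on_subset\<close>)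
    also have "\<dots> = integral {x<..y} \<eta>"
      by (rule lebesgue_integral_eq_integral[OF sub]) simp
    also have "\<dots> = integral {x..y} \<eta>"
      by (rule integral_subset_negligible) (auto intro: negligible_subset[of "{x}"])
    also have "\<dots> = integral {a..y} \<eta> - integral {a..x} \<eta>"
      using Henstock_Kurzweil_Integration.integral_combine[of a x y \<eta>] integrable_on_subinterval[OF io, of a y] that by auto
    finally show ?thesis by (simp add: h_def)
  qed
  define m where "m = (a + b) / 2"
  have m: "m \<in> {a<..<b}" using ab by (simp add: m_def)
  have "h y = h m" if "y \<in> {a<..<b}" for y
    using step[of y m] step[of m y] that m by (cases y m rule: linorder_cases) auto
  then have "h y = h m" if "y \<in> {a..b}" for y
    using continuous_constant_on_closure[of "{a<..<b}" h "h m" y] ch that ab by simp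
  then have "h y = h a" if "y \<in> {a..b}" for y using that ab by simp
  moreover have "h a = \<xi> a" by (simp add: h_def)
  ultimately show "\<xi> y = \<xi> a + integral {a..y} \<eta>" if "y \<in> {a..b}" for y
    using that unfolding h_def by (metis diff_eq_eq)
qed

lemma H1_interval_affine:
  assumes "a < b"
  shows "H1_interval a b (\<lambda>x. c + m * (x - a)) (\<lambda>_. m)"
  unfolding H1_interval_def square_integrable_def
proof (intro conjI allI impI)
  show "continuous_on {a..b} (\<lambda>x. c + m * (x - a))" by (intro continuous_intros)
  have i: "integrable (lebesgue_on {a..b}) f" if "continuous_on {a..b} f" for f :: "real \<Rightarrow> real"
    using continuous_imp_integrable_real that by blast
  then show "(\<lambda>x. c + m * (x - a)) \<in> borel_measurable (lebesgue_on {a..b})"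
    "(\<lambda>x. m) \<in> borel_measurable (lebesgue_on {a..b})"
    by (intro borel_measurable_integrable i continuous_intros)+
  show "integrable (lebesgue_on {a..b}) (\<lambda>x. (c + m * (x - a))\<^sup>2)" "integrable (lebesgue_on {a..b}) (\<lambda>x. m\<^sup>2)"
    by (intro i continuous_intros)+
  fix \<psi> assume \<psi>: "test_fun a b \<psi>"
  then have s: "smooth \<psi>" and z: "\<psi> a = 0" "\<psi> b = 0" using assms by (auto simp: test_fun_def)
  have c1: "continuous_on {a..b} (\<lambda>x. (c + m * (x - a)) * deriv \<psi> x)" "continuous_on {a..b} (\<lambda>x. m * \<psi> x)"
    by (intro continuous_intros smooth_continuous smooth_deriv_continuous s)+
  have "((\<lambda>x. m * \<psi> x + (c + m * (x - a)) * deriv \<psi> x) has_integral (c + m * (b - a)) * \<psi> b - (c + m * (a - a)) * \<psi> a) {a..b}"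
  proof (rule fundamental_theorem_of_calculus)
    fix x
    have "((\<lambda>x. (c + m * (x - a)) * \<psi> x) has_real_derivative m * \<psi> x + (c + m * (x - a)) * deriv \<psi> x) (at x)"
      by (auto intro!: derivative_eq_intros smooth_DERIV[OF s])
    then show "((\<lambda>x. (c + m * (x - a)) * \<psi> x) has_vector_derivative m * \<psi> x + (c + m * (x - a)) * deriv \<psi> x) (at x within {a..b})"
      by (simp add: has_real_derivative_iff_has_vector_derivative has_vector_derivative_at_within)
  qed (use assms in simp)
  then have "integral {a..b} (\<lambda>x. m * \<psi> x + (c + m * (x - a)) * deriv \<psi> x) = 0" using z by (simp add: integral_unique)
  moreover have "integral {a..b} (\<lambda>x. m * \<psi> x + (c + m * (x - a)) * deriv \<psi> x) =
     integral {a..b} (\<lambda>x. m * \<psi> x) + integral {a..b} (\<lambda>x. (c + m * (x - a)) * deriv \<psi> x)"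
    by (intro Henstock_Kurzweil_Integration.integral_add integrable_continuous_real c1)
  moreover have L1: "(LINT x|lebesgue_on {a..b}. (c + m * (x - a)) * deriv \<psi> x) = integral {a..b} (\<lambda>x. (c + m * (x - a)) * deriv \<psi> x)"
    by (rule lebesgue_integral_eq_integral[OF i[OF c1(1)]]) simp
  moreover have L2: "(LINT x|lebesgue_on {a..b}. m * \<psi> x) = integral {a..b} (\<lambda>x. m * \<psi> x)"
    by (rule lebesgue_integral_eq_integral[OF i[OF c1(2)]]) simp
  ultimately show "(LINT x|lebesgue_on {a..b}. (c + m * (x - a)) * deriv \<psi> x) = - (LINT x|lebesgue_on {a..b}. m * \<psi> x)"
    by linarith
qed

text \<open>All competitors share their end values, so their derivatives share the mean
  \<open>m\<close>, and the energy is the integral of \<open>(\<theta> x - m)\<^sup>2\<close> plus a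
  constant. It is least exactly when the derivative is \<open>m\<close> almost everywhere.
  Uniqueness matters because the choice operator may return any minimizer.\<close>

lemma obstacle_minimizer_slope:
  assumes ab: "cl < cr" and \<kappa>: "\<kappa>l = 1 \<or> \<kappa>l = - 1" "\<kappa>r = 1 \<or> \<kappa>r = - 1" and \<Delta>: "0 < \<Delta>"
    and x: "x \<in> {cl..cr}"
  shows "vector_derivative (SOME \<xi>. obstacle_minimizer \<Delta> \<kappa>l \<kappa>r cl cr \<xi>) (at x within {cl..cr})
    = (\<kappa>l + \<kappa>r) * \<Delta> / (2 * (cr - cl))"
proof -
  define m where "m = (\<kappa>l + \<kappa>r) * \<Delta> / (2 * (cr - cl))"
  have mL: "m * (cr - cl) = (\<kappa>l + \<kappa>r) * \<Delta> / 2" using ab by (simp add: m_def field_simps)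
  have cc: "integrable (lebesgue_on {cl..cr}) (\<lambda>_. c)" "(LINT x|lebesgue_on {cl..cr}. c) = c * (cr - cl)" for c :: real
    using ab continuous_imp_integrable_real[of cl cr "\<lambda>_. c"] by (auto simp: measure_restrict_space)
  have mean: "(LINT x|lebesgue_on {cl..cr}. \<theta> x) = m * (cr - cl)"
    and sq: "(LINT x|lebesgue_on {cl..cr}. (\<theta> x)\<^sup>2) = (LINT x|lebesgue_on {cl..cr}. (\<theta> x - m)\<^sup>2) + m\<^sup>2 * (cr - cl)"
    and i2: "integrable (lebesgue_on {cl..cr}) (\<lambda>x. (\<theta> x - m)\<^sup>2)"
    if adm: "obstacle_admissible \<Delta> \<kappa>l \<kappa>r cl cr \<zeta> \<theta>" for \<zeta> \<theta>
  proof -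
    have H: "H1_interval cl cr \<zeta> \<theta>" and e: "\<zeta> cl = - \<kappa>l * \<Delta> / 2" "\<zeta> cr = \<kappa>r * \<Delta> / 2"
      using adm by (auto simp: obstacle_admissible_def)
    note F = H1_interval_FTC[OF ab H]
    have "(LINT x|lebesgue_on {cl..cr}. \<theta> x) = integral {cl..cr} \<theta>"
      by (rule lebesgue_integral_eq_integral[OF F(2)]) simp
    then show mean: "(LINT x|lebesgue_on {cl..cr}. \<theta> x) = m * (cr - cl)"
      using F(3)[of cr] ab e mL by (simp add: field_simps)
    have t2: "integrable (lebesgue_on {cl..cr}) (\<lambda>x. (\<theta> x)\<^sup>2)"
      using H by (simp add: H1_interval_def square_integrable_def)
    have eq: "(\<lambda>x. (\<theta> x - m)\<^sup>2) = (\<lambda>x. (\<theta> x)\<^sup>2 - 2 * m * \<theta> x + m\<^sup>2)"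
      by (auto simp: power2_diff algebra_simps)
    show "integrable (lebesgue_on {cl..cr}) (\<lambda>x. (\<theta> x - m)\<^sup>2)"
      unfolding eq using t2 F(2) cc(1) by simp
    have "(LINT x|lebesgue_on {cl..cr}. (\<theta> x - m)\<^sup>2) = (LINT x|lebesgue_on {cl..cr}. (\<theta> x)\<^sup>2) - 2 * m * (m * (cr - cl)) + m\<^sup>2 * (cr - cl)"
      unfolding eq using t2 F(2) cc mean by simp
    then show "(LINT x|lebesgue_on {cl..cr}. (\<theta> x)\<^sup>2) = (LINT x|lebesgue_on {cl..cr}. (\<theta> x - m)\<^sup>2) + m\<^sup>2 * (cr - cl)"
      by (simp add: power2_eq_square)
  qed
  define \<xi>0 where "\<xi>0 x = - \<kappa>l * \<Delta> / 2 + m * (x - cl)" for x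
  have adm0: "obstacle_admissible \<Delta> \<kappa>l \<kappa>r cl cr \<xi>0 (\<lambda>_. m)"
    unfolding obstacle_admissible_def
  proof (intro conjI ballI)
    show "H1_interval cl cr \<xi>0 (\<lambda>_. m)" unfolding \<xi>0_def by (rule H1_interval_affine[OF ab])
    show "\<xi>0 cl = - \<kappa>l * \<Delta> / 2" by (simp add: \<xi>0_def)
    show e: "\<xi>0 cr = \<kappa>r * \<Delta> / 2" using mL by (simp add: \<xi>0_def field_simps)
    fix x assume x: "x \<in> {cl..cr}"
    define t where "t = m * (x - cl)"
    define M where "M = m * (cr - cl)"
    \<comment> \<open>The affine function runs monotonically between end values of modulus
      \<open>\<Delta> / 2\<close>, so it respects the obstacle by itself.\<close>
    have "(0 \<le> t \<and> t \<le> M) \<or> (t \<le> 0 \<and> M \<le> t)"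
    proof (cases "0 \<le> m")
      case True
      then show ?thesis using x by (simp add: t_def M_def mult_left_mono)
    next
      case False
      then show ?thesis using x by (simp add: t_def M_def mult_left_mono_neg mult_nonpos_nonneg)
    qed
    moreover have "M = (\<kappa>l + \<kappa>r) * \<Delta> / 2" using mL by (simp add: M_def)
    ultimately have "\<bar>- \<kappa>l * \<Delta> / 2 + t\<bar> \<le> \<Delta> / 2"
      using \<kappa> \<Delta> unfolding abs_le_iff by auto
    then show "\<bar>\<xi>0 x\<bar> \<le> \<Delta> / 2" by (simp add: \<xi>0_def t_def)
  qed
  have "obstacle_minimizer \<Delta> \<kappa>l \<kappa>r cl cr \<xi>0"
    unfolding obstacle_minimizer_def
  proof (intro exI[of _ "\<lambda>_. m"] conjI allI impI adm0)
    fix \<zeta> \<theta> assume a: "obstacle_admissible \<Delta> \<kappa>l \<kappa>r cl cr \<zeta> \<theta>"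
    show "(LINT x|lebesgue_on {cl..cr}. m\<^sup>2) \<le> (LINT x|lebesgue_on {cl..cr}. (\<theta> x)\<^sup>2)"
      unfolding sq[OF a] cc(2) by simp
  qed
  then have "obstacle_minimizer \<Delta> \<kappa>l \<kappa>r cl cr (SOME \<xi>. obstacle_minimizer \<Delta> \<kappa>l \<kappa>r cl cr \<xi>)"
    by (rule someI[where P="obstacle_minimizer \<Delta> \<kappa>l \<kappa>r cl cr"])
  then obtain \<xi> \<eta> where \<xi>: "\<xi> = (SOME \<xi>. obstacle_minimizer \<Delta> \<kappa>l \<kappa>r cl cr \<xi>)"
    and adm: "obstacle_admissible \<Delta> \<kappa>l \<kappa>r cl cr \<xi> \<eta>"
    and min: "\<And>\<zeta> \<theta>. obstacle_admissible \<Delta> \<kappa>l \<kappa>r cl cr \<zeta> \<theta> \<Longrightarrow>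
      (LINT x|lebesgue_on {cl..cr}. (\<eta> x)\<^sup>2) \<le> (LINT x|lebesgue_on {cl..cr}. (\<theta> x)\<^sup>2)"
    unfolding obstacle_minimizer_def by blast
  \<comment> \<open>Comparison with the affine competitor removes the constant part of the energy
    and leaves no room for fluctuation.\<close>
  have "(LINT x|lebesgue_on {cl..cr}. (\<eta> x - m)\<^sup>2) \<le> 0"
    using min[OF adm0] unfolding sq[OF adm] cc(2) by simp
  then have "(LINT x|lebesgue_on {cl..cr}. (\<eta> x - m)\<^sup>2) = 0"
    by (intro antisym Bochner_Integration.integral_nonneg) auto
  then have "AE x in lebesgue_on {cl..cr}. (\<eta> x - m)\<^sup>2 = 0"
    using integral_nonneg_eq_0_iff_AE[OF i2[OF adm]] by simp
  then have ae: "AE x in lebesgue. x \<in> {cl..cr} \<longrightarrow> \<eta> x = m"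
    by (simp add: AE_restrict_space_iff)
  have neg: "negligible {x. x \<in> {cl..cr} \<and> \<eta> x \<noteq> m}"
  proof -
    obtain N where N: "N \<in> null_sets lebesgue" "{x \<in> space lebesgue. \<not> (x \<in> {cl..cr} \<longrightarrow> \<eta> x = m)} \<subseteq> N"
      using ae unfolding eventually_ae_filter by blast
    show ?thesis
      by (rule negligible_subset[of N]) (use N in \<open>auto simp: negligible_iff_null_sets\<close>)
  qed
  have H: "H1_interval cl cr \<xi> \<eta>" using adm by (simp add: obstacle_admissible_def)
  have aff: "\<xi> y = \<xi> cl + m * (y - cl)" if y: "y \<in> {cl..cr}" for y
  proof -
    have "integral {cl..y} \<eta> = integral {cl..y} (\<lambda>_. m)"
      by (rule integral_spike[OF neg]) (use y in auto)
    then show ?thesis using H1_interval_FTC(3)[OF ab H y] y by simp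
  qed
  have d: "((\<lambda>y. \<xi> cl + m * (y - cl)) has_vector_derivative m) (at x within {cl..cr})"
    by (auto intro!: derivative_eq_intros simp flip: has_real_derivative_iff_has_vector_derivative)
  have "(\<xi> has_vector_derivative m) (at x within {cl..cr})"
    by (rule has_vector_derivative_transform[OF x _ d]) (rule aff)
  then have "vector_derivative \<xi> (at x within {cl..cr}) = m"
    by (rule vector_derivative_within_closed_interval[OF ab x])
  then show ?thesis by (simp add: \<xi> m_def)
qed

section \<open>Facets and their transition numbers\<close>

lemma constant_sign:
  fixes h :: "real \<Rightarrow> real"
  assumes "continuous_on UNIV h" "\<And>y. a < y \<Longrightarrow> y < b \<Longrightarrow> h y \<noteq> p"
  shows "(\<forall>y. a < y \<longrightarrow> y < b \<longrightarrow> h y < p) \<or> (\<forall>y. a < y \<longrightarrow> y < b \<longrightarrow> p < h y)"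
proof (rule ccontr)
  assume "\<not> ?thesis"
  then obtain y z where y: "a < y" "y < b" "p \<le> h y" and z: "a < z" "z < b" "h z \<le> p" by force
  have c: "connected (h ` {a<..<b})"
    by (intro connected_continuous_image continuous_on_subset[OF assms(1)]) auto
  have "p \<in> h ` {a<..<b}"
    by (rule connectedD_interval[OF c, of "h z" "h y"]) (use y z in auto)
  then obtain x where "x \<in> {a<..<b}" "p = h x" by blast
  then show False using assms(2)[of x] by simp
qed

text \<open>If one candidate reached further, it would contain points just outside the other facet,
  where the slope differs from \<open>p\<close>.\<close>

lemma facet_unique:
  assumes "facet f p x bl cl cr br" "facet f p x bl' cl' cr' br'"
  shows "cl = cl' \<and> cr = cr'"
proof -
  have cl: "cl \<le> cl'" if 1: "facet f p x bl cl cr br" and 2: "facet f p x bl' cl' cr' br'" for bl cl cr br bl' cl' cr' br'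
  proof (rule ccontr)
    assume "\<not> cl \<le> cl'"
    then have "max bl cl' < cl" using 1 by (auto simp: facet_def)
    then obtain y where y: "max bl cl' < y" "y < cl" using dense by blast
    then have "y \<in> {bl<..<br} - {cl..cr}" "y \<in> {cl'..cr'}" using 1 2 by (auto simp: facet_def)
    then show False using 1 2 unfolding facet_def by blast
  qed
  have cr: "cr' \<le> cr" if 1: "facet f p x bl cl cr br" and 2: "facet f p x bl' cl' cr' br'" for bl cl cr br bl' cl' cr' br'
  proof (rule ccontr)
    assume "\<not> cr' \<le> cr"
    then have "cr < min br cr'" using 1 by (auto simp: facet_def)
    then obtain y where y: "cr < y" "y < min br cr'" using dense by blast
    then have "y \<in> {bl<..<br} - {cl..cr}" "y \<in> {cl'..cr'}" using 1 2 by (auto simp: facet_def)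
    then show False using 1 2 unfolding facet_def by blast
  qed
  show ?thesis using cl[OF assms] cl[OF assms(2,1)] cr[OF assms] cr[OF assms(2,1)] by auto
qed

text \<open>By continuity the slope stays on one side of \<open>p\<close> along each entire flank,
  so the eventual signs in the transition numbers hold on all of it, and the default value 0 does
  not occur.\<close>

lemma nonlocal_curvature_facet:
  assumes fac: "facet f p x bl cl cr br" and p: "deriv f x = p" "p \<in> jump_points W" "0 \<le> deriv_jump W p"
    and c: "continuous_on UNIV (deriv f)"
  obtains \<kappa>l \<kappa>r :: real where
    "(\<kappa>l = 1 \<and> (\<forall>y. bl < y \<longrightarrow> y < cl \<longrightarrow> deriv f y < p)) \<or> (\<kappa>l = - 1 \<and> (\<forall>y. bl < y \<longrightarrow> y < cl \<longrightarrow> p < deriv f y))"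
    "(\<kappa>r = 1 \<and> (\<forall>y. cr < y \<longrightarrow> y < br \<longrightarrow> p < deriv f y)) \<or> (\<kappa>r = - 1 \<and> (\<forall>y. cr < y \<longrightarrow> y < br \<longrightarrow> deriv f y < p))"
    "nonlocal_curvature W f x = (\<kappa>l + \<kappa>r) * deriv_jump W p / (2 * (cr - cl))"
proof -
  have b: "bl < cl" "cl < cr" "cr < br" "x \<in> {cl..cr}" using fac by (auto simp: facet_def)
  define \<kappa>l where "\<kappa>l = left_transition f p cl"
  define \<kappa>r where "\<kappa>r = right_transition f p cr"
  have l: "(\<kappa>l = 1 \<and> (\<forall>y. bl < y \<longrightarrow> y < cl \<longrightarrow> deriv f y < p)) \<or> (\<kappa>l = - 1 \<and> (\<forall>y. bl < y \<longrightarrow> y < cl \<longrightarrow> p < deriv f y))"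
  proof -
    have "(\<forall>y. bl < y \<longrightarrow> y < cl \<longrightarrow> deriv f y < p) \<or> (\<forall>y. bl < y \<longrightarrow> y < cl \<longrightarrow> p < deriv f y)"
      by (rule constant_sign[OF c]) (use fac in \<open>auto simp: facet_def\<close>)
    then show ?thesis
    proof
      assume h: "\<forall>y. bl < y \<longrightarrow> y < cl \<longrightarrow> deriv f y < p"
      then have "\<forall>\<^sub>F y in at_left cl. deriv f y < p" using b by (auto simp: eventually_at_left_field)
      then show ?thesis using h by (simp add: \<kappa>l_def left_transition_def)
    next
      assume h: "\<forall>y. bl < y \<longrightarrow> y < cl \<longrightarrow> p < deriv f y"
      then have e: "\<forall>\<^sub>F y in at_left cl. p < deriv f y" using b by (auto simp: eventually_at_left_field)
      have "\<not> (\<forall>\<^sub>F y in at_left cl. deriv f y < p)"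
      proof
        assume "\<forall>\<^sub>F y in at_left cl. deriv f y < p"
        with e have "\<forall>\<^sub>F y in at_left cl. False" by eventually_elim simp
        then show False by (simp add: trivial_limit_at_left_real)
      qed
      then show ?thesis using h e by (simp add: \<kappa>l_def left_transition_def)
    qed
  qed
  have r: "(\<kappa>r = 1 \<and> (\<forall>y. cr < y \<longrightarrow> y < br \<longrightarrow> p < deriv f y)) \<or> (\<kappa>r = - 1 \<and> (\<forall>y. cr < y \<longrightarrow> y < br \<longrightarrow> deriv f y < p))"
  proof -
    have "(\<forall>y. cr < y \<longrightarrow> y < br \<longrightarrow> deriv f y < p) \<or> (\<forall>y. cr < y \<longrightarrow> y < br \<longrightarrow> p < deriv f y)"
      by (rule constant_sign[OF c]) (use fac in \<open>auto simp: facet_def\<close>)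
    then show ?thesis
    proof
      assume h: "\<forall>y. cr < y \<longrightarrow> y < br \<longrightarrow> p < deriv f y"
      then have "\<forall>\<^sub>F y in at_right cr. p < deriv f y" using b by (auto simp: eventually_at_right_field)
      then show ?thesis using h by (simp add: \<kappa>r_def right_transition_def)
    next
      assume h: "\<forall>y. cr < y \<longrightarrow> y < br \<longrightarrow> deriv f y < p"
      then have e: "\<forall>\<^sub>F y in at_right cr. deriv f y < p" using b by (auto simp: eventually_at_right_field)
      have "\<not> (\<forall>\<^sub>F y in at_right cr. p < deriv f y)"
      proof
        assume "\<forall>\<^sub>F y in at_right cr. p < deriv f y"
        with e have "\<forall>\<^sub>F y in at_right cr. False" by eventually_elim simp
        then show False by (simp add: trivial_limit_at_right_real)
      qed
      then show ?thesis using h e by (simp add: \<kappa>r_def right_transition_def)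
    qed
  qed
  have reg: "faceted_region f x = (cl, cr)"
    unfolding faceted_region_def
    by (rule the_equality) (use fac p(1) facet_unique in \<open>blast+\<close>)
  have \<Delta>: "0 < deriv_jump W p" using p by (simp add: jump_points_def)
  have "nonlocal_curvature W f x = vector_derivative (SOME \<xi>. obstacle_minimizer (deriv_jump W p) \<kappa>l \<kappa>r cl cr \<xi>) (at x within {cl..cr})"
    using p by (simp add: nonlocal_curvature_def reg \<kappa>l_def \<kappa>r_def Let_def)
  also have "\<dots> = (\<kappa>l + \<kappa>r) * deriv_jump W p / (2 * (cr - cl))"
    by (rule obstacle_minimizer_slope[OF b(2) _ _ \<Delta> b(4)]) (use l r in auto)
  finally show ?thesis using that l r by blast
qed

section \<open>Barriers for admissible test functions\<close>

lemma ex_antiderivative: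
  fixes F :: "real \<Rightarrow> real"
  assumes "continuous_on UNIV F"
  shows "\<exists>G. (\<forall>y. (G has_real_derivative F y) (at y)) \<and> G x = c"
proof -
  obtain G where G: "\<And>y. (G has_real_derivative F y) (at y)"
    using einterval_antiderivative[of "-\<infinity>" "\<infinity>" F] assms
    by (auto simp: continuous_on_eq_continuous_at has_real_derivative_iff_has_vector_derivative)
  have "((\<lambda>y. G y + (c - G x)) has_real_derivative F y) (at y)" for y
    using DERIV_add[OF G DERIV_const] by simp
  then show ?thesis by (intro exI[of _ "\<lambda>y. G y + (c - G x)"]) simp
qed

lemma continuous_near:
  fixes F :: "real \<Rightarrow> real"
  assumes "continuous_on UNIV F" "0 < e"
  obtains h where "0 < h" "\<And>y. \<bar>y - c\<bar> < h \<Longrightarrow> \<bar>F y - F c\<bar> < e"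
  using assms unfolding continuous_on_iff dist_real_def by (metis UNIV_I)

text \<open>The outer interval from \<open>a0\<close> to \<open>b0\<close> leaves room for test
  functions beyond \<open>a\<close> and \<open>b\<close>. The rate \<open>l\<close> bounds the
  growth of the selection only in the direction given by \<sigma>, whereas \<open>K\<close> is a
  crude two-sided Lipschitz constant.\<close>

definition barrier :: "real \<Rightarrow> (real \<Rightarrow> real \<Rightarrow> bool) \<Rightarrow> (real \<Rightarrow> real) \<Rightarrow> real \<Rightarrow> real \<Rightarrow> bool" where
  "barrier \<sigma> R f x l \<longleftrightarrow> (\<exists>a0 a b b0 ft F om K.
     a0 < a \<and> a < x \<and> x < b \<and> b < b0 \<and> b0 < a0 + 1 \<and> 0 \<le> K \<and>
     (\<forall>y. (ft has_real_derivative F y) (at y)) \<and> continuous_on UNIV F \<and>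
     (\<forall>y\<in>{a0<..<b0}. R (F y) (om y)) \<and>
     (\<forall>y z. a0 < y \<longrightarrow> y < z \<longrightarrow> z < b0 \<longrightarrow>
        \<bar>om z - om y\<bar> \<le> K * (z - y) \<and> \<sigma> * (om z - om y) \<le> l * (z - y)) \<and>
     (\<forall>y\<in>{a..b}. 0 \<le> \<sigma> * (ft y - f y)) \<and> ft x = f x \<and>
     0 < \<sigma> * (ft a - f a) \<and> 0 < \<sigma> * (ft b - f b))"

lemma barrierI:
  assumes "a0 < a" "a < x" "x < b" "b < b0" "b0 < a0 + 1" "0 \<le> K"
    "\<And>y. (ft has_real_derivative F y) (at y)" "continuous_on UNIV F"
    "\<And>y. y \<in> {a0<..<b0} \<Longrightarrow> R (F y) (om y)"
    "\<And>y z. a0 < y \<Longrightarrow> y < z \<Longrightarrow> z < b0 \<Longrightarrow>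
       \<bar>om z - om y\<bar> \<le> K * (z - y) \<and> \<sigma> * (om z - om y) \<le> l * (z - y)"
    "\<And>y. y \<in> {a..b} \<Longrightarrow> 0 \<le> \<sigma> * (ft y - f y)" "ft x = f x"
    "0 < \<sigma> * (ft a - f a)" "0 < \<sigma> * (ft b - f b)"
  shows "barrier \<sigma> R f x l"
  unfolding barrier_def
  by (rule exI[of _ a0], rule exI[of _ a], rule exI[of _ b], rule exI[of _ b0], rule exI[of _ ft],
      rule exI[of _ F], rule exI[of _ om], rule exI[of _ K]) (use assms in \<open>intro conjI; blast\<close>)

text \<open>
  The relation \<open>R\<close> stands for the graph of the subdifferential near the slope \<open>p\<close>, so that a barrier
  from below is obtained by reflecting \<open>f\<close> and \<open>R\<close>.  Where the facet is entered from the side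
  that lowers the curvature (transition number \<open>-1\<close>) the barrier continues the facet by a straight line,
  on which any value between \<open>A\<close> and \<open>B\<close> may be selected; otherwise it bends away quadratically.
\<close>

lemma facet_barrier:
  fixes f F0 :: "real \<Rightarrow> real" and R :: "real \<Rightarrow> real \<Rightarrow> bool" and \<kappa>l \<kappa>r :: real
  assumes f: "\<And>y. (f has_real_derivative F0 y) (at y)" "continuous_on UNIV F0"
    and I: "bl < cl" "cl < cr" "cr < br" "br - bl \<le> 1" "x \<in> {cl..cr}" "\<And>y. y \<in> {cl..cr} \<Longrightarrow> F0 y = p"
    and l: "(\<kappa>l = 1 \<and> (\<forall>y. bl < y \<longrightarrow> y < cl \<longrightarrow> F0 y < p)) \<or> (\<kappa>l = - 1 \<and> (\<forall>y. bl < y \<longrightarrow> y < cl \<longrightarrow> p < F0 y))"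
    and r: "(\<kappa>r = 1 \<and> (\<forall>y. cr < y \<longrightarrow> y < br \<longrightarrow> p < F0 y)) \<or> (\<kappa>r = - 1 \<and> (\<forall>y. cr < y \<longrightarrow> y < br \<longrightarrow> F0 y < p))"
    and R: "0 < e" "A \<le> B" "\<And>q. p - e < q \<Longrightarrow> q < p \<Longrightarrow> R q A" "\<And>q. p < q \<Longrightarrow> q < p + e \<Longrightarrow> R q B"
      "\<And>s. A \<le> s \<Longrightarrow> s \<le> B \<Longrightarrow> R p s"
    and lam: "(\<kappa>l + \<kappa>r) * (B - A) / (2 * (cr - cl)) < lam"
  shows "barrier 1 R f x lam"
proof -
  \<comment> \<open>\<open>2 * (y - cl)\<close> is the derivative of
    \<open>(y - cl)\<^sup>2\<close>, which lifts the barrier strictly off \<open>f\<close> beyond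
    the facet. On a straight side the separation comes from the slope of \<open>f\<close> itself,
    which exceeds \<open>p\<close> to the left of the facet.\<close>
  define FL where "FL y = (if \<kappa>l = -1 then p else F0 y + 2 * (y - cl))" for y
  define FR where "FR y = (if \<kappa>r = -1 then p else F0 y + 2 * (y - cr))" for y
  \<comment> \<open>\<open>min\<close> and \<open>max\<close> freeze each branch at the facet, where
    both equal \<open>p\<close>; subtracting one \<open>p\<close> glues them.\<close>
  define F where "F y = FL (min y cl) + FR (max y cr) - p" for y
  have p: "F0 cl = p" "F0 cr = p" using I by auto
  have bend: "continuous_on UNIV (\<lambda>y. F0 y + 2 * (y - c))" for c by (intro continuous_intros f(2))
  have cFL: "continuous_on UNIV FL"
  proof (cases "\<kappa>l = -1")
    case True
    then have "FL = (\<lambda>_. p)" by (simp add: FL_def fun_eq_iff)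
    then show ?thesis by simp
  next
    case False
    then have "FL = (\<lambda>y. F0 y + 2 * (y - cl))" by (simp add: FL_def fun_eq_iff)
    then show ?thesis using bend[of cl] by (simp only:)
  qed
  have cFR: "continuous_on UNIV FR"
  proof (cases "\<kappa>r = -1")
    case True
    then have "FR = (\<lambda>_. p)" by (simp add: FR_def fun_eq_iff)
    then show ?thesis by simp
  next
    case False
    then have "FR = (\<lambda>y. F0 y + 2 * (y - cr))" by (simp add: FR_def fun_eq_iff)
    then show ?thesis using bend[of cr] by (simp only:)
  qed
  have "continuous_on UNIV (\<lambda>y. min y cl)" "continuous_on UNIV (\<lambda>y. max y cr)"
    by (intro continuous_intros)+
  then have "continuous_on UNIV (\<lambda>y. FL (min y cl))" "continuous_on UNIV (\<lambda>y. FR (max y cr))"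
    using continuous_on_compose2[OF cFL] continuous_on_compose2[OF cFR] by blast+
  then have cF: "continuous_on UNIV F" unfolding F_def by (intro continuous_intros)
  have FLR: "FL cl = p" "FR cr = p" using p by (simp_all add: FL_def FR_def)
  have F_l: "F y = FL y" if "y \<le> cl" for y
  proof -
    have "min y cl = y" "max y cr = cr" using that I(2) by auto
    then show ?thesis by (simp add: F_def FLR)
  qed
  have F_r: "F y = FR y" if "cr \<le> y" for y
  proof -
    have "min y cl = cl" "max y cr = y" using that I(2) by auto
    then show ?thesis by (simp add: F_def FLR)
  qed
  have F_m: "F y = p" if "cl \<le> y" "y \<le> cr" for y
  proof -
    have "min y cl = cl" "max y cr = cr" using that by auto
    then show ?thesis by (simp add: F_def FLR)
  qed
  obtain ft where ft: "\<And>y. (ft has_real_derivative F y) (at y)" "ft x = f x"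
    using ex_antiderivative[OF cF, of x "f x"] by blast
  define D where "D y = ft y - f y" for y
  have dD: "(D has_real_derivative F y - F0 y) (at y)" for y
    unfolding D_def by (intro DERIV_diff ft f)
  \<comment> \<open>Barrier and test function have the same slope on the facet and agree at
    \<open>x\<close>, so they agree on all of it, wherever \<open>x\<close> lies.\<close>
  have D_m: "D y = 0" if "cl \<le> y" "y \<le> cr" for y
  proof -
    have Dx: "D x = 0" by (simp add: D_def ft(2))
    have z0: "F z - F0 z = 0" if "cl < z" "z < cr" for z using F_m[of z] I(6)[of z] that by simp
    have x: "cl \<le> x" "x \<le> cr" using I(5) by auto
    show ?thesis
    proof (cases y x rule: linorder_cases)
      case less
      obtain z where z: "y < z" "z < x" "D x - D y = (x - y) * (F z - F0 z)"
        using MVT2[OF less, of D "\<lambda>y. F y - F0 y"] dD by auto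
      then show ?thesis using z0[of z] that x Dx by simp
    next
      case greater
      obtain z where z: "x < z" "z < y" "D y - D x = (y - x) * (F z - F0 z)"
        using MVT2[OF greater, of D "\<lambda>y. F y - F0 y"] dD by auto
      then show ?thesis using z0[of z] that x Dx by simp
    qed (simp add: Dx)
  qed
  have D_l: "0 < D y" if yy: "bl < y" "y < cl" for y
  proof -
    obtain z where z: "y < z" "z < cl" "D cl - D y = (cl - y) * (F z - F0 z)"
      using MVT2[OF yy(2), of D "\<lambda>y. F y - F0 y"] dD by auto
    have "F z - F0 z < 0" using l z yy F_l[of z] by (auto simp: FL_def)
    then have "D cl - D y < 0" unfolding z(3) using yy(2) by (intro mult_pos_neg) auto
    then show ?thesis using D_m[of cl] I by simp
  qed
  have D_r: "0 < D y" if yy: "cr < y" "y < br" for y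
  proof -
    obtain z where z: "cr < z" "z < y" "D y - D cr = (y - cr) * (F z - F0 z)"
      using MVT2[OF yy(1), of D "\<lambda>y. F y - F0 y"] dD by auto
    have "0 < F z - F0 z" using r z yy F_r[of z] by (auto simp: FR_def)
    then have "0 < D y - D cr" unfolding z(3) using yy(1) by (intro mult_pos_pos) auto
    then show ?thesis using D_m[of cr] I by simp
  qed
  obtain h1 where h1: "0 < h1" "\<And>y. \<bar>y - cl\<bar> < h1 \<Longrightarrow> \<bar>F y - F cl\<bar> < e"
    using continuous_near[OF cF R(1)] by blast
  obtain h2 where h2: "0 < h2" "\<And>y. \<bar>y - cr\<bar> < h2 \<Longrightarrow> \<bar>F y - F cr\<bar> < e"
    using continuous_near[OF cF R(1)] by blast
  have Fp: "F cl = p" "F cr = p" using F_m I by auto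
  define L where "L = cr - cl"
  have L: "0 < L" using I by (simp add: L_def)
  \<comment> \<open>With both transition numbers -1 the selection may fall from \<open>B\<close> to
    \<open>A\<close> over the widened interval of length \<open>L + 2 * h\<close>, which is a slower
    descent than the curvature. That \<open>lam\<close> is strictly larger than the curvature leaves
    room for some positive \<open>h\<close>.\<close>
  have "\<exists>h>0. \<kappa>l = -1 \<longrightarrow> \<kappa>r = -1 \<longrightarrow> - (B - A) / (L + 2 * h) \<le> lam"
  proof (cases "0 \<le> lam \<or> \<not> (\<kappa>l = -1 \<and> \<kappa>r = -1)")
    case True
    have "- (B - A) / (L + 2 * 1) \<le> 0" using R(2) L by (simp add: divide_nonpos_pos)
    then show ?thesis using True by (intro exI[of _ 1]) auto
  next
    case False
    have "(-1 + -1) * (B - A) / (2 * (cr - cl)) = - (B - A) / L"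
      unfolding L_def using I(2) by (simp add: field_simps)
    then have "- (B - A) / L < lam" using lam False by simp
    then have lt: "- lam * L < B - A" using L by (simp add: field_simps)
    \<comment> \<open>The solution of \<open>- (B - A) / (L + 2 * h) = lam\<close>, positive because
      \<open>lam\<close> exceeds \<open>- (B - A) / L\<close>.\<close>
    define h where "h = (B - A + lam * L) / (- 2 * lam)"
    have lm: "lam < 0" using False by simp
    have "0 < h" using lt lm unfolding h_def by (intro divide_pos_pos) auto
    moreover have "- lam * (L + 2 * h) = B - A" using lm by (simp add: h_def field_simps)
    then have "- (B - A) / (L + 2 * h) \<le> lam" using L \<open>0 < h\<close> by (simp add: field_simps)
    ultimately show ?thesis by blast
  qed
  then obtain h3 where h3: "0 < h3" "\<kappa>l = -1 \<Longrightarrow> \<kappa>r = -1 \<Longrightarrow> - (B - A) / (L + 2 * h3) \<le> lam" by blast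
  \<comment> \<open>Small enough for the slope to stay within the radius of the kink on both flanks,
    and for the widened interval to stay in the neighbourhood of the facet, hence to be shorter than
    a period.\<close>
  define h where "h = min (min h1 h2) (min h3 (min ((cl - bl) / 2) ((br - cr) / 2)))"
  have h: "0 < h" "h \<le> h1" "h \<le> h2" "h \<le> h3" "h < cl - bl" "h < br - cr"
    using h1(1) h2(1) h3(1) I by (auto simp: h_def min_def)
  define a0 b0 where "a0 = cl - h" and "b0 = cr + h"
  have slope3: "- (B - A) / (b0 - a0) \<le> lam" if "\<kappa>l = -1" "\<kappa>r = -1"
  proof -
    have "(B - A) / (L + 2 * h3) \<le> (B - A) / (b0 - a0)"
      using h R(2) L by (intro divide_left_mono mult_pos_pos) (auto simp: a0_def b0_def L_def)
    then show ?thesis using h3(2)[OF that] unfolding minus_divide_left[symmetric] by linarith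
  qed
  have F_ll: "p - e < F y \<and> F y < p" if "\<kappa>l = 1" "a0 < y" "y < cl" for y
  proof -
    have "\<bar>y - cl\<bar> < h1" "bl < y" using that h by (auto simp: a0_def)
    then have "\<bar>F y - p\<bar> < e" "F0 y < p" using h1(2) Fp l that by auto
    moreover have "F y = F0 y + 2 * (y - cl)" using F_l[of y] that by (simp add: FL_def)
    ultimately show ?thesis using that by auto
  qed
  have F_rr: "p < F y \<and> F y < p + e" if "\<kappa>r = 1" "cr < y" "y < b0" for y
  proof -
    have "\<bar>y - cr\<bar> < h2" "y < br" using that h by (auto simp: b0_def)
    then have "\<bar>F y - p\<bar> < e" "p < F0 y" using h2(2) Fp r that by auto
    moreover have "F y = F0 y + 2 * (y - cr)" using F_r[of y] that by (simp add: FR_def)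
    ultimately show ?thesis using that by auto
  qed
  have F_lp: "F y = p" if "\<kappa>l = -1" "y \<le> cl" for y using F_l[OF that(2)] that by (simp add: FL_def)
  have F_rp: "F y = p" if "\<kappa>r = -1" "cr \<le> y" for y using F_r[OF that(2)] that by (simp add: FR_def)
  have "\<exists>om K. 0 \<le> K \<and> (\<forall>y\<in>{a0<..<b0}. R (F y) (om y)) \<and>
    (\<forall>y z. a0 < y \<longrightarrow> y < z \<longrightarrow> z < b0 \<longrightarrow> \<bar>om z - om y\<bar> \<le> K * (z - y) \<and> om z - om y \<le> lam * (z - y))"
  proof -
    \<comment> \<open>The selection climbs from \<open>A\<close> to \<open>B\<close> across the
      facet if both numbers are 1, falls from \<open>B\<close> to \<open>A\<close> across the
      widened interval if both are -1, and is constant in the mixed cases, where the curvature is 0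
      and so \<open>lam\<close> is positive.\<close>
    consider "\<kappa>l = 1" "\<kappa>r = 1" | "\<kappa>l = 1" "\<kappa>r = -1" | "\<kappa>l = -1" "\<kappa>r = 1" | "\<kappa>l = -1" "\<kappa>r = -1" using l r by blast
    then show ?thesis
    proof cases
      case 1
      define m where "m = (B - A) / L"
      have "(1 + 1) * (B - A) / (2 * (cr - cl)) = m" unfolding m_def L_def using I(2) by (simp add: field_simps)
      then have m: "0 \<le> m" "m \<le> lam" "m * L = B - A" using R(2) L lam 1 by (simp_all add: m_def)
      define om where "om y = A + m * (max cl (min y cr) - cl)" for y
      have "R (F y) (om y)" if y: "y \<in> {a0<..<b0}" for y
      proof -
        consider "y < cl" | "cl \<le> y" "y \<le> cr" | "cr < y" by linarith
        then show ?thesis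
        proof cases
          assume "y < cl"
          then show ?thesis using F_ll[OF 1(1), of y] y R(3) I by (simp add: om_def)
        next
          assume yc: "cl \<le> y" "y \<le> cr"
          then have "0 \<le> m * (y - cl)" "m * (y - cl) \<le> m * L" using m(1) by (auto simp: L_def intro: mult_left_mono)
          then show ?thesis using F_m[OF yc] yc m(3) by (simp add: om_def R(5))
        next
          assume "cr < y"
          then have "om y = B" using m(3) I by (simp add: om_def L_def)
          then show ?thesis using F_rr[OF 1(2) \<open>cr < y\<close>] y R(4) by simp
        qed
      qed
      moreover have "\<bar>om z - om y\<bar> \<le> m * (z - y) \<and> om z - om y \<le> lam * (z - y)" if "y < z" for y z
      proof -
        define d where "d = max cl (min z cr) - max cl (min y cr)"
        have d: "0 \<le> d" "d \<le> z - y" using that I by (auto simp: d_def)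
        have "om z - om y = m * d" by (simp add: om_def d_def algebra_simps)
        moreover have "0 \<le> m * d" "m * d \<le> m * (z - y)" using m d by (auto intro: mult_left_mono)
        moreover have "m * (z - y) \<le> lam * (z - y)" using m that by (intro mult_right_mono) auto
        ultimately show ?thesis by simp
      qed
      ultimately show ?thesis using m(1) by blast
    next
      case 2
      have "R (F y) A" if y: "y \<in> {a0<..<b0}" for y
      proof -
        consider "y < cl" | "cl \<le> y" "y \<le> cr" | "cr < y" by linarith
        then show ?thesis using F_ll[OF 2(1), of y] F_m[of y] F_rp[OF 2(2), of y] y R by cases auto
      qed
      moreover have "0 \<le> lam" using lam 2 by simp
      ultimately show ?thesis by (intro exI[of _ "\<lambda>_. A"] exI[of _ 0]) auto
    next
      case 3
      have "R (F y) B" if y: "y \<in> {a0<..<b0}" for y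
      proof -
        consider "y < cl" | "cl \<le> y" "y \<le> cr" | "cr < y" by linarith
        then show ?thesis using F_rr[OF 3(2), of y] F_m[of y] F_lp[OF 3(1), of y] y R by cases auto
      qed
      moreover have "0 \<le> lam" using lam 3 by simp
      ultimately show ?thesis by (intro exI[of _ "\<lambda>_. B"] exI[of _ 0]) auto
    next
      case 4
      define m where "m = (B - A) / (b0 - a0)"
      have ab0: "0 < b0 - a0" using h I by (simp add: a0_def b0_def)
      have m: "0 \<le> m" "m * (b0 - a0) = B - A" using R(2) ab0 by (simp_all add: m_def)
      have ml: "- m \<le> lam" using slope3[OF 4] unfolding m_def minus_divide_left .
      define om where "om y = B - m * (y - a0)" for y
      have "R (F y) (om y)" if y: "y \<in> {a0<..<b0}" for y
      proof -
        have "F y = p" using F_lp[OF 4(1), of y] F_m[of y] F_rp[OF 4(2), of y] by linarith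
        moreover have "0 \<le> m * (y - a0)" "m * (y - a0) \<le> m * (b0 - a0)" using m(1) y by (auto intro: mult_left_mono)
        ultimately show ?thesis using m(2) by (simp add: om_def R(5))
      qed
      moreover have "\<bar>om z - om y\<bar> \<le> m * (z - y) \<and> om z - om y \<le> lam * (z - y)" if "y < z" for y z
      proof -
        have "om z - om y = - (m * (z - y))" by (simp add: om_def algebra_simps)
        moreover have "0 \<le> m * (z - y)" using m that by simp
        moreover have "- m * (z - y) \<le> lam * (z - y)" using ml that by (intro mult_right_mono) auto
        ultimately show ?thesis by simp
      qed
      ultimately show ?thesis using m(1) by blast
    qed
  qed
  then obtain om K where om: "0 \<le> K" "\<forall>y\<in>{a0<..<b0}. R (F y) (om y)"
    "\<forall>y z. a0 < y \<longrightarrow> y < z \<longrightarrow> z < b0 \<longrightarrow> \<bar>om z - om y\<bar> \<le> K * (z - y) \<and> om z - om y \<le> lam * (z - y)" by blast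
  define a b where "a = cl - h / 2" and "b = cr + h / 2"
  have ab: "a0 < a" "a < x" "x < b" "b < b0" "b0 < a0 + 1" "bl < a" "a < cl" "cr < b" "b < br"
    using h I by (auto simp: a_def b_def a0_def b0_def)
  have D0: "0 \<le> D y" if "y \<in> {a..b}" for y
  proof -
    consider "y < cl" | "cl \<le> y" "y \<le> cr" | "cr < y" by linarith
    then show ?thesis using D_l[of y] D_m[of y] D_r[of y] that ab by cases auto
  qed
  show ?thesis
  proof (rule barrierI[OF ab(1-5) om(1) ft(1) cF])
    show "R (F y) (om y)" if "y \<in> {a0<..<b0}" for y using om(2) that by blast
    show "\<bar>om z - om y\<bar> \<le> K * (z - y) \<and> 1 * (om z - om y) \<le> lam * (z - y)" if "a0 < y" "y < z" "z < b0" for y z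
      unfolding mult_1 using om(3) that by blast
  qed (use D0 D_l[of a] D_r[of b] ab ft(2) in \<open>simp_all add: D_def\<close>)
qed

text \<open>Where \<open>W\<close> is affine near the slope at \<open>x\<close>, the selection can
  be constant, so any positive rate is allowed and adding \<open>(y - x)\<^sup>2\<close> to
  \<open>f\<close> gives the separation.\<close>

lemma regular_barrier:
  fixes f F0 :: "real \<Rightarrow> real" and R :: "real \<Rightarrow> real \<Rightarrow> bool"
  assumes f: "\<And>y. (f has_real_derivative F0 y) (at y)" "continuous_on UNIV F0"
    and R: "0 < e" "\<And>q. F0 x - e < q \<Longrightarrow> q < F0 x + e \<Longrightarrow> R q A"
    and lam: "0 < lam"
  shows "barrier 1 R f x lam"
proof -
  define F where "F y = F0 y + 2 * (y - x)" for y
  have cF: "continuous_on UNIV F" unfolding F_def by (intro continuous_intros f)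
  obtain h1 where h1: "0 < h1" "\<And>y. \<bar>y - x\<bar> < h1 \<Longrightarrow> \<bar>F y - F x\<bar> < e"
    using continuous_near[OF cF R(1)] by blast
  define h where "h = min h1 (1/4)"
  have h: "0 < h" "h \<le> h1" "2 * h < 1" using h1 by (auto simp: h_def)
  define ft where "ft y = f y + (y - x)\<^sup>2" for y
  have dft: "(ft has_real_derivative F y) (at y)" for y
    unfolding ft_def F_def by (auto intro!: derivative_eq_intros f)
  have "R (F y) A" if "y \<in> {x - h<..<x + h}" for y
  proof -
    have "\<bar>y - x\<bar> < h1" using h that by (auto simp: abs_less_iff)
    then have "\<bar>F y - F x\<bar> < e" by (rule h1(2))
    moreover have "F x = F0 x" by (simp add: F_def)
    ultimately have "\<bar>F y - F0 x\<bar> < e" by simp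
    then show ?thesis by (intro R(2)) auto
  qed
  then show ?thesis
    by (intro barrierI[of "x - h" "x - h/2" x "x + h/2" "x + h" 0 ft F R "\<lambda>_. A"] dft cF)
       (use h lam in \<open>auto simp: ft_def\<close>)
qed

text \<open>For \<sigma> = -1 the facet construction is applied to \<open>- f\<close> and to the
  subdifferential reflected in both variables: the kink at \<open>- p\<close> then has slopes
  \<open>- B\<close> and \<open>- A\<close>, and both transition numbers change sign.\<close>

lemma test_function_barrier:
  fixes \<sigma> :: real
  assumes kink: "\<And>q. \<exists>A B e. kink W q A B e"
    and f: "\<And>y. (f has_real_derivative deriv f y) (at y)" "continuous_on UNIV (deriv f)"
    and fac: "deriv f x \<in> jump_points W \<Longrightarrow> faceted f (deriv f x) x"
    and \<sigma>: "\<sigma> = 1 \<or> \<sigma> = -1"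
    and lam: "\<sigma> * nonlocal_curvature W f x < lam"
  shows "barrier \<sigma> (\<lambda>q s. s \<in> subdifferential W q) f x lam"
proof -
  define p where "p = deriv f x"
  obtain A B e where k: "kink W p A B e" using kink by blast
  have AB: "0 < e" "A \<le> B" and AB': "\<And>s. A \<le> s \<Longrightarrow> s \<le> B \<Longrightarrow> s \<in> subdifferential W p"
    using k unfolding kink_def by (blast, blast) (metis k kink_def atLeastAtMost_iff subsetD)
  note J = kink_deriv_jump[OF k]
  note near = kink_subdifferential_near[OF k kink]
  have \<sigma>2: "\<sigma> * (\<sigma> * y) = y" for y using \<sigma> by auto
  define G where "G y = \<sigma> * f y" for y
  define G0 where "G0 y = \<sigma> * deriv f y" for y
  define R where "R q s \<longleftrightarrow> \<sigma> * s \<in> subdifferential W (\<sigma> * q)" for q s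
  have G: "\<And>y. (G has_real_derivative G0 y) (at y)" "continuous_on UNIV G0"
    unfolding G_def G0_def by (auto intro!: DERIV_cmult f continuous_intros)
  have "barrier 1 R G x lam"
  proof (cases "p \<in> jump_points W")
    case False
    then have BA: "B = A" using J by (simp add: jump_points_def)
    have "nonlocal_curvature W f x = 0"
      using False kink_deriv_deriv[of W p A e] k BA by (simp add: nonlocal_curvature_def p_def)
    then have "0 < lam" using lam by simp
    show ?thesis
    proof (rule regular_barrier[OF G AB(1) _ \<open>0 < lam\<close>])
      fix q assume q: "G0 x - e < q" "q < G0 x + e"
      have "p - e < \<sigma> * q" "\<sigma> * q < p + e" using q \<sigma> by (auto simp: G0_def p_def)
      then have "A \<in> subdifferential W (\<sigma> * q)"
        using near[of "\<sigma> * q"] AB' BA by (cases "\<sigma> * q" p rule: linorder_cases) auto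
      then show "R q (\<sigma> * A)" by (simp add: R_def \<sigma>2)
    qed
  next
    case True
    obtain bl cl cr br where fc: "facet f p x bl cl cr br"
      using fac True unfolding faceted_def p_def by blast
    have b: "bl < cl" "cl < cr" "cr < br" "br - bl \<le> 1" "x \<in> {cl..cr}" "\<And>y. y \<in> {cl..cr} \<Longrightarrow> deriv f y = p"
      using fc by (auto simp: facet_def)
    obtain \<kappa>l \<kappa>r :: real where
      l: "(\<kappa>l = 1 \<and> (\<forall>y. bl < y \<longrightarrow> y < cl \<longrightarrow> deriv f y < p)) \<or> (\<kappa>l = - 1 \<and> (\<forall>y. bl < y \<longrightarrow> y < cl \<longrightarrow> p < deriv f y))" and
      r: "(\<kappa>r = 1 \<and> (\<forall>y. cr < y \<longrightarrow> y < br \<longrightarrow> p < deriv f y)) \<or> (\<kappa>r = - 1 \<and> (\<forall>y. cr < y \<longrightarrow> y < br \<longrightarrow> deriv f y < p))" and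
      c: "nonlocal_curvature W f x = (\<kappa>l + \<kappa>r) * deriv_jump W p / (2 * (cr - cl))"
    proof -
      have "0 \<le> deriv_jump W p" using J AB(2) by simp
      from nonlocal_curvature_facet[OF fc p_def[symmetric] True this f(2)] that show ?thesis by blast
    qed
    have J': "deriv_jump W p = B - A" by (rule J)
    from \<sigma> show ?thesis
    proof
      assume s: "\<sigma> = 1"
      have G0: "G0 = deriv f" and R: "R q s = (s \<in> subdifferential W q)" for q s
        using s by (auto simp: G0_def R_def)
      have lam': "(\<kappa>l + \<kappa>r) * (B - A) / (2 * (cr - cl)) < lam" using lam s unfolding c J' by simp
      show ?thesis
      proof (rule facet_barrier[OF G b(1-5) _ _ _ AB(1,2) _ _ _ lam'])
        show "G0 y = p" if "y \<in> {cl..cr}" for y using b(6)[OF that] by (simp add: G0)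
        show "(\<kappa>l = 1 \<and> (\<forall>y. bl < y \<longrightarrow> y < cl \<longrightarrow> G0 y < p)) \<or> (\<kappa>l = - 1 \<and> (\<forall>y. bl < y \<longrightarrow> y < cl \<longrightarrow> p < G0 y))"
          using l unfolding G0 .
        show "(\<kappa>r = 1 \<and> (\<forall>y. cr < y \<longrightarrow> y < br \<longrightarrow> p < G0 y)) \<or> (\<kappa>r = - 1 \<and> (\<forall>y. cr < y \<longrightarrow> y < br \<longrightarrow> G0 y < p))"
          using r unfolding G0 .
        show "R q A" if "p - e < q" "q < p" for q unfolding R by (rule near(2)[OF that])
        show "R q B" if "p < q" "q < p + e" for q unfolding R by (rule near(1)[OF that])
        show "R p s" if "A \<le> s" "s \<le> B" for s unfolding R by (rule AB'[OF that])
      qed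
    next
      assume s: "\<sigma> = -1"
      have G0: "G0 y = - deriv f y" and R: "R q s = (- s \<in> subdifferential W (- q))" for q s y
        using s by (auto simp: G0_def R_def)
      have "- ((\<kappa>l + \<kappa>r) * (B - A) / (2 * (cr - cl))) < lam" using lam s unfolding c J' by simp
      moreover have "(- \<kappa>l + - \<kappa>r) * (- A - - B) / (2 * (cr - cl)) = - ((\<kappa>l + \<kappa>r) * (B - A) / (2 * (cr - cl)))"
      proof -
        have "(- \<kappa>l + - \<kappa>r) * (- A - - B) = - ((\<kappa>l + \<kappa>r) * (B - A))" by (simp add: algebra_simps)
        then show ?thesis by (simp only: minus_divide_left)
      qed
      ultimately have lam': "(- \<kappa>l + - \<kappa>r) * (- A - - B) / (2 * (cr - cl)) < lam" by simp
      have BA: "- B \<le> - A" using AB(2) by simp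
      show ?thesis
      proof (rule facet_barrier[OF G b(1-5) _ _ _ AB(1) BA _ _ _ lam'])
        show "G0 y = - p" if "y \<in> {cl..cr}" for y using b(6)[OF that] by (simp add: G0)
        show "(- \<kappa>l = 1 \<and> (\<forall>y. bl < y \<longrightarrow> y < cl \<longrightarrow> G0 y < - p)) \<or> (- \<kappa>l = - 1 \<and> (\<forall>y. bl < y \<longrightarrow> y < cl \<longrightarrow> - p < G0 y))"
          using l unfolding G0 neg_less_iff_less by auto
        show "(- \<kappa>r = 1 \<and> (\<forall>y. cr < y \<longrightarrow> y < br \<longrightarrow> - p < G0 y)) \<or> (- \<kappa>r = - 1 \<and> (\<forall>y. cr < y \<longrightarrow> y < br \<longrightarrow> G0 y < - p))"
          using r unfolding G0 neg_less_iff_less by auto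
        show "R q (- B)" if "- p - e < q" "q < - p" for q unfolding R using near(1)[of "- q"] that by simp
        show "R q (- A)" if "- p < q" "q < - p + e" for q unfolding R using near(2)[of "- q"] that by simp
        show "R (- p) s" if "- B \<le> s" "s \<le> - A" for s unfolding R using AB'[of "- s"] that by simp
      qed
    qed
  qed
  then obtain a0 a b b0 ft F om K where H: "a0 < a" "a < x" "x < b" "b < b0" "b0 < a0 + 1" "0 \<le> K"
    "\<And>y. (ft has_real_derivative F y) (at y)" "continuous_on UNIV F"
    "\<And>y. y \<in> {a0<..<b0} \<Longrightarrow> R (F y) (om y)"
    "\<And>y z. a0 < y \<Longrightarrow> y < z \<Longrightarrow> z < b0 \<Longrightarrow> \<bar>om z - om y\<bar> \<le> K * (z - y) \<and> om z - om y \<le> lam * (z - y)"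
    "\<And>y. y \<in> {a..b} \<Longrightarrow> 0 \<le> ft y - G y" "ft x = G x" "0 < ft a - G a" "0 < ft b - G b"
    unfolding barrier_def mult_1 by blast
  have sub: "\<sigma> * (\<sigma> * ft y - f y) = ft y - G y" for y by (simp add: right_diff_distrib \<sigma>2 G_def)
  have subo: "\<sigma> * (\<sigma> * om z - \<sigma> * om y) = om z - om y" for y z by (simp add: right_diff_distrib \<sigma>2)
  have abso: "\<bar>\<sigma> * om z - \<sigma> * om y\<bar> = \<bar>om z - om y\<bar>" for y z using \<sigma> by auto
  show ?thesis
  proof (rule barrierI[OF H(1-6), of "\<lambda>y. \<sigma> * ft y" "\<lambda>y. \<sigma> * F y" _ "\<lambda>y. \<sigma> * om y"])
    show "((\<lambda>y. \<sigma> * ft y) has_real_derivative \<sigma> * F y) (at y)" for y by (rule DERIV_cmult[OF H(7)])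
    show "continuous_on UNIV (\<lambda>y. \<sigma> * F y)" by (intro continuous_intros H)
    show "\<sigma> * ft x = f x" using H(12) by (simp add: G_def \<sigma>2)
  qed (use H(9-11,13,14) in \<open>simp_all add: sub subo abso R_def\<close>)
qed

section \<open>From barriers to semicontinuous envelopes\<close>

lemma isCont_nhds: "isCont f a \<Longrightarrow> (f \<longlongrightarrow> f a) (nhds a)"
  by (simp add: isCont_def tendsto_at_iff_tendsto_nhds)

text \<open>Stated with a gap on a whole neighbourhood, so that it contradicts touching by an
  envelope. The comparison is run on the time interval from \<open>t' - r\<close> to
  \<open>t\<close> for every \<open>t\<close> near \<open>t'\<close>, also for \<open>t\<close>
  later than \<open>t'\<close>; this makes the gap uniform.\<close>

lemma no_touching:
  fixes \<sigma> :: real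
  assumes en: "energy_solution W cp cm T u" and cont: "L2_continuous T u"
    and good: "\<forall>t\<in>{0<..<T}. good_representative (u t)"
    and W: "\<And>p s. s \<in> subdifferential W p \<Longrightarrow> - cm \<le> s \<and> s \<le> cp"
    and kink: "\<And>q. \<exists>A B e. kink W q A B e"
    and f: "C2P_torus (jump_points W) f" and g: "Ck_on 1 {0<..<T} g"
    and \<sigma>: "\<sigma> = 1 \<or> \<sigma> = -1" and t': "t' \<in> {0<..<T}"
    and touch: "\<And>t x. t \<in> {0<..<T} \<Longrightarrow> \<sigma> * (u t x - f x - g t) \<le> 0"
    and lt: "\<sigma> * nonlocal_curvature W f x' < \<sigma> * deriv g t'"
  shows "\<exists>c>0. \<forall>\<^sub>F (t, x) in nhds (t', x'). t \<in> {0<..<T} \<and> \<sigma> * (u t x - f x' - g t') \<le> - c"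
proof -
  have dg: "(g has_real_derivative deriv g s) (at s)" if "s \<in> {0<..<T}" for s
    using g that by (auto simp: Ck_on_def DERIV_deriv_iff_real_differentiable)
  have cg: "continuous_on {0<..<T} (deriv g)" using g by (simp add: Ck_on_def)
  have "(deriv ^^ 0) f differentiable (at x)" "(deriv ^^ 1) f differentiable (at x)" for x
    using f unfolding C2P_torus_def Ck_on_def by (auto simp: numeral_2_eq_2 less_Suc_eq)
  then have df: "(f has_real_derivative deriv f x) (at x)" and df2: "deriv f differentiable (at x)" for x
    by (simp_all add: DERIV_deriv_iff_real_differentiable)
  have cf: "continuous_on UNIV f" using df by (meson DERIV_isCont continuous_at_imp_continuous_on)
  have cf': "continuous_on UNIV (deriv f)"
    using df2 by (auto intro!: continuous_at_imp_continuous_on differentiable_imp_continuous_within)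
  have fac: "deriv f x' \<in> jump_points W \<Longrightarrow> faceted f (deriv f x') x'" using f by (simp add: C2P_torus_def)
  \<comment> \<open>The distance from the curvature up to \<open>lam\<close> is used to build the
    barrier, the distance from \<open>lam\<close> to the time derivative absorbs the time
    penalty.\<close>
  obtain lam where lam: "\<sigma> * nonlocal_curvature W f x' < lam" "lam < \<sigma> * deriv g t'" using dense[OF lt] by blast
  obtain a0 a b b0 ft F om K where H: "a0 < a" "a < x'" "x' < b" "b < b0" "b0 < a0 + 1" "0 \<le> K"
    "\<And>y. (ft has_real_derivative F y) (at y)" "continuous_on UNIV F"
    "\<And>y. y \<in> {a0<..<b0} \<Longrightarrow> om y \<in> subdifferential W (F y)"
    "\<And>y z. a0 < y \<Longrightarrow> y < z \<Longrightarrow> z < b0 \<Longrightarrow> \<bar>om z - om y\<bar> \<le> K * (z - y)"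
    "\<And>y z. a0 < y \<Longrightarrow> y < z \<Longrightarrow> z < b0 \<Longrightarrow> \<sigma> * (om z - om y) \<le> lam * (z - y)"
    "\<And>y. y \<in> {a..b} \<Longrightarrow> 0 \<le> \<sigma> * (ft y - f y)" "ft x' = f x'" "0 < \<sigma> * (ft a - f a)" "0 < \<sigma> * (ft b - f b)"
    using test_function_barrier[OF kink df cf' fac \<sigma> lam(1)] unfolding barrier_def by blast
  have "isCont (\<lambda>s. \<sigma> * deriv g s) t'"
    using cg t' by (auto simp: continuous_on_eq_continuous_at)
  moreover have "(lam + \<sigma> * deriv g t') / 2 < \<sigma> * deriv g t'" using lam(2) by simp
  ultimately have "\<forall>\<^sub>F s in nhds t'. (lam + \<sigma> * deriv g t') / 2 < \<sigma> * deriv g s"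
    using isCont_nhds order_tendstoD(1) by blast
  moreover have "\<forall>\<^sub>F s in nhds t'. s \<in> {0<..<T}" using t' by (intro eventually_nhds_in_open) auto
  ultimately have "\<forall>\<^sub>F s in nhds t'. s \<in> {0<..<T} \<and> (lam + \<sigma> * deriv g t') / 2 < \<sigma> * deriv g s"
    by eventually_elim auto
  then obtain d where d: "0 < d" "\<And>s. dist s t' < d \<Longrightarrow> s \<in> {0<..<T} \<and> (lam + \<sigma> * deriv g t') / 2 < \<sigma> * deriv g s"
    by (auto simp: eventually_nhds_metric)
  \<comment> \<open>The penalty has derivative at least \<open>- 2 * r\<close> on the interval, and
    \<open>2 * r\<close> is at most half of the gap between \<open>lam\<close> and the time
    derivative; the other half is spent on the continuity of \<open>deriv g\<close>.\<close>
  define r where "r = min (d / 2) ((\<sigma> * deriv g t' - lam) / 4)"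
  have r: "0 < r" "r < d" "2 * r \<le> (\<sigma> * deriv g t' - lam) / 2"
    using d(1) lam(2) by (auto simp: r_def min_def)
  have near: "s \<in> {0<..<T}" "lam + 2 * r \<le> \<sigma> * deriv g s" if "\<bar>s - t'\<bar> \<le> r" for s
  proof -
    have "dist s t' < d" using that r by (simp add: dist_real_def)
    then have s: "s \<in> {0<..<T}" "(lam + \<sigma> * deriv g t') / 2 < \<sigma> * deriv g s" using d(2) by blast+
    show "s \<in> {0<..<T}" by (rule s)
    have "2 * r \<le> (\<sigma> * deriv g t' - lam) / 2" by (rule r)
    then have "lam + 2 * r \<le> (lam + \<sigma> * deriv g t') / 2" by (simp add: field_simps)
    then show "lam + 2 * r \<le> \<sigma> * deriv g s" using s(2) by linarith
  qed
  define G where "G s = g s + \<sigma> * (s - t')\<^sup>2" for s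
  define G' where "G' s = deriv g s + \<sigma> * (2 * (s - t'))" for s
  \<comment> \<open>One entry for each part of the parabolic boundary: \<open>r\<^sup>2\<close> is
    the penalty at the initial time \<open>t' - r\<close>, the others are the distances of the
    barrier from \<open>f\<close> at \<open>a\<close> and at \<open>b\<close>.\<close>
  define d0 where "d0 = min (r\<^sup>2) (min (\<sigma> * (ft a - f a)) (\<sigma> * (ft b - f b)))"
  have d0: "0 < d0" "d0 \<le> r\<^sup>2" "d0 \<le> \<sigma> * (ft a - f a)" "d0 \<le> \<sigma> * (ft b - f b)" using r H by (auto simp: d0_def)
  have \<sigma>2: "\<sigma> * (\<sigma> * y) = y" for y using \<sigma> by auto
  have split: "\<sigma> * (u t x - ft x - G t) = \<sigma> * (u t x - f x - g t) - \<sigma> * (ft x - f x) - (t - t')\<^sup>2" for t x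
    using \<sigma>2[of "(t - t')\<^sup>2"] by (simp add: G_def algebra_simps)
  have dG: "(G has_real_derivative G' s) (at s)" if "s \<in> {0<..<T}" for s
    unfolding G_def G'_def by (auto intro!: derivative_eq_intros dg that)
  have cmp: "\<sigma> * (u t x - ft x - G t) \<le> - d0 / 2" if t: "\<bar>t - t'\<bar> < r" and x: "x \<in> {a<..<b}" for t x
  proof (rule barrier_comparison[OF en cont good W \<sigma> H(7,8,9,10,11) H(1) _ H(4,5,6)])
    show "a < b" using H by simp
    show "0 < t' - r" "t < T" using near(1)[of "t' - r"] near(1)[of t] r t by auto
    show "t' - r < t" using t by auto
    show "(G has_real_derivative G' s) (at s)" if "s \<in> {t' - r..t}" for s
      using that t by (intro dG near(1)) auto
    show "continuous_on {t' - r..t} G'"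
      unfolding G'_def using near(1) t
      by (intro continuous_intros continuous_on_subset[OF cg]) auto
    show "lam \<le> \<sigma> * G' s" if "s \<in> {t' - r..t}" for s
    proof -
      have "\<bar>s - t'\<bar> \<le> r" using that t by auto
      then have "lam + 2 * r \<le> \<sigma> * deriv g s" "- (2 * r) \<le> 2 * (s - t')" using near(2) by auto
      moreover have "\<sigma> * G' s = \<sigma> * deriv g s + 2 * (s - t')" unfolding G'_def distrib_left \<sigma>2 by simp
      ultimately show ?thesis by linarith
    qed
    show "0 < d0" by (rule d0)
    show "\<sigma> * (u s a - ft a - G s) \<le> - d0" "\<sigma> * (u s b - ft b - G s) \<le> - d0" if "s \<in> {t' - r..t}" for s
    proof -
      have "s \<in> {0<..<T}" using that t by (intro near(1)) auto
      then show "\<sigma> * (u s a - ft a - G s) \<le> - d0" "\<sigma> * (u s b - ft b - G s) \<le> - d0"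
        unfolding split using touch[of s a] touch[of s b] d0 zero_le_power2[of "s - t'"] by linarith+
    qed
    show "\<sigma> * (u (t' - r) y - ft y - G (t' - r)) \<le> - d0" if "y \<in> {a..b}" for y
      unfolding split using touch[of "t' - r" y] H(12)[OF that] d0(2) near(1)[of "t' - r"] r by auto
  qed (use x in auto)
  \<comment> \<open>At the touching point the barrier has the value of the test function. By
    continuity it exceeds that value, in the direction of \<sigma>, by less than
    \<open>d0 / 4\<close> nearby, so half of the gap \<open>d0 / 2\<close> survives.\<close>
  have "((\<lambda>z. \<sigma> * (ft (snd z) + G (fst z) - f x' - g t')) \<longlongrightarrow> \<sigma> * (ft x' + G t' - f x' - g t')) (nhds (t', x'))"
  proof -
    have "(ft \<longlongrightarrow> ft x') (nhds x')" by (rule isCont_nhds[OF DERIV_isCont[OF H(7)]])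
    moreover have "(G \<longlongrightarrow> G t') (nhds t')" by (rule isCont_nhds[OF DERIV_isCont[OF dG[OF t']]])
    ultimately show ?thesis
      unfolding nhds_prod
      by (intro tendsto_intros filterlim_compose[OF _ filterlim_snd] filterlim_compose[OF _ filterlim_fst])
  qed
  moreover have "\<sigma> * (ft x' + G t' - f x' - g t') < d0 / 4" using H(13) d0(1) by (simp add: G_def)
  ultimately have "\<forall>\<^sub>F z in nhds (t', x'). \<sigma> * (ft (snd z) + G (fst z) - f x' - g t') < d0 / 4"
    by (rule order_tendstoD)
  moreover have "\<forall>\<^sub>F z in nhds (t', x'). z \<in> {t' - r<..<t' + r} \<times> {a<..<b}"
    using r H by (intro eventually_nhds_in_open open_Times) auto
  ultimately have "\<forall>\<^sub>F (t, x) in nhds (t', x'). t \<in> {0<..<T} \<and> \<sigma> * (u t x - f x' - g t') \<le> - (d0 / 4)"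
  proof eventually_elim
    case (elim z)
    obtain t x where z: "z = (t, x)" by (cases z)
    have t: "\<bar>t - t'\<bar> < r" and x: "x \<in> {a<..<b}" using elim(2) z by auto
    have "\<sigma> * (u t x - f x' - g t') = \<sigma> * (u t x - ft x - G t) + \<sigma> * (ft x + G t - f x' - g t')"
      by (simp add: algebra_simps)
    then have "\<sigma> * (u t x - f x' - g t') \<le> - (d0 / 4)" using cmp[OF t x] elim(1) z by simp
    moreover have "t \<in> {0<..<T}" using t by (intro near(1)) auto
    ultimately show ?case by (simp add: z)
  qed
  then show ?thesis using d0(1) by (intro exI[of _ "d0 / 4"]) auto
qed

text \<open>The curvature sees \<open>f\<close> only through \<open>deriv f\<close>; so at a fixed
  time the summand \<open>g t'\<close> of an admissible function leaves it unchanged.\<close>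

lemma nonlocal_curvature_cong:
  assumes "deriv f = deriv h"
  shows "nonlocal_curvature W f = nonlocal_curvature W h"
  unfolding fun_eq_iff nonlocal_curvature_def faceted_region_def facet_def left_transition_def right_transition_def assms
  by simp

lemma admissible_test_derivatives:
  fixes f g :: "real \<Rightarrow> real"
  assumes \<phi>: "\<And>t x. t \<in> {0<..<T} \<Longrightarrow> \<phi> t x = f x + g t" and t': "t' \<in> {0<..<T}"
    and f: "C2P_torus P f" and g: "Ck_on 1 {0<..<T} g"
  shows "deriv (\<lambda>t. \<phi> t x') t' = deriv g t'" "nonlocal_curvature W (\<phi> t') = nonlocal_curvature W f"
proof -
  have "\<forall>j<2. \<forall>x. (deriv ^^ j) f differentiable (at x)"
    using f by (simp add: C2P_torus_def Ck_on_def)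
  from this[rule_format, of 0] have df: "(f has_real_derivative deriv f x) (at x)" for x
    by (simp add: DERIV_deriv_iff_real_differentiable)
  have dg: "(g has_real_derivative deriv g t') (at t')"
    using g t' by (auto simp: Ck_on_def DERIV_deriv_iff_real_differentiable)
  have "deriv (\<lambda>t. \<phi> t x') t' = deriv (\<lambda>t. f x' + g t) t'"
    by (rule deriv_eq_on_open[of "{0<..<T}"]) (use \<phi> t' in auto)
  also have "\<dots> = deriv g t'" by (rule DERIV_imp_deriv) (use DERIV_add[OF DERIV_const dg] in simp)
  finally show "deriv (\<lambda>t. \<phi> t x') t' = deriv g t'" .
  have "\<phi> t' = (\<lambda>x. f x + g t')" using \<phi>[OF t'] by auto
  moreover have "deriv (\<lambda>x. f x + g t') = deriv f"
    by (intro ext DERIV_imp_deriv) (use DERIV_add[OF df DERIV_const] in simp)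
  ultimately show "nonlocal_curvature W (\<phi> t') = nonlocal_curvature W f"
    by (intro nonlocal_curvature_cong) simp
qed

lemma le_upper_envelope: "u t x \<le> upper_envelope u t x"
  unfolding upper_envelope_def Limsup_def
proof (rule INF_greatest)
  fix P assume "P \<in> {P. eventually P (nhds (t, x))}"
  then have "P (t, x)" by (auto dest: eventually_nhds_x_imp_x)
  then show "u t x \<le> Sup ((\<lambda>(s, y). u s y) ` Collect P)" by (intro SUP_upper2[of "(t, x)"]) auto
qed

lemma lower_envelope_le: "lower_envelope u t x \<le> u t x"
  unfolding lower_envelope_def Liminf_def
proof (rule SUP_least)
  fix P assume "P \<in> {P. eventually P (nhds (t, x))}"
  then have "P (t, x)" by (auto dest: eventually_nhds_x_imp_x)
  then show "Inf ((\<lambda>(s, y). u s y) ` Collect P) \<le> u t x" by (intro INF_lower2[of "(t, x)"]) auto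
qed

lemma ereal_minus_real:
  fixes y :: ereal
  shows "y - ereal c = 0 \<Longrightarrow> y = ereal c" "y - ereal c \<le> 0 \<Longrightarrow> y \<le> ereal c" "0 \<le> y - ereal c \<Longrightarrow> ereal c \<le> y"
  by (cases y; simp add: zero_ereal_def)+

theorem theorem4p1:
  fixes T :: real
    and Np Nm :: nat
    and \<alpha>p \<beta>p \<alpha>m \<beta>m :: "nat \<Rightarrow> real"
    and W :: "real \<Rightarrow> real"
    and u0 :: "real \<Rightarrow> real"
    and u :: "real \<Rightarrow> real \<Rightarrow> real"
  assumes "T > 0"
    and "Np \<ge> 1" and "Nm \<ge> 1"
    and "\<forall>j\<in>{1..Np}. \<alpha>p j > 0" and "\<forall>j\<in>{1..Nm}. \<alpha>m j > 0"
    and "W = energy_density Np \<alpha>p \<beta>p Nm \<alpha>m \<beta>m"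
    and "BV_torus u0"
    and "energy_solution_from W (\<Sum>j=1..Np. \<alpha>p j) (\<Sum>j=1..Nm. \<alpha>m j) T u0 u"
    and "\<forall>t\<in>{0<..<T}. good_representative (u t)"
  shows "viscosity_solution W T (\<lambda>t x. ereal (u t x))"
proof -
  have en: "energy_solution W (\<Sum>j=1..Np. \<alpha>p j) (\<Sum>j=1..Nm. \<alpha>m j) T u" and cont: "L2_continuous T u"
    using assms(8) by (auto simp: energy_solution_from_def)
  have W: "- (\<Sum>j=1..Nm. \<alpha>m j) \<le> s \<and> s \<le> (\<Sum>j=1..Np. \<alpha>p j)" if "s \<in> subdifferential W p" for p s
    using energy_density_subdifferential_bounds[OF assms(4,5)] that unfolding assms(6) by blast
  have kink: "\<exists>A B e. kink W q A B e" for q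
    unfolding assms(6) by (rule energy_density_kink[OF assms(4,5)])
  have touching: "\<exists>c>0. \<forall>\<^sub>F (t, x) in nhds (t', x'). t \<in> {0<..<T} \<and> \<sigma> * (u t x - f x' - g t') \<le> - c"
    if "C2P_torus (jump_points W) f" "Ck_on 1 {0<..<T} g" "\<sigma> = 1 \<or> \<sigma> = -1" "t' \<in> {0<..<T}"
      "\<And>t x. t \<in> {0<..<T} \<Longrightarrow> \<sigma> * (u t x - f x - g t) \<le> 0"
      "\<sigma> * nonlocal_curvature W f x' < \<sigma> * deriv g t'" for f g x' t' and \<sigma> :: real
    by (rule no_touching[OF en cont assms(9)]) (fact W kink that)+
  have "viscosity_subsolution W T (\<lambda>t x. ereal (u t x))"
    unfolding viscosity_subsolution_def
  proof (intro allI impI, elim conjE, rule ccontr)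
    fix \<phi> t' x'
    assume adm: "admissible_test (jump_points W) T \<phi>" and t': "t' \<in> {0<..<T}"
      and eq: "upper_envelope (\<lambda>t x. ereal (u t x)) t' x' - ereal (\<phi> t' x') = 0"
      and le: "\<forall>t\<in>{0<..<T}. \<forall>x. upper_envelope (\<lambda>t x. ereal (u t x)) t x - ereal (\<phi> t x) \<le> 0"
      and not: "\<not> deriv (\<lambda>t. \<phi> t x') t' - nonlocal_curvature W (\<phi> t') x' \<le> 0"
    obtain f g where f: "C2P_torus (jump_points W) f" and g: "Ck_on 1 {0<..<T} g"
      and \<phi>: "\<And>t x. t \<in> {0<..<T} \<Longrightarrow> \<phi> t x = f x + g t"
      using adm unfolding admissible_test_def by blast
    note D = admissible_test_derivatives[OF \<phi> t' f g]
    \<comment> \<open>The inequality passes from the envelope to \<open>u\<close> itself, because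
      the neighbourhood filter includes the point.\<close>
    have "1 * (u t x - f x - g t) \<le> 0" if "t \<in> {0<..<T}" for t x
    proof -
      have "upper_envelope (\<lambda>t x. ereal (u t x)) t x \<le> ereal (\<phi> t x)" using le that ereal_minus_real(2) by blast
      then have "ereal (u t x) \<le> ereal (\<phi> t x)" using le_upper_envelope order_trans by metis
      then show ?thesis using \<phi>[OF that] by simp
    qed
    moreover have "1 * nonlocal_curvature W f x' < 1 * deriv g t'" using not D by simp
    ultimately obtain c where c: "0 < c" "\<forall>\<^sub>F (t, x) in nhds (t', x'). t \<in> {0<..<T} \<and> 1 * (u t x - f x' - g t') \<le> - c"
      using touching[OF f g, of 1 t' x'] t' by blast
    \<comment> \<open>The gap on a neighbourhood carries over to the limit superior, which was
      assumed to equal the test function.\<close>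
    have "upper_envelope (\<lambda>t x. ereal (u t x)) t' x' \<le> ereal (\<phi> t' x' - c)"
      unfolding upper_envelope_def
    proof (rule Limsup_bounded)
      show "\<forall>\<^sub>F z in nhds (t', x'). (case z of (s, y) \<Rightarrow> ereal (u s y)) \<le> ereal (\<phi> t' x' - c)"
        using c(2) by eventually_elim (use \<phi>[OF t'] in auto)
    qed
    then show False using ereal_minus_real(1)[OF eq] c(1) by simp
  qed
  moreover have "viscosity_supersolution W T (\<lambda>t x. ereal (u t x))"
    unfolding viscosity_supersolution_def
  proof (intro allI impI, elim conjE, rule ccontr)
    fix \<phi> t' x'
    assume adm: "admissible_test (jump_points W) T \<phi>" and t': "t' \<in> {0<..<T}"
      and eq: "lower_envelope (\<lambda>t x. ereal (u t x)) t' x' - ereal (\<phi> t' x') = 0"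
      and ge: "\<forall>t\<in>{0<..<T}. \<forall>x. lower_envelope (\<lambda>t x. ereal (u t x)) t x - ereal (\<phi> t x) \<ge> 0"
      and not: "\<not> deriv (\<lambda>t. \<phi> t x') t' - nonlocal_curvature W (\<phi> t') x' \<ge> 0"
    obtain f g where f: "C2P_torus (jump_points W) f" and g: "Ck_on 1 {0<..<T} g"
      and \<phi>: "\<And>t x. t \<in> {0<..<T} \<Longrightarrow> \<phi> t x = f x + g t"
      using adm unfolding admissible_test_def by blast
    note D = admissible_test_derivatives[OF \<phi> t' f g]
    have "- 1 * (u t x - f x - g t) \<le> 0" if "t \<in> {0<..<T}" for t x
    proof -
      have "ereal (\<phi> t x) \<le> lower_envelope (\<lambda>t x. ereal (u t x)) t x" using ge that ereal_minus_real(3) by blast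
      then have "ereal (\<phi> t x) \<le> ereal (u t x)" using lower_envelope_le order_trans by metis
      then show ?thesis using \<phi>[OF that] by simp
    qed
    moreover have "- 1 * nonlocal_curvature W f x' < - 1 * deriv g t'" using not D by simp
    ultimately obtain c where c: "0 < c" "\<forall>\<^sub>F (t, x) in nhds (t', x'). t \<in> {0<..<T} \<and> - 1 * (u t x - f x' - g t') \<le> - c"
      using touching[OF f g, of "- 1" t' x'] t' by blast
    have "ereal (\<phi> t' x' + c) \<le> lower_envelope (\<lambda>t x. ereal (u t x)) t' x'"
      unfolding lower_envelope_def
    proof (rule Liminf_bounded)
      show "\<forall>\<^sub>F z in nhds (t', x'). ereal (\<phi> t' x' + c) \<le> (case z of (s, y) \<Rightarrow> ereal (u s y))"
        using c(2) by eventually_elim (use \<phi>[OF t'] in auto)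
    qed
    then show False using ereal_minus_real(1)[OF eq] c(1) by simp
  qed
  ultimately show ?thesis by (simp add: viscosity_solution_def)
qed

end
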